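(* Let $\alpha\in\mathbb{R}$ with $\alpha\neq 0$, and let $\Phi\colon\Sigma\to\mathbb{R}^3$ be a smooth immersion of a connected, oriented surface $\Sigma$ with $0\notin\Phi(\Sigma)$. Suppose that $\Sigma$ is an $\alpha$-stationary surface and that the Gauss curvature $K$ of $\Sigma$ is constant. Then $\Sigma$ is a plane or a sphere, that is, $\Phi(\Sigma)$ is contained in an affine plane or in a round sphere of $\mathbb{R}^3$.
   Context: For $\alpha\in\mathbb{R}$, the energy of an immersion $\Phi\colon\Sigma\to\mathbb{R}^3$ is $E_\alpha[\Sigma]=\int_\Sigma|\Phi|^\alpha\,d\Sigma$, where $d\Sigma$ is the area element induced on $\Sigma$. Critical points of $E_\alpha$ are called $\alpha$-stationary surfaces (or simply stationary surfaces). When $0\notin\Phi(\Sigma)$, being $\alpha$-stationary is equivalent to the Euler-Lagrange equation $$H=\alpha\,\frac{\langle N,\Phi\rangle}{|\Phi|^2}\quad\text{on }\Sigma,$$ where $N$ is the unit normal (Gauss map) of $\Sigma$, the shape operator is $SX=-\overline{\nabla}_XN$ ($\overline{\nabla}$ the Levi-Civita connection of $\mathbb{R}^3$), $\kappa_1,\kappa_2$ are the principal curvatures (eigenvalues of $S$), $H=\kappa_1+\kappa_2$ is the mean curvature (sum, not average) and $K=\kappa_1\kappa_2$ is the Gauss curvature. Surfaces are not assumed complete or closed, so "a plane or a sphere" is understood as an open piece of one. *)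

theory Defs
  imports "HOL-Analysis.Analysis"
begin

text \<open>
  \<open>C\<^sup>k\<close> and \<open>C\<^sup>\<infinity>\<close> maps on an open set \<open>S\<close>, by iterated directional derivatives.  Only used for open \<open>S\<close>.
\<close>

primrec Ck_on :: "nat \<Rightarrow> ('a::real_normed_vector \<Rightarrow> 'b::real_normed_vector) \<Rightarrow> 'a set \<Rightarrow> bool" where
  "Ck_on 0 f S \<longleftrightarrow> continuous_on S f"
| "Ck_on (Suc k) f S \<longleftrightarrow>
     (\<forall>u\<in>S. f differentiable (at u)) \<and> (\<forall>v. Ck_on k (\<lambda>u. frechet_derivative f (at u) v) S)"

definition smooth_on :: "('a::real_normed_vector) set \<Rightarrow> ('a \<Rightarrow> 'b::real_normed_vector) \<Rightarrow> bool" where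
  "smooth_on S f \<longleftrightarrow> (\<forall>k. Ck_on k f S)"

text \<open>
  A surface is an abstract (Hausdorff, second countable) smooth 2-manifold without boundary, given by a
  topology and an atlas of local parametrizations: a chart \<open>(D, x)\<close> is a homeomorphism \<open>x\<close> from the open
  set \<open>D\<close> of the plane onto an open subset of the surface (values of \<open>x\<close> off \<open>D\<close> are irrelevant).  The
  orientation is carried by the atlas: coordinate changes have positive Jacobian determinant.
\<close>

type_synonym 'a chart = "(real^2) set \<times> (real^2 \<Rightarrow> 'a)"

definition oriented_surface :: "'a topology \<Rightarrow> 'a chart set \<Rightarrow> bool" where
  "oriented_surface X A \<longleftrightarrow>
     Hausdorff_space X \<and> second_countable X \<and>
     (\<forall>(D, x)\<in>A. open D \<and> openin X (x ` D) \<and>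
        homeomorphic_map (top_of_set D) (subtopology X (x ` D)) x) \<and>
     (\<Union>(D, x)\<in>A. x ` D) = topspace X \<and>
     (\<forall>(D, x)\<in>A. \<forall>(D', y)\<in>A.
        let W = {u\<in>D. x u \<in> y ` D'}; \<tau> = the_inv_into D' y \<circ> x
        in smooth_on W \<tau> \<and> (\<forall>u\<in>W. det (matrix (frechet_derivative \<tau> (at u))) > 0))"

definition smooth_map :: "'a chart set \<Rightarrow> ('a \<Rightarrow> real^3) \<Rightarrow> bool" where
  "smooth_map A F \<longleftrightarrow> (\<forall>(D, x)\<in>A. smooth_on D (F \<circ> x))"

definition smooth_immersion :: "'a chart set \<Rightarrow> ('a \<Rightarrow> real^3) \<Rightarrow> bool" where
  "smooth_immersion A \<Phi> \<longleftrightarrow> smooth_map A \<Phi> \<and>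
     (\<forall>(D, x)\<in>A. \<forall>u\<in>D. inj (frechet_derivative (\<Phi> \<circ> x) (at u)))"

definition coord_cross :: "(real^2 \<Rightarrow> real^3) \<Rightarrow> real^2 \<Rightarrow> real^3" where
  "coord_cross f u =
     cross3 (frechet_derivative f (at u) (axis 1 1)) (frechet_derivative f (at u) (axis 2 1))"

text \<open>
  The area element \<open>d\<Sigma>\<close> induced by \<open>\<Phi>\<close>: the Borel measure on the surface that equals
  \<open>|\<Phi>\<^sub>u \<times> \<Phi>\<^sub>v| du dv\<close> in every chart.  By the change of variables formula and second countability there is
  exactly one such measure, so the choice operator picks it.
\<close>

definition is_area_measure :: "'a topology \<Rightarrow> 'a chart set \<Rightarrow> ('a \<Rightarrow> real^3) \<Rightarrow> 'a measure \<Rightarrow> bool" where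
  "is_area_measure X A \<Phi> M \<longleftrightarrow>
     space M = topspace X \<and> sets M = sigma_sets (topspace X) {U. openin X U} \<and>
     (\<forall>(D, x)\<in>A. \<forall>B\<in>sets M. B \<subseteq> x ` D \<longrightarrow>
        emeasure M B =
          (\<integral>\<^sup>+u. ennreal (norm (coord_cross (\<Phi> \<circ> x) u)) * indicator {u\<in>D. x u \<in> B} u \<partial>lborel))"

definition area_measure :: "'a topology \<Rightarrow> 'a chart set \<Rightarrow> ('a \<Rightarrow> real^3) \<Rightarrow> 'a measure" where
  "area_measure X A \<Phi> = (SOME M. is_area_measure X A \<Phi> M)"

definition energy :: "real \<Rightarrow> 'a topology \<Rightarrow> 'a chart set \<Rightarrow> 'a set \<Rightarrow> ('a \<Rightarrow> real^3) \<Rightarrow> real" where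
  "energy \<alpha> X A C \<Phi> = (LINT p:C|area_measure X A \<Phi>. norm (\<Phi> p) powr \<alpha>)"

text \<open>
  Since the surface need not be compact, its total energy may be infinite; as usual, criticality is tested
  on smooth variations that are fixed off a compact set \<open>C\<close>, using the energy of \<open>C\<close>.  For an immersion
  \<open>\<Phi>\<close> avoiding the origin, every such variation consists, for small \<open>t\<close>, of immersions avoiding the
  origin, so neither property is demanded of \<open>\<Psi> t\<close>.
\<close>

definition compact_variation ::
  "'a topology \<Rightarrow> 'a chart set \<Rightarrow> ('a \<Rightarrow> real^3) \<Rightarrow> 'a set \<Rightarrow> real \<Rightarrow> (real \<Rightarrow> 'a \<Rightarrow> real^3) \<Rightarrow> bool" where
  "compact_variation X A \<Phi> C \<epsilon> \<Psi> \<longleftrightarrow>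
     compactin X C \<and> \<epsilon> > 0 \<and>
     (\<forall>(D, x)\<in>A. smooth_on ({-\<epsilon><..<\<epsilon>} \<times> D) (\<lambda>(t, u). \<Psi> t (x u))) \<and>
     (\<forall>p\<in>topspace X. \<Psi> 0 p = \<Phi> p) \<and>
     (\<forall>t\<in>{-\<epsilon><..<\<epsilon>}. \<forall>p\<in>topspace X - C. \<Psi> t p = \<Phi> p)"

definition alpha_stationary :: "real \<Rightarrow> 'a topology \<Rightarrow> 'a chart set \<Rightarrow> ('a \<Rightarrow> real^3) \<Rightarrow> bool" where
  "alpha_stationary \<alpha> X A \<Phi> \<longleftrightarrow>
     (\<forall>C \<epsilon> \<Psi>. compact_variation X A \<Phi> C \<epsilon> \<Psi> \<longrightarrow>
        ((\<lambda>t. energy \<alpha> X A C (\<Psi> t)) has_real_derivative 0) (at 0))"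

text \<open>
  The tangent space at \<open>p\<close> is identified with the coordinate plane by means of one chosen chart around \<open>p\<close>,
  and \<open>differential A F p\<close> is \<open>dF\<^sub>p\<close> under this identification.  The Gauss map, the tangent plane in space
  and the shape operator below do not depend on the choice (for the Gauss map because the atlas is oriented).
\<close>

definition chart_at :: "'a chart set \<Rightarrow> 'a \<Rightarrow> 'a chart" where
  "chart_at A p = (SOME c. c \<in> A \<and> p \<in> snd c ` fst c)"

definition differential :: "'a chart set \<Rightarrow> ('a \<Rightarrow> real^3) \<Rightarrow> 'a \<Rightarrow> real^2 \<Rightarrow> real^3" where
  "differential A F p =
     (let (D, x) = chart_at A p in frechet_derivative (F \<circ> x) (at (the_inv_into D x p)))"

definition gauss_map :: "'a chart set \<Rightarrow> ('a \<Rightarrow> real^3) \<Rightarrow> 'a \<Rightarrow> real^3" where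
  "gauss_map A \<Phi> p =
     sgn (cross3 (differential A \<Phi> p (axis 1 1)) (differential A \<Phi> p (axis 2 1)))"

definition tangent_plane :: "'a chart set \<Rightarrow> ('a \<Rightarrow> real^3) \<Rightarrow> 'a \<Rightarrow> (real^3) set" where
  "tangent_plane A \<Phi> p = range (differential A \<Phi> p)"

text \<open>
  \<open>S X = - \<nabla>\<^sub>X N\<close>, as an operator on the tangent plane in space: \<open>S (d\<Phi> v) = - dN v\<close>.
\<close>

definition shape_operator :: "'a chart set \<Rightarrow> ('a \<Rightarrow> real^3) \<Rightarrow> 'a \<Rightarrow> real^3 \<Rightarrow> real^3" where
  "shape_operator A \<Phi> p w =
     - differential A (gauss_map A \<Phi>) p (the_inv (differential A \<Phi> p) w)"

text \<open>
  The two eigenvalues of \<open>S\<close>, listed with multiplicity by means of an orthonormal eigenbasis of the tangent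
  plane; one exists because \<open>S\<close> is self-adjoint.
\<close>

definition principal_curvatures ::
  "'a chart set \<Rightarrow> ('a \<Rightarrow> real^3) \<Rightarrow> 'a \<Rightarrow> real \<Rightarrow> real \<Rightarrow> bool" where
  "principal_curvatures A \<Phi> p \<kappa>\<^sub>1 \<kappa>\<^sub>2 \<longleftrightarrow>
     (\<exists>e\<^sub>1\<in>tangent_plane A \<Phi> p. \<exists>e\<^sub>2\<in>tangent_plane A \<Phi> p.
        norm e\<^sub>1 = 1 \<and> norm e\<^sub>2 = 1 \<and> e\<^sub>1 \<bullet> e\<^sub>2 = 0 \<and>
        shape_operator A \<Phi> p e\<^sub>1 = \<kappa>\<^sub>1 *\<^sub>R e\<^sub>1 \<and> shape_operator A \<Phi> p e\<^sub>2 = \<kappa>\<^sub>2 *\<^sub>R e\<^sub>2)"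

definition gauss_curvature :: "'a chart set \<Rightarrow> ('a \<Rightarrow> real^3) \<Rightarrow> 'a \<Rightarrow> real" where
  "gauss_curvature A \<Phi> p = (THE K. \<exists>\<kappa>\<^sub>1 \<kappa>\<^sub>2. principal_curvatures A \<Phi> p \<kappa>\<^sub>1 \<kappa>\<^sub>2 \<and> K = \<kappa>\<^sub>1 * \<kappa>\<^sub>2)"

end

theory Submission
  imports Defs
begin

text \<open>
  The surface turns out to be totally umbilic, and totally umbilic surfaces are pieces of planes and spheres.

  Stationarity gives the Euler--Lagrange equation \<open>H |\<Phi>|\<^sup>2 = \<alpha> \<langle>N, \<Phi>\<rangle>\<close>. It is obtained from variations \<open>\<Phi> + t h v\<close> with a
  constant vector \<open>v\<close> and a bump function \<open>h\<close> in a chart: the energy is an integral over a box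
  (\<open>energy_chart\<close>), one differentiates under the integral sign (\<open>first_variation\<close>) and integrates by parts.
  That the energy means anything for the varied maps rests on the existence of the area measure
  (\<open>ex_area_measure\<close>). In a chart with \<open>F = \<Phi> \<circ> x\<close> and unit normal \<open>n\<close>, the two hypotheses then take the form
  \<open>F\<^sub>1 \<times> n\<^sub>2 + n\<^sub>1 \<times> F\<^sub>2 = - H F\<^sub>1 \<times> F\<^sub>2\<close> (\<open>mean_curvature_equation\<close>) and \<open>n\<^sub>1 \<times> n\<^sub>2 = K F\<^sub>1 \<times> F\<^sub>2\<close> (\<open>gauss_curvature_chart\<close>).

  Suppose that the principal curvatures \<open>k \<noteq> l\<close> differ on an open set. There is a smooth principal frame
  \<open>e\<^sub>1, e\<^sub>2\<close>, and the components \<open>a, b, s\<close> of the position vector in the frame \<open>e\<^sub>1, e\<^sub>2, n\<close>, together with \<open>k, l\<close>, satisfy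
  an overdetermined system: as \<open>k l\<close> is constant, the Euler--Lagrange and Codazzi equations determine all
  first derivatives, and the Gauss equation is one more relation. After the elimination of \<open>|\<Phi>|\<^sup>2\<close> this relation
  is linear in \<open>a\<^sup>2, b\<^sup>2, s\<^sup>2\<close> with coefficients that are homogeneous polynomials in \<open>k, l\<close> (\<open>gauss_polynomial\<close>), and so
  are its derivatives along \<open>e\<^sub>1\<close> and \<open>e\<^sub>2\<close> (\<open>gauss_polynomial_prolonged\<close>). These three equations have a
  non-trivial solution, so their determinant vanishes. It is a non-zero polynomial in \<open>l / k\<close>, which is
  therefore locally constant; but then \<open>p = q = 0\<close>, and the Gauss equation forces \<open>k l = 0\<close>
  (\<open>ratio_not_root\<close>). The values \<open>\<alpha> = 4\<close> and \<open>\<alpha> = -4\<close>, for which the determinant is the zero polynomial, and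
  the loci \<open>a = 0\<close> and \<open>b = 0\<close> lead to smaller determinants. The case \<open>k l = 0\<close> is excluded separately, along the
  rulings (\<open>l_not_zero\<close>). The contradiction is \<open>no_nonumbilic_patch\<close>.

  Hence \<open>H\<^sup>2 = 4 K\<close> and \<open>dN = - (H / 2) d\<Phi>\<close> everywhere. If \<open>K = 0\<close>, the normal is constant; otherwise the centre
  \<open>\<Phi> + (2 / H) N\<close> is constant (\<open>plane_or_sphere\<close>).
\<close>

section \<open>Calculus of \<open>C\<^sup>k\<close> maps\<close>

lemma Ck_on_cong_open:
  assumes "open S" "\<And>u. u \<in> S \<Longrightarrow> f u = g u" "Ck_on k f S"
  shows "Ck_on k g S"
  using assms(2,3)
proof (induction k arbitrary: f g)
  case 0
  then show ?case by (simp cong: continuous_on_cong)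
next
  case (Suc k)
  have d: "f differentiable (at u)" if "u \<in> S" for u using Suc.prems(2) that by simp
  have gd: "(g has_derivative frechet_derivative f (at u)) (at u)" if "u \<in> S" for u
    by (rule has_derivative_transform_within_open[OF d[OF that, unfolded frechet_derivative_works] assms(1) that Suc.prems(1)])
  have eq: "frechet_derivative f (at u) = frechet_derivative g (at u)" if "u \<in> S" for u
    by (rule frechet_derivative_at[OF gd[OF that]])
  show ?case
    unfolding Ck_on.simps
  proof safe
    show "g differentiable at u" if "u \<in> S" for u
      using gd[OF that] by (rule differentiableI)
    show "Ck_on k (\<lambda>u. frechet_derivative g (at u) v) S" for v
    proof (rule Suc.IH)
      show "Ck_on k (\<lambda>u. frechet_derivative f (at u) v) S" using Suc.prems(2) by simp
    qed (simp only: eq)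
  qed
qed

lemma Ck_on_subset: "Ck_on k f S \<Longrightarrow> T \<subseteq> S \<Longrightarrow> Ck_on k f T"
  by (induction k arbitrary: f) (auto intro: continuous_on_subset)

lemma Ck_on_imp_continuous_on: "Ck_on k f S \<Longrightarrow> continuous_on S f"
  by (cases k) (simp_all add: differentiable_imp_continuous_on differentiable_at_imp_differentiable_on)

lemma Ck_on_SucD: "Ck_on (Suc k) f S \<Longrightarrow> Ck_on k f S"
proof (induction k arbitrary: f)
  case 0
  then show ?case by (simp only: Ck_on.simps(1) Ck_on_imp_continuous_on)
qed simp

lemma Ck_on_local:
  assumes "\<And>u. u \<in> S \<Longrightarrow> \<exists>T. open T \<and> u \<in> T \<and> Ck_on k f T"
  shows "Ck_on k f S"
  using assms
proof (induction k arbitrary: f)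
  case 0
  have "continuous (at u) f" if u: "u \<in> S" for u
  proof -
    obtain T where "open T" "u \<in> T" "continuous_on T f" using "0.prems"[OF u] unfolding Ck_on.simps by blast
    then show ?thesis using continuous_on_eq_continuous_at by blast
  qed
  then show ?case by (simp add: continuous_at_imp_continuous_on)
next
  case (Suc k)
  show ?case
    unfolding Ck_on.simps
  proof safe
    show "f differentiable at u" if "u \<in> S" for u
      using Suc.prems[OF that] by auto
    show "Ck_on k (\<lambda>u. frechet_derivative f (at u) v) S" for v
      using Suc.prems unfolding Ck_on.simps by (intro Suc.IH) blast
  qed
qed

text \<open>The closure properties below all go by induction on \<open>k\<close>, with this introduction rule.\<close>

lemma Ck_on_SucI:
  assumes "open S" "\<And>u. u \<in> S \<Longrightarrow> (f has_derivative f' u) (at u)" "\<And>v. Ck_on k (\<lambda>u. f' u v) S"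
  shows "Ck_on (Suc k) f S"
proof -
  have "frechet_derivative f (at u) = f' u" if "u \<in> S" for u
    using assms(2)[OF that] by (metis frechet_derivative_at)
  then show ?thesis
    using assms Ck_on_cong_open[OF assms(1), of "\<lambda>u. f' u v" "\<lambda>u. frechet_derivative f (at u) v" for v]
    by (auto simp: differentiable_def)
qed

lemma Ck_on_Suc_has_derivative:
  "Ck_on (Suc k) f S \<Longrightarrow> u \<in> S \<Longrightarrow> (f has_derivative frechet_derivative f (at u)) (at u)"
  by (simp add: frechet_derivative_works)

lemma Ck_on_const: "open S \<Longrightarrow> Ck_on k (\<lambda>u. c) S"
  by (induction k arbitrary: c) auto

lemma Ck_on_bounded_linear:
  assumes "open S" "bounded_linear h" "Ck_on k f S"
  shows "Ck_on k (\<lambda>u. h (f u)) S"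
  using assms(3)
proof (induction k arbitrary: f)
  case 0
  then show ?case using bounded_linear.continuous_on[OF assms(2)] by auto
next
  case (Suc k)
  show ?case
    by (rule Ck_on_SucI[OF assms(1) bounded_linear.has_derivative[OF assms(2) Ck_on_Suc_has_derivative[OF Suc.prems]]])
      (use Suc in auto)
qed

lemma Ck_on_id: "open S \<Longrightarrow> Ck_on k (\<lambda>u. u) S"
  by (cases k) (auto simp: Ck_on_const)

lemma Ck_on_add:
  assumes "open S" "Ck_on k f S" "Ck_on k g S"
  shows "Ck_on k (\<lambda>u. f u + g u) S"
  using assms(2,3)
proof (induction k arbitrary: f g)
  case 0
  then show ?case by (auto intro: continuous_on_add)
next
  case (Suc k)
  show ?case
    by (rule Ck_on_SucI[OF assms(1) has_derivative_add[OF Ck_on_Suc_has_derivative[OF Suc.prems(1)]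
            Ck_on_Suc_has_derivative[OF Suc.prems(2)]]])
      (use Suc in auto)
qed

lemma Ck_on_bounded_bilinear:
  assumes "open S" "bounded_bilinear h" "Ck_on k f S" "Ck_on k g S"
  shows "Ck_on k (\<lambda>u. h (f u) (g u)) S"
  using assms(3,4)
proof (induction k arbitrary: f g)
  case 0
  then show ?case using bounded_bilinear.continuous_on[OF assms(2)] by auto
next
  case (Suc k)
  have "Ck_on k (\<lambda>u. h (f u) (frechet_derivative g (at u) v) + h (frechet_derivative f (at u) v) (g u)) S" for v
    using Suc.prems Ck_on_SucD[OF Suc.prems(1)] Ck_on_SucD[OF Suc.prems(2)]
    by (intro Ck_on_add assms(1) Suc.IH) auto
  from Ck_on_SucI[OF assms(1) bounded_bilinear.FDERIV[OF assms(2) Ck_on_Suc_has_derivative[OF Suc.prems(1)]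
            Ck_on_Suc_has_derivative[OF Suc.prems(2)]] this]
  show ?case by simp
qed

lemma Ck_on_compose_real:
  fixes g :: "'a::real_normed_vector \<Rightarrow> real" and \<psi> :: "real \<Rightarrow> 'b::real_normed_vector"
  assumes "open S" "open T" "g ` S \<subseteq> T" "Ck_on k g S" "Ck_on k \<psi> T"
  shows "Ck_on k (\<lambda>u. \<psi> (g u)) S"
  using assms(4,5)
proof (induction k arbitrary: \<psi>)
  case 0
  then show ?case
    using continuous_on_compose2[of T \<psi> S g] assms(3) by simp
next
  case (Suc k)
  have d: "((\<lambda>u. \<psi> (g u)) has_derivative
        (\<lambda>v. frechet_derivative g (at u) v *\<^sub>R frechet_derivative \<psi> (at (g u)) 1)) (at u)" if "u \<in> S" for u
  proof -
    have g: "(g has_derivative frechet_derivative g (at u)) (at u)"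
      using Suc.prems(1) that by (rule Ck_on_Suc_has_derivative)
    have p: "(\<psi> has_derivative frechet_derivative \<psi> (at (g u))) (at (g u))"
      using Suc.prems(2) that assms(3) by (intro Ck_on_Suc_has_derivative) auto
    have "frechet_derivative \<psi> (at (g u)) r = r *\<^sub>R frechet_derivative \<psi> (at (g u)) 1" for r
      using linear_scale[OF has_derivative_linear[OF p], of r 1] by simp
    then have "(\<lambda>v. frechet_derivative \<psi> (at (g u)) (frechet_derivative g (at u) v)) =
        (\<lambda>v. frechet_derivative g (at u) v *\<^sub>R frechet_derivative \<psi> (at (g u)) 1)"
      by blast
    then show ?thesis
      using has_derivative_compose[OF g p] by metis
  qed
  have "Ck_on k (\<lambda>u. frechet_derivative g (at u) v *\<^sub>R frechet_derivative \<psi> (at (g u)) 1) S" for v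
    using Suc.prems Ck_on_SucD[OF Suc.prems(1)]
    by (intro Ck_on_bounded_bilinear[OF assms(1) bounded_bilinear_scaleR] Suc.IH) auto
  from Ck_on_SucI[OF assms(1) d this] show ?case by simp
qed

lemma Ck_on_real_derivI:
  assumes "open T" "\<And>x. x \<in> T \<Longrightarrow> (\<psi> has_real_derivative \<psi>' x) (at x)" "Ck_on k \<psi>' T"
  shows "Ck_on (Suc k) \<psi> T"
  by (rule Ck_on_SucI[OF assms(1), where f' = "\<lambda>x v. \<psi>' x * v"])
    (use assms in \<open>auto simp: has_field_derivative_def
      intro!: Ck_on_bounded_bilinear[OF assms(1) bounded_bilinear_mult] Ck_on_const\<close>)

lemma Ck_on_powr: "Ck_on k (\<lambda>x::real. x powr a) {0<..}"
proof (induction k arbitrary: a)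
  case 0
  then show ?case by (auto intro!: continuous_intros)
next
  case (Suc k)
  have o: "open {0::real<..}" by auto
  show ?case
    by (rule Ck_on_real_derivI[OF o _ Ck_on_bounded_bilinear[OF o bounded_bilinear_mult Ck_on_const[OF o] Suc, of a "a - 1"]])
      (auto intro!: has_real_derivative_powr)
qed

lemma Ck_on_inverse: "Ck_on k (inverse :: real \<Rightarrow> real) (- {0})"
proof (induction k)
  case 0
  then show ?case by (auto intro!: continuous_intros)
next
  case (Suc k)
  have o: "open (- {0::real})" by auto
  show ?case
    by (rule Ck_on_real_derivI[OF o _ Ck_on_bounded_linear[OF o bounded_linear_minus[OF bounded_linear_ident]
            Ck_on_bounded_bilinear[OF o bounded_bilinear_mult Suc Suc]]])
      (use DERIV_inverse in \<open>simp add: numeral_2_eq_2\<close>)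
qed

subsection \<open>Smooth maps\<close>

lemma smooth_on_imp_Ck: "smooth_on S f \<Longrightarrow> Ck_on k f S"
  by (simp add: smooth_on_def)

lemma smooth_on_has_derivative:
  "smooth_on S f \<Longrightarrow> u \<in> S \<Longrightarrow> (f has_derivative frechet_derivative f (at u)) (at u)"
  by (rule Ck_on_Suc_has_derivative[of 0 f S, OF smooth_on_imp_Ck])

lemma smooth_on_imp_continuous_on: "smooth_on S f \<Longrightarrow> continuous_on S f"
  by (rule Ck_on_imp_continuous_on[of 0, OF smooth_on_imp_Ck])

lemma smooth_on_frechet_derivative:
  "smooth_on S f \<Longrightarrow> smooth_on S (\<lambda>u. frechet_derivative f (at u) v)"
  unfolding smooth_on_def by (metis Ck_on.simps(2))

lemma smooth_on_subset: "smooth_on S f \<Longrightarrow> T \<subseteq> S \<Longrightarrow> smooth_on T f"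
  unfolding smooth_on_def by (auto intro: Ck_on_subset)

lemma smooth_on_cong_open:
  "open S \<Longrightarrow> (\<And>u. u \<in> S \<Longrightarrow> f u = g u) \<Longrightarrow> smooth_on S f \<Longrightarrow> smooth_on S g"
  unfolding smooth_on_def by (auto intro: Ck_on_cong_open[of S f g])

lemma smooth_on_local:
  "(\<And>u. u \<in> S \<Longrightarrow> \<exists>T. open T \<and> u \<in> T \<and> smooth_on T f) \<Longrightarrow> smooth_on S f"
  unfolding smooth_on_def by (rule allI, rule Ck_on_local) meson

lemma smooth_on_const: "open S \<Longrightarrow> smooth_on S (\<lambda>u. c)"
  unfolding smooth_on_def by (rule allI, rule Ck_on_const) auto

lemma smooth_on_id: "open S \<Longrightarrow> smooth_on S (\<lambda>u. u)"
  unfolding smooth_on_def by (rule allI, rule Ck_on_id) auto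

lemma smooth_on_bounded_linear:
  "open S \<Longrightarrow> bounded_linear h \<Longrightarrow> smooth_on S f \<Longrightarrow> smooth_on S (\<lambda>u. h (f u))"
  unfolding smooth_on_def by (rule allI, rule Ck_on_bounded_linear) auto

lemma smooth_on_add:
  "open S \<Longrightarrow> smooth_on S f \<Longrightarrow> smooth_on S g \<Longrightarrow> smooth_on S (\<lambda>u. f u + g u)"
  unfolding smooth_on_def by (rule allI, rule Ck_on_add) auto

lemma smooth_on_bounded_bilinear:
  "open S \<Longrightarrow> bounded_bilinear h \<Longrightarrow> smooth_on S f \<Longrightarrow> smooth_on S g \<Longrightarrow> smooth_on S (\<lambda>u. h (f u) (g u))"
  unfolding smooth_on_def by (rule allI, rule Ck_on_bounded_bilinear) auto

lemma smooth_on_minus: "open S \<Longrightarrow> smooth_on S f \<Longrightarrow> smooth_on S (\<lambda>u. - f u)"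
  by (rule smooth_on_bounded_linear[OF _ bounded_linear_minus[OF bounded_linear_ident]])

lemma smooth_on_diff:
  "open S \<Longrightarrow> smooth_on S f \<Longrightarrow> smooth_on S g \<Longrightarrow> smooth_on S (\<lambda>u. f u - g u)"
  using smooth_on_add[of S f "\<lambda>u. - g u"] smooth_on_minus[of S g] by simp

lemmas smooth_on_mult = smooth_on_bounded_bilinear[OF _ bounded_bilinear_mult]
lemmas smooth_on_scaleR = smooth_on_bounded_bilinear[OF _ bounded_bilinear_scaleR]
lemmas smooth_on_inner = smooth_on_bounded_bilinear[OF _ bounded_bilinear_inner]
lemmas smooth_on_vec_nth = smooth_on_bounded_linear[OF _ bounded_linear_vec_nth]

lemma bounded_bilinear_cross3: "bounded_bilinear cross3"
  using bilinear_conv_bounded_bilinear bilinear_cross by blast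

lemmas smooth_on_cross3 = smooth_on_bounded_bilinear[OF _ bounded_bilinear_cross3]

lemma smooth_on_powr:
  fixes f :: "_ \<Rightarrow> real"
  assumes "open S" "smooth_on S f" "\<And>u. u \<in> S \<Longrightarrow> 0 < f u"
  shows "smooth_on S (\<lambda>u. f u powr a)"
  unfolding smooth_on_def
  by (rule allI, rule Ck_on_compose_real[where T = "{0<..}" and \<psi> = "\<lambda>x. x powr a"])
    (use assms in \<open>auto simp: Ck_on_powr smooth_on_def\<close>)

lemma smooth_on_inverse:
  assumes "open S" "smooth_on S f" "\<And>u. u \<in> S \<Longrightarrow> f u \<noteq> (0::real)"
  shows "smooth_on S (\<lambda>u. inverse (f u))"
  unfolding smooth_on_def
  by (rule allI, rule Ck_on_compose_real[where T = "- {0}" and \<psi> = inverse])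
    (use assms in \<open>auto simp: Ck_on_inverse smooth_on_def\<close>)

lemma smooth_on_divide:
  assumes "open S" "smooth_on S f" "smooth_on S g" "\<And>u. u \<in> S \<Longrightarrow> g u \<noteq> (0::real)"
  shows "smooth_on S (\<lambda>u. f u / g u)"
  unfolding divide_inverse using assms by (intro smooth_on_mult smooth_on_inverse) auto

lemma smooth_on_sqrt:
  fixes f :: "_ \<Rightarrow> real"
  assumes "open S" "smooth_on S f" "\<And>u. u \<in> S \<Longrightarrow> 0 < f u"
  shows "smooth_on S (\<lambda>u. sqrt (f u))"
  by (rule smooth_on_cong_open[OF assms(1) _ smooth_on_powr[OF assms, of "1/2"]])
    (auto simp: powr_half_sqrt assms(3) less_imp_le)

lemma smooth_on_norm:
  fixes f :: "_ \<Rightarrow> 'b::real_inner"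
  assumes "open S" "smooth_on S f" "\<And>u. u \<in> S \<Longrightarrow> f u \<noteq> 0"
  shows "smooth_on S (\<lambda>u. norm (f u))"
  unfolding norm_eq_sqrt_inner
  using assms by (intro smooth_on_sqrt smooth_on_inner) auto

lemma smooth_on_sgn:
  fixes f :: "_ \<Rightarrow> 'b::real_inner"
  assumes "open S" "smooth_on S f" "\<And>u. u \<in> S \<Longrightarrow> f u \<noteq> 0"
  shows "smooth_on S (\<lambda>u. sgn (f u))"
  unfolding sgn_div_norm
  using assms by (intro smooth_on_scaleR smooth_on_inverse smooth_on_norm) auto

subsection \<open>Symmetry of second derivatives\<close>

text \<open>The mean value theorem, applied in the direction \<open>v\<close> to \<open>u \<mapsto> f (u + s w) - f u\<close>, and then
  in the direction \<open>w\<close>.\<close>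

lemma second_difference_mean_value:
  fixes f :: "'a::real_normed_vector \<Rightarrow> real"
  assumes f: "Ck_on 2 f S" and s: "0 < s"
    and S: "\<And>a b. 0 \<le> a \<Longrightarrow> a \<le> s \<Longrightarrow> 0 \<le> b \<Longrightarrow> b \<le> s \<Longrightarrow> x + a *\<^sub>R v + b *\<^sub>R w \<in> S"
  shows "\<exists>a b. 0 \<le> a \<and> a \<le> s \<and> 0 \<le> b \<and> b \<le> s \<and>
    f (x + s *\<^sub>R v + s *\<^sub>R w) - f (x + s *\<^sub>R v) - f (x + s *\<^sub>R w) + f x =
       s\<^sup>2 * frechet_derivative (\<lambda>u. frechet_derivative f (at u) v) (at (x + a *\<^sub>R v + b *\<^sub>R w)) w"
proof -
  let ?d = "\<lambda>u. frechet_derivative f (at u)"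
  let ?g = "\<lambda>a. f (x + a *\<^sub>R v + s *\<^sub>R w) - f (x + a *\<^sub>R v + 0 *\<^sub>R w)"
  have f2: "Ck_on (Suc (Suc 0)) f S" using f by (simp only: numeral_2_eq_2)
  have fd: "(f has_derivative ?d u) (at u)" if "u \<in> S" for u
    using f2 that by (rule Ck_on_Suc_has_derivative)
  have fl: "((\<lambda>a. f (x + a *\<^sub>R v + b *\<^sub>R w)) has_real_derivative ?d (x + a *\<^sub>R v + b *\<^sub>R w) v) (at a)"
    if "0 \<le> a" "a \<le> s" "0 \<le> b" "b \<le> s" for a b
  proof -
    have "((\<lambda>a. x + a *\<^sub>R v + b *\<^sub>R w) has_derivative (\<lambda>r. r *\<^sub>R v)) (at a)"
      by (auto intro!: derivative_eq_intros)
    from has_derivative_compose[OF this fd[OF S[OF that]]]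
    show ?thesis
      using linear_scale[OF has_derivative_linear[OF fd[OF S[OF that]]]]
      by (simp add: has_field_derivative_def mult_commute_abs)
  qed
  have gd: "(?g has_real_derivative (?d (x + a *\<^sub>R v + s *\<^sub>R w) v - ?d (x + a *\<^sub>R v + 0 *\<^sub>R w) v)) (at a)"
    if "0 \<le> a" "a \<le> s" for a
    using that s by (intro DERIV_diff fl) auto
  obtain a where a: "0 < a" "a < s" "?g s - ?g 0 = (s - 0) *
      (?d (x + a *\<^sub>R v + s *\<^sub>R w) v - ?d (x + a *\<^sub>R v + 0 *\<^sub>R w) v)"
    using MVT2[OF s, of ?g "\<lambda>a. ?d (x + a *\<^sub>R v + s *\<^sub>R w) v - ?d (x + a *\<^sub>R v + 0 *\<^sub>R w) v"] gd by auto
  let ?h = "\<lambda>b. ?d (x + a *\<^sub>R v + b *\<^sub>R w) v"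
  let ?e = "\<lambda>b. frechet_derivative (\<lambda>u. ?d u v) (at (x + a *\<^sub>R v + b *\<^sub>R w)) w"
  have hd: "(?h has_real_derivative ?e b) (at b)" if "0 \<le> b" "b \<le> s" for b
  proof -
    have p: "x + a *\<^sub>R v + b *\<^sub>R w \<in> S" using S a that by auto
    have C1: "Ck_on (Suc 0) (\<lambda>u. ?d u v) S" using f2 by (metis Ck_on.simps(2))
    have "((\<lambda>b. x + a *\<^sub>R v + b *\<^sub>R w) has_derivative (\<lambda>r. r *\<^sub>R w)) (at b)"
      by (auto intro!: derivative_eq_intros)
    from has_derivative_compose[OF this Ck_on_Suc_has_derivative[OF C1 p]]
    show ?thesis
      using linear_scale[OF has_derivative_linear[OF Ck_on_Suc_has_derivative[OF C1 p]]]
      by (simp add: has_field_derivative_def mult_commute_abs)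
  qed
  obtain b where b: "0 < b" "b < s" "?h s - ?h 0 = (s - 0) * ?e b"
    using MVT2[OF s, of ?h ?e] hd by auto
  show ?thesis
    by (rule exI[of _ a], rule exI[of _ b]) (use a b in \<open>auto simp: power2_eq_square\<close>)
qed

text \<open>The second difference is symmetric in \<open>v\<close> and \<open>w\<close>; divided by \<open>s\<^sup>2\<close> it tends to either
  second derivative.\<close>

lemma second_derivative_symmetric_real:
  fixes f :: "'a::real_normed_vector \<Rightarrow> real"
  assumes "open S" "Ck_on 2 f S" "x \<in> S"
  shows "frechet_derivative (\<lambda>u. frechet_derivative f (at u) v) (at x) w =
         frechet_derivative (\<lambda>u. frechet_derivative f (at u) w) (at x) v"
proof -
  let ?D = "\<lambda>v w u. frechet_derivative (\<lambda>u. frechet_derivative f (at u) v) (at u) w"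
  obtain r where r: "r > 0" "ball x r \<subseteq> S" using assms openE by blast
  define M where "M = norm v + norm w + 1"
  have M: "M > 0" unfolding M_def by (smt (verit) norm_ge_zero)
  have near: "x + a *\<^sub>R v + b *\<^sub>R w \<in> ball x (s * M)" if "0 \<le> a" "a \<le> s" "0 \<le> b" "b \<le> s" "0 < s" for a b s
  proof -
    have "norm (a *\<^sub>R v + b *\<^sub>R w) \<le> a * norm v + b * norm w"
      using norm_triangle_ineq[of "a *\<^sub>R v" "b *\<^sub>R w"] that by simp
    also have "\<dots> \<le> s * norm v + s * norm w"
      using that by (intro add_mono mult_right_mono) auto
    also have "\<dots> < s * M" using that unfolding M_def by (simp add: algebra_simps)
    finally have "norm (a *\<^sub>R v + b *\<^sub>R w) < s * M" .
    moreover have "dist x (x + a *\<^sub>R v + b *\<^sub>R w) = norm (a *\<^sub>R v + b *\<^sub>R w)"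
      using norm_minus_cancel[of "a *\<^sub>R v + b *\<^sub>R w"] by (simp add: dist_norm algebra_simps del: norm_minus_cancel)
    ultimately show ?thesis by simp
  qed
  have cont: "continuous_on S (?D v w)" for v w
    using assms(2) unfolding numeral_2_eq_2 Ck_on.simps by blast
  have "\<bar>?D v w x - ?D w v x\<bar> \<le> 2 * e" if e: "e > 0" for e
  proof -
    have "\<exists>d>0. \<forall>y\<in>S. dist y x < d \<longrightarrow> dist (?D v w y) (?D v w x) < e" for v w
      using cont[of v w] assms(3) e unfolding continuous_on_iff by blast
    then obtain d1 d2 where d: "d1 > 0" "d2 > 0"
      "\<forall>y\<in>S. dist y x < d1 \<longrightarrow> dist (?D v w y) (?D v w x) < e"
      "\<forall>y\<in>S. dist y x < d2 \<longrightarrow> dist (?D w v y) (?D w v x) < e" by metis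
    define s where "s = min r (min d1 d2) / M"
    have s: "s > 0" unfolding s_def using d r M by auto
    have sM: "s * M \<le> r" "s * M \<le> d1" "s * M \<le> d2" unfolding s_def using M by auto
    have inS: "x + a *\<^sub>R v + b *\<^sub>R w \<in> S" if "0 \<le> a" "a \<le> s" "0 \<le> b" "b \<le> s" for a b
      using near[OF that s] subset_ball[OF sM(1)] r(2) by blast
    obtain a b where 1: "0 \<le> a" "a \<le> s" "0 \<le> b" "b \<le> s"
      "f (x + s *\<^sub>R v + s *\<^sub>R w) - f (x + s *\<^sub>R v) - f (x + s *\<^sub>R w) + f x = s\<^sup>2 * ?D v w (x + a *\<^sub>R v + b *\<^sub>R w)"
      using second_difference_mean_value[OF assms(2) s inS] by blast
    obtain b' a' where 2: "0 \<le> a'" "a' \<le> s" "0 \<le> b'" "b' \<le> s"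
      "f (x + s *\<^sub>R w + s *\<^sub>R v) - f (x + s *\<^sub>R w) - f (x + s *\<^sub>R v) + f x = s\<^sup>2 * ?D w v (x + b' *\<^sub>R w + a' *\<^sub>R v)"
    proof -
      have "x + b *\<^sub>R w + a *\<^sub>R v \<in> S" if "0 \<le> b" "b \<le> s" "0 \<le> a" "a \<le> s" for a b
        using inS[OF that(3,4,1,2)] by (simp only: ac_simps)
      from second_difference_mean_value[OF assms(2) s this] show ?thesis using that by blast
    qed
    have sw: "x + s *\<^sub>R w + s *\<^sub>R v = x + s *\<^sub>R v + s *\<^sub>R w"
      "x + b' *\<^sub>R w + a' *\<^sub>R v = x + a' *\<^sub>R v + b' *\<^sub>R w" by (simp_all only: ac_simps)
    have "s\<^sup>2 * ?D v w (x + a *\<^sub>R v + b *\<^sub>R w) = s\<^sup>2 * ?D w v (x + a' *\<^sub>R v + b' *\<^sub>R w)"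
      using 1(5) 2(5) unfolding sw by linarith
    then have eq: "?D v w (x + a *\<^sub>R v + b *\<^sub>R w) = ?D w v (x + a' *\<^sub>R v + b' *\<^sub>R w)" using s by simp
    have "dist (?D v w (x + a *\<^sub>R v + b *\<^sub>R w)) (?D v w x) < e"
    proof -
      have "dist (x + a *\<^sub>R v + b *\<^sub>R w) x < d1"
        using near[OF 1(1-4) s] sM(2) unfolding mem_ball dist_commute[of x] by linarith
      then show ?thesis using d(3) inS[OF 1(1-4)] by blast
    qed
    moreover have "dist (?D w v (x + a' *\<^sub>R v + b' *\<^sub>R w)) (?D w v x) < e"
    proof -
      have "dist (x + a' *\<^sub>R v + b' *\<^sub>R w) x < d2"
        using near[OF 2(1-4) s] sM(3) unfolding mem_ball dist_commute[of x] by linarith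
      then show ?thesis using d(4) inS[OF 2(1-4)] by blast
    qed
    ultimately show ?thesis using eq unfolding dist_real_def by linarith
  qed
  note le = this
  define z where "z = \<bar>?D v w x - ?D w v x\<bar>"
  have "z \<le> 2 * e" if "e > 0" for e using le[OF that] unfolding z_def .
  from this[of "z / 4"] have "z \<le> 0" by linarith
  then show ?thesis unfolding z_def by simp
qed

lemma frechet_derivative_bounded_linear:
  assumes "bounded_linear h" "f differentiable (at u)"
  shows "frechet_derivative (\<lambda>u. h (f u)) (at u) v = h (frechet_derivative f (at u) v)"
  using bounded_linear.has_derivative[OF assms(1)] assms(2)
  by (metis frechet_derivative_at frechet_derivative_works)

lemma second_derivative_symmetric:
  fixes f :: "'a::real_normed_vector \<Rightarrow> 'b::real_inner"
  assumes "open S" "smooth_on S f" "x \<in> S"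
  shows "frechet_derivative (\<lambda>u. frechet_derivative f (at u) v) (at x) w =
         frechet_derivative (\<lambda>u. frechet_derivative f (at u) w) (at x) v"
proof -
  have *: "frechet_derivative (\<lambda>u. frechet_derivative (\<lambda>u. f u \<bullet> c) (at u) v) (at x) w =
        frechet_derivative (\<lambda>u. frechet_derivative f (at u) v) (at x) w \<bullet> c" for v w c
  proof -
    have d: "f differentiable (at u)" if "u \<in> S" for u
      using smooth_on_has_derivative[OF assms(2) that] differentiableI by blast
    have d2: "(\<lambda>u. frechet_derivative f (at u) v) differentiable (at x)"
      using smooth_on_has_derivative[OF smooth_on_frechet_derivative[OF assms(2)] assms(3)] differentiableI by blast
    have e: "frechet_derivative (\<lambda>u. f u \<bullet> c) (at u) v = frechet_derivative f (at u) v \<bullet> c" if "u \<in> S" for u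
      by (rule frechet_derivative_bounded_linear[OF bounded_linear_inner_left d[OF that]])
    have "frechet_derivative (\<lambda>u. frechet_derivative f (at u) v \<bullet> c) (at x) =
        frechet_derivative (\<lambda>u. frechet_derivative (\<lambda>u. f u \<bullet> c) (at u) v) (at x)"
      by (rule frechet_derivative_transform_within_open[OF _ assms(1,3)])
        (use e d2 in \<open>auto intro!: differentiable_compose[OF bounded_linear_imp_differentiable[OF bounded_linear_inner_left]]\<close>)
    then show ?thesis
      using frechet_derivative_bounded_linear[OF bounded_linear_inner_left d2, of c w] by simp
  qed
  have "Ck_on 2 (\<lambda>u. f u \<bullet> c) S" for c
    using smooth_on_bounded_linear[OF assms(1) bounded_linear_inner_left assms(2)] by (simp add: smooth_on_def)
  from second_derivative_symmetric_real[OF assms(1) this assms(3)]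
  have "frechet_derivative (\<lambda>u. frechet_derivative f (at u) v) (at x) w \<bullet> c =
      frechet_derivative (\<lambda>u. frechet_derivative f (at u) w) (at x) v \<bullet> c" for c
    unfolding *[symmetric] .
  then show ?thesis by (rule vector_eq_rdot[THEN iffD1, OF allI])
qed

section \<open>The overdetermined system along a principal frame\<close>

text \<open>The derivative of \<open>f\<close> at \<open>u\<close> in the direction of the vector field \<open>V\<close>, as a derivative in one real variable, so that the
  rules for real functions apply to long rational expressions.\<close>

definition line_deriv :: "('a::real_normed_vector \<Rightarrow> 'a) \<Rightarrow> ('a \<Rightarrow> real) \<Rightarrow> 'a \<Rightarrow> real \<Rightarrow> bool" where
  "line_deriv V f u d \<longleftrightarrow> ((\<lambda>t. f (u + t *\<^sub>R V u)) has_real_derivative d) (at 0)"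

text \<open>An identity between functions on an open set may be differentiated.\<close>

lemma line_deriv_unique_open:
  assumes "open S" "u \<in> S" "\<And>w. w \<in> S \<Longrightarrow> f w = g w" "line_deriv V f u d" "line_deriv V g u e"
  shows "d = e"
proof -
  have "isCont (\<lambda>t::real. u + t *\<^sub>R V u) 0" by (intro continuous_intros)
  then have "((\<lambda>t. u + t *\<^sub>R V u) \<longlongrightarrow> u) (nhds 0)"
    using isCont_def tendsto_at_iff_tendsto_nhds[of "\<lambda>t. u + t *\<^sub>R V u" "0::real"] by fastforce
  from topological_tendstoD[OF this assms(1,2)]
  have "\<forall>\<^sub>F t in nhds 0. f (u + t *\<^sub>R V u) = g (u + t *\<^sub>R V u)"
    by (rule eventually_mono) (rule assms(3))
  from DERIV_cong_ev[OF refl this refl, of d] assms(4)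
  have "((\<lambda>t. g (u + t *\<^sub>R V u)) has_real_derivative d) (at 0)"
    unfolding line_deriv_def by blast
  from DERIV_unique[OF this] assms(5) show ?thesis unfolding line_deriv_def by blast
qed

lemma line_deriv_const_open:
  assumes "open S" "u \<in> S" "\<And>w. w \<in> S \<Longrightarrow> f w = c" "line_deriv V f u d"
  shows "d = 0"
  by (rule line_deriv_unique_open[OF assms(1-4)]) (auto simp: line_deriv_def)

text \<open>The coefficients of the Gauss equation (\<open>PX\<close>, its reflection in \<open>k\<close> and \<open>l\<close>, and \<open>PZ\<close>) and of its derivative along the
  first principal direction (\<open>QX\<close>, \<open>QY\<close>, \<open>QZ\<close>), both read as linear equations for the squares of the components of
  the position vector.\<close>

definition PX :: "real \<Rightarrow> real \<Rightarrow> real \<Rightarrow> real" where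
  "PX \<alpha> k l = 1 * k^4 + (3*\<alpha> + 1*\<alpha>^2) * k^3 * l + (14 + 10*\<alpha> + 1*\<alpha>^2) * k^2 * l^2 + (16 + 3*\<alpha>) * k * l^3 + 1 * l^4"

definition PZ :: "real \<Rightarrow> real \<Rightarrow> real \<Rightarrow> real" where
  "PZ \<alpha> k l = 1 * k^4 + (4 + 3*\<alpha> + 1*\<alpha>^2) * k^3 * l + (6 + 6*\<alpha>) * k^2 * l^2 + (4 + 3*\<alpha> + 1*\<alpha>^2) * k * l^3 + 1 * l^4"

definition QX :: "real \<Rightarrow> real \<Rightarrow> real \<Rightarrow> real" where
  "QX \<alpha> k l = (16 + 8*\<alpha> + 5*\<alpha>^2 + 1*\<alpha>^3) * k^4 + (48 + 128*\<alpha> + 53*\<alpha>^2 + 5*\<alpha>^3) * k^3 * l + (432 + 344*\<alpha> + 67*\<alpha>^2 + 4*\<alpha>^3) * k^2 * l^2 + (400 + 128*\<alpha> + 11*\<alpha>^2) * k * l^3"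

definition QY :: "real \<Rightarrow> real \<Rightarrow> real \<Rightarrow> real" where
  "QY \<alpha> k l = (64 + 24*\<alpha> + 2*\<alpha>^2) * k^4 + (464 + 192*\<alpha> + 27*\<alpha>^2 + 1*\<alpha>^3) * k^3 * l + (368 + 328*\<alpha> + 71*\<alpha>^2 + 5*\<alpha>^3) * k^2 * l^2 + ((-16) + 64*\<alpha> + 37*\<alpha>^2 + 4*\<alpha>^3) * k * l^3 + (16 + (-1)*\<alpha>^2) * l^4"

definition QZ :: "real \<Rightarrow> real \<Rightarrow> real \<Rightarrow> real" where
  "QZ \<alpha> k l = (16 + 8*\<alpha> + 5*\<alpha>^2 + 1*\<alpha>^3) * k^4 + (64 + 96*\<alpha> + 42*\<alpha>^2 + 4*\<alpha>^3) * k^3 * l + (96 + 168*\<alpha> + 40*\<alpha>^2 + 5*\<alpha>^3) * k^2 * l^2 + (64 + 80*\<alpha> + 50*\<alpha>^2 + 6*\<alpha>^3) * k * l^3 + (16 + (-1)*\<alpha>^2) * l^4"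


text \<open>The scalar equations satisfied along a principal frame \<open>e\<^sub>1, e\<^sub>2, n\<close>. The functions \<open>a, b, s\<close> are the components
  \<open>\<langle>\<Phi>, e\<^sub>1\<rangle>, \<langle>\<Phi>, e\<^sub>2\<rangle>, \<langle>\<Phi>, n\<rangle>\<close> of the position, \<open>k\<close> and \<open>l\<close> the principal curvatures, and \<open>p, q\<close> the connection
  coefficients: \<open>\<nabla> e\<^sub>1\<close> is \<open>p e\<^sub>2\<close> along \<open>e\<^sub>1\<close> and \<open>q e\<^sub>2\<close> along \<open>e\<^sub>2\<close>. The assumptions are the derivatives of the
  position, the Codazzi equations \<open>k2\<close> and \<open>l1\<close>, the Gauss equation, and the Euler--Lagrange equation \<open>H\<close>.\<close>

locale curvature_frame =
  fixes W :: "'a::real_normed_vector set" and V1 V2 :: "'a \<Rightarrow> 'a"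
    and a b s k l p q p2 q1 :: "'a \<Rightarrow> real" and \<alpha> c :: real
  assumes W: "open W" "W \<noteq> {}" and \<alpha>: "\<alpha> \<noteq> 0"
    and cont: "continuous_on W a" "continuous_on W b" "continuous_on W k" "continuous_on W l"
    and kl: "\<And>u. u \<in> W \<Longrightarrow> k u \<noteq> l u" "\<And>u. u \<in> W \<Longrightarrow> k u * l u = c"
    and pos: "\<And>u. u \<in> W \<Longrightarrow> (a u)\<^sup>2 + (b u)\<^sup>2 + (s u)\<^sup>2 > 0"
    and H: "\<And>u. u \<in> W \<Longrightarrow> (k u + l u) * ((a u)\<^sup>2 + (b u)\<^sup>2 + (s u)\<^sup>2) = \<alpha> * s u"
    and a1: "\<And>u. u \<in> W \<Longrightarrow> line_deriv V1 a u (1 + p u * b u + k u * s u)"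
    and a2: "\<And>u. u \<in> W \<Longrightarrow> line_deriv V2 a u (q u * b u)"
    and b1: "\<And>u. u \<in> W \<Longrightarrow> line_deriv V1 b u (- p u * a u)"
    and b2: "\<And>u. u \<in> W \<Longrightarrow> line_deriv V2 b u (1 - q u * a u + l u * s u)"
    and s1: "\<And>u. u \<in> W \<Longrightarrow> line_deriv V1 s u (- k u * a u)"
    and s2: "\<And>u. u \<in> W \<Longrightarrow> line_deriv V2 s u (- l u * b u)"
    and k1: "\<And>u. u \<in> W \<Longrightarrow> \<exists>d. line_deriv V1 k u d"
    and k2: "\<And>u. u \<in> W \<Longrightarrow> line_deriv V2 k u (p u * (k u - l u))"
    and l1: "\<And>u. u \<in> W \<Longrightarrow> line_deriv V1 l u (q u * (k u - l u))"
    and l2: "\<And>u. u \<in> W \<Longrightarrow> \<exists>d. line_deriv V2 l u d"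
    and p2: "\<And>u. u \<in> W \<Longrightarrow> line_deriv V2 p u (p2 u)"
    and q1: "\<And>u. u \<in> W \<Longrightarrow> line_deriv V1 q u (q1 u)"
    and gauss: "\<And>u. u \<in> W \<Longrightarrow> c = p2 u - q1 u - (p u)\<^sup>2 - (q u)\<^sup>2"
begin

text \<open>The eliminations divide by functions that may vanish somewhere; they are carried out on the open subset where
  these functions do not vanish.\<close>

lemma restrict:
  assumes "open U" "U \<noteq> {}" "U \<subseteq> W"
  shows "curvature_frame U V1 V2 a b s k l p q p2 q1 \<alpha> c"
  by unfold_locales (fact assms(1,2) \<alpha> | (rule continuous_on_subset[OF _ assms(3)], fact cont)
    | (drule subsetD[OF assms(3)], rule kl pos H a1 a2 b1 b2 s1 s2 k1 k2 l1 l2 p2 q1 gauss, assumption))+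

text \<open>Interchanging the principal directions turns \<open>(p, q)\<close> into \<open>(-q, -p)\<close>. Every computation
  along \<open>e\<^sub>2\<close> below is obtained from one along \<open>e\<^sub>1\<close> in this way.\<close>

lemma swap: "curvature_frame W V2 V1 b a s l k (\<lambda>u. - q u) (\<lambda>u. - p u) (\<lambda>u. - q1 u) (\<lambda>u. - p2 u) \<alpha> c"
proof
  fix u assume u: "u \<in> W"
  show "l u \<noteq> k u" "l u * k u = c" using kl[OF u] by (auto simp: mult.commute)
  show "(b u)\<^sup>2 + (a u)\<^sup>2 + (s u)\<^sup>2 > 0" using pos[OF u] by (simp add: add.commute)
  show "(l u + k u) * ((b u)\<^sup>2 + (a u)\<^sup>2 + (s u)\<^sup>2) = \<alpha> * s u" using H[OF u] by (simp add: add.commute)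
  show "line_deriv V2 b u (1 + - q u * a u + l u * s u)" using b2[OF u] by simp
  show "line_deriv V1 b u (- p u * a u)" "line_deriv V2 a u (- (- q u) * b u)" using b1[OF u] a2[OF u] by simp_all
  show "line_deriv V1 a u (1 - - p u * b u + k u * s u)" using a1[OF u] by simp
  show "line_deriv V2 s u (- l u * b u)" "line_deriv V1 s u (- k u * a u)" using s1[OF u] s2[OF u] by simp_all
  show "\<exists>d. line_deriv V2 l u d" "\<exists>d. line_deriv V1 k u d" using k1[OF u] l2[OF u] by blast+
  show "line_deriv V1 l u (- q u * (l u - k u))" using l1[OF u] by (simp add: algebra_simps)
  show "line_deriv V2 k u (- p u * (l u - k u))" using k2[OF u] by (simp add: algebra_simps)
  show "line_deriv V1 (\<lambda>u. - q u) u (- q1 u)" "line_deriv V2 (\<lambda>u. - p u) u (- p2 u)"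
    using p2[OF u] q1[OF u] unfolding line_deriv_def by (auto intro: DERIV_minus)
  show "c = - q1 u - - p2 u - (- q u)\<^sup>2 - (- p u)\<^sup>2" using gauss[OF u] by simp
qed (use W \<alpha> cont in auto)

abbreviation "\<rho> u \<equiv> (a u)\<^sup>2 + (b u)\<^sup>2 + (s u)\<^sup>2"

lemma \<rho>1: "u \<in> W \<Longrightarrow> line_deriv V1 \<rho> u (2 * a u)"
proof -
  assume u: "u \<in> W"
  note [derivative_intros] = a1[OF u, unfolded line_deriv_def] b1[OF u, unfolded line_deriv_def] s1[OF u, unfolded line_deriv_def]
  show ?thesis unfolding line_deriv_def
    by (auto intro!: derivative_eq_intros simp: algebra_simps)
qed

lemma \<rho>2: "u \<in> W \<Longrightarrow> line_deriv V2 \<rho> u (2 * b u)"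
proof -
  assume u: "u \<in> W"
  note [derivative_intros] = a2[OF u, unfolded line_deriv_def] b2[OF u, unfolded line_deriv_def] s2[OF u, unfolded line_deriv_def]
  show ?thesis unfolding line_deriv_def
    by (auto intro!: derivative_eq_intros simp: algebra_simps)
qed

text \<open>The flat case. Along the rulings \<open>1/\<kappa>\<^sub>1\<close> is affine, \<open>\<langle>N, \<Phi>\<rangle>\<close> is constant and \<open>|\<Phi>|\<^sup>2\<close> is a quadratic polynomial with
  leading coefficient one, so \<open>|\<Phi>|\<^sup>2 \<kappa>\<^sub>1 = \<alpha> \<langle>N, \<Phi>\<rangle>\<close> is impossible: its second derivative along the ruling reads \<open>2 = 0\<close>.\<close>

lemma l_not_zero: "\<exists>u\<in>W. l u \<noteq> 0"
proof (rule ccontr)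
  assume "\<not> (\<exists>u\<in>W. l u \<noteq> 0)"
  then have l0: "l u = 0" if "u \<in> W" for u using that by blast
  have k0: "k u \<noteq> 0" if "u \<in> W" for u using kl(1)[OF that] l0[OF that] by simp
  have q0: "q u = 0" if u: "u \<in> W" for u
    using line_deriv_const_open[OF W(1) u l0 l1[OF u]] k0[OF u] l0[OF u] by simp
  have q10: "q1 u = 0" if u: "u \<in> W" for u
    using line_deriv_const_open[OF W(1) u q0 q1[OF u]] .
  have p: "p u * \<rho> u = - 2 * b u" if u: "u \<in> W" for u
  proof -
    have 1: "line_deriv V2 (\<lambda>u. k u * \<rho> u) u (p u * k u * \<rho> u + k u * (2 * b u))"
      unfolding line_deriv_def
      using DERIV_mult[OF k2[OF u, unfolded line_deriv_def] \<rho>2[OF u, unfolded line_deriv_def]] l0[OF u]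
      by (simp add: algebra_simps)
    have 2: "line_deriv V2 (\<lambda>u. \<alpha> * s u) u 0"
      using DERIV_cmult[OF s2[OF u, unfolded line_deriv_def], of \<alpha>] l0[OF u] unfolding line_deriv_def by simp
    have "k w * \<rho> w = \<alpha> * s w" if "w \<in> W" for w using H[OF that] l0[OF that] by simp
    from line_deriv_unique_open[OF W(1) u this 1 2] have "p u * k u * \<rho> u + k u * (2 * b u) = 0" .
    then have "k u * (p u * \<rho> u + 2 * b u) = 0" by (simp add: algebra_simps)
    then show ?thesis using k0[OF u] by simp
  qed
  obtain u where u: "u \<in> W" using W(2) by blast
  have 1: "line_deriv V2 (\<lambda>u. p u * \<rho> u) u (p2 u * \<rho> u + 2 * b u * p u)"
    unfolding line_deriv_def
    using DERIV_mult[OF p2[OF u, unfolded line_deriv_def] \<rho>2[OF u, unfolded line_deriv_def]] by simp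
  have 2: "line_deriv V2 (\<lambda>u. - 2 * b u) u (- 2)"
    using DERIV_cmult[OF b2[OF u, unfolded line_deriv_def], of "-2"] l0[OF u] q0[OF u] unfolding line_deriv_def by simp
  from line_deriv_unique_open[OF W(1) u p 1 2] have "p2 u * \<rho> u + 2 * b u * p u = - 2" .
  moreover have "p2 u = (p u)\<^sup>2" using gauss[OF u] kl(2)[OF u] l0[OF u] q0[OF u] q10[OF u] by simp
  ultimately have "p u * (p u * \<rho> u) + 2 * b u * p u = - 2" by (simp add: power2_eq_square mult.assoc)
  then show False unfolding p[OF u] by simp
qed

lemma not_flat: "c \<noteq> 0"
proof
  assume c: "c = 0"
  have "open (W \<inter> k -` (- {0}))"
    by (rule continuous_open_preimage[OF cont(3) W(1) open_Compl[OF closed_singleton]])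
  also have "W \<inter> k -` (- {0}) = {u\<in>W. k u \<noteq> 0}" by auto
  finally have o: "open {u\<in>W. k u \<noteq> 0}" .
  show False
  proof (cases "\<exists>u\<in>W. k u \<noteq> 0")
    case True
    then have "{u\<in>W. k u \<noteq> 0} \<noteq> {}" by blast
    from curvature_frame.l_not_zero[OF restrict[OF o this]]
    obtain u where "u \<in> W" "k u \<noteq> 0" "l u \<noteq> 0" by blast
    then show False using kl(2)[of u] c by simp
  next
    case False
    then show False using curvature_frame.l_not_zero[OF swap] by blast
  qed
qed

lemma kl0: "u \<in> W \<Longrightarrow> k u \<noteq> 0" "u \<in> W \<Longrightarrow> l u \<noteq> 0"
  using kl(2)[of u] not_flat by auto

lemma k1': assumes u: "u \<in> W" shows "\<exists>d. line_deriv V1 k u d \<and> d * l u = - k u * (q u * (k u - l u))"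
proof -
  obtain d where d: "line_deriv V1 k u d" using k1[OF u] by blast
  have "line_deriv V1 (\<lambda>u. k u * l u) u (d * l u + q u * (k u - l u) * k u)"
    unfolding line_deriv_def
    using DERIV_mult[OF d[unfolded line_deriv_def] l1[OF u, unfolded line_deriv_def]] by simp
  from line_deriv_const_open[OF W(1) u kl(2) this] d show ?thesis by (auto simp: algebra_simps)
qed

text \<open>The derivative of \<open>H |\<Phi>|\<^sup>2 = \<alpha> \<langle>N, \<Phi>\<rangle>\<close> along \<open>e\<^sub>1\<close>. As \<open>\<kappa>\<^sub>1 \<kappa>\<^sub>2\<close> is constant, the Codazzi
  equation expresses the derivative of \<open>H\<close> through \<open>q\<close>, so \<open>q\<close> is an algebraic function of \<open>a,
  b, s, k, l\<close>.\<close>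

lemma q: assumes u: "u \<in> W" shows "q u * \<rho> u * (k u - l u)\<^sup>2 = l u * (2 * (k u + l u) + \<alpha> * k u) * a u"
proof -
  obtain d where d: "line_deriv V1 k u d" "d * l u = - k u * (q u * (k u - l u))" using k1'[OF u] by blast
  have 1: "line_deriv V1 (\<lambda>u. (k u + l u) * \<rho> u) u ((d + q u * (k u - l u)) * \<rho> u + (k u + l u) * (2 * a u))"
    unfolding line_deriv_def
    using DERIV_mult[OF DERIV_add[OF d(1)[unfolded line_deriv_def] l1[OF u, unfolded line_deriv_def]] \<rho>1[OF u, unfolded line_deriv_def]]
    by (simp add: algebra_simps)
  have 2: "line_deriv V1 (\<lambda>u. \<alpha> * s u) u (\<alpha> * (- k u * a u))"
    using DERIV_cmult[OF s1[OF u, unfolded line_deriv_def], of \<alpha>] unfolding line_deriv_def by simp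
  from line_deriv_unique_open[OF W(1) u H 1 2]
  have "(d + q u * (k u - l u)) * \<rho> u + (k u + l u) * (2 * a u) = \<alpha> * (- k u * a u)" .
  then have "((d * l u) + l u * q u * (k u - l u)) * \<rho> u + l u * (k u + l u) * (2 * a u) = l u * \<alpha> * (- k u * a u)"
    by algebra
  then show ?thesis unfolding d(2) by algebra
qed

lemma p: assumes u: "u \<in> W" shows "p u * \<rho> u * (k u - l u)\<^sup>2 = - (k u * (2 * (k u + l u) + \<alpha> * l u) * b u)"
  using curvature_frame.q[OF swap u] by (simp add: algebra_simps power2_eq_square)

text \<open>The derivative of the relation for \<open>p\<close> along \<open>e\<^sub>2\<close>, which is one of the two terms with
  second derivatives in the Gauss equation.\<close>

lemma p2_eq:
  assumes u: "u \<in> W"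
  defines "K \<equiv> k u" and "L \<equiv> l u" and "S \<equiv> s u" and "R \<equiv> \<rho> u"
  shows "p2 u * (R * (K - L)\<^sup>2)\<^sup>2 = K * (2 * (K + L) + \<alpha> * L) *
    ((b u)\<^sup>2 * (2 * (K - L)\<^sup>2 - 2 * (K + L) * (2 * (K + L) + \<alpha> * L) + (K - L) * (2 * (K + L) + \<alpha> * L)
      + (K - L) * (2 * (K - L) - \<alpha> * L))
     - R * (K - L)\<^sup>2 + L * (2 * (K + L) + \<alpha> * K) * (a u)\<^sup>2 - L * S * R * (K - L)\<^sup>2)"
proof -
  let ?A = "2 * (K + L) + \<alpha> * K" and ?B = "2 * (K + L) + \<alpha> * L"
  obtain d where d: "line_deriv V2 l u d" "d * K = - L * (p u * (K - L))"
    using curvature_frame.k1'[OF swap u] unfolding K_def L_def by (auto simp: algebra_simps)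
  note D = p2[OF u, unfolded line_deriv_def] \<rho>2[OF u, unfolded line_deriv_def] b2[OF u, unfolded line_deriv_def]
    k2[OF u, unfolded line_deriv_def] d(1)[unfolded line_deriv_def]
  have 1: "line_deriv V2 (\<lambda>u. p u * \<rho> u * (k u - l u)\<^sup>2) u
      (p2 u * R * (K - L)\<^sup>2 + p u * (2 * b u) * (K - L)\<^sup>2 + p u * R * (2 * (K - L) * (p u * (K - L) - d)))"
    unfolding line_deriv_def R_def K_def L_def
    by (rule DERIV_cong[OF DERIV_mult[OF DERIV_mult[OF D(1,2)] DERIV_power[OF DERIV_diff[OF D(4,5)], of 2]]])
      (simp add: algebra_simps power2_eq_square)
  have 2: "line_deriv V2 (\<lambda>u. - (k u * (2 * (k u + l u) + \<alpha> * l u) * b u)) u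
      (- ((p u * (K - L)) * ?B * b u + K * (2 * (p u * (K - L) + d) + \<alpha> * d) * b u
        + K * ?B * (1 - q u * a u + L * S)))"
    unfolding line_deriv_def K_def L_def S_def
    by (rule DERIV_cong[OF DERIV_minus[OF DERIV_mult[OF DERIV_mult[OF D(4)
              DERIV_add[OF DERIV_cmult[OF DERIV_add[OF D(4,5)], of 2] DERIV_cmult[OF D(5), of \<alpha>]]] D(3)]]])
      (simp add: algebra_simps)
  define P where "P = p u * R * (K - L)\<^sup>2"
  define Q where "Q = q u * R * (K - L)\<^sup>2"
  have P: "P = - (K * ?B * b u)" using p[OF u] unfolding P_def K_def L_def R_def .
  have Q: "Q = L * ?A * a u" using q[OF u] unfolding Q_def K_def L_def R_def .
  note e = line_deriv_unique_open[OF W(1) u p 1 2]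
  \<comment> \<open>Clear denominators: multiply by \<open>K \<rho> (K - L)\<^sup>2\<close>, which turns \<open>p\<close> and \<open>q\<close> into \<open>P\<close> and \<open>Q\<close>.\<close>
  have "K * (p2 u * R * (K - L)\<^sup>2 + p u * (2 * b u) * (K - L)\<^sup>2 + p u * R * (2 * (K - L) * (p u * (K - L))))
      - p u * R * (2 * (K - L)) * (d * K) =
      - (K * (p u * (K - L)) * ?B * b u + K * (2 * (K * p u * (K - L) + d * K) + \<alpha> * (d * K)) * b u
        + K * K * ?B * (1 - q u * a u + L * S))"
    using arg_cong[OF e, of "\<lambda>z. K * z"] by (simp add: algebra_simps)
  from arg_cong[OF this[unfolded d(2)], of "\<lambda>z. z * (R * (K - L)\<^sup>2)"]
  have "K * (p2 u * (R * (K - L)\<^sup>2)\<^sup>2) = - (K * (2 * b u) * (K - L)\<^sup>2 * P + 2 * (K + L) * P\<^sup>2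
      + K * (K - L) * ?B * b u * P + K * b u * (K - L) * (2 * (K - L) - \<alpha> * L) * P
      + K * K * ?B * (R * (K - L)\<^sup>2 - a u * Q + L * S * R * (K - L)\<^sup>2))"
    unfolding P_def Q_def by algebra
  then have "K * (p2 u * (R * (K - L)\<^sup>2)\<^sup>2) = K * (K * ?B *
    ((b u)\<^sup>2 * (2 * (K - L)\<^sup>2 - 2 * (K + L) * ?B + (K - L) * ?B
      + (K - L) * (2 * (K - L) - \<alpha> * L))
     - R * (K - L)\<^sup>2 + L * ?A * (a u)\<^sup>2 - L * S * R * (K - L)\<^sup>2))"
    unfolding P Q by algebra
  then show ?thesis using kl0(1)[OF u] unfolding K_def by simp
qed

text \<open>The Gauss equation, multiplied by \<open>|\<Phi>|\<^sup>4 (k - l)\<^sup>4 (k + l)\<^sup>2\<close>. It contains \<open>|\<Phi>|\<^sup>2\<close> to the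
  powers one and two; both are eliminated by \<open>(k + l) |\<Phi>|\<^sup>2 = \<alpha> s\<close>, and what remains is
  homogeneous and linear in the squares \<open>a\<^sup>2, b\<^sup>2, s\<^sup>2\<close>. This linearity makes the elimination in
  the following lemmas possible by determinants.\<close>

lemma gauss_polynomial:
  assumes u: "u \<in> W"
  shows "(k u + l u)\<^sup>2 * (PX \<alpha> (k u) (l u) * (a u)\<^sup>2 + PX \<alpha> (l u) (k u) * (b u)\<^sup>2)
       + (k u - l u)\<^sup>2 * PZ \<alpha> (k u) (l u) * (s u)\<^sup>2 = 0"
proof -
  define K L S R P Q where defs: "K = k u" "L = l u" "S = s u" "R = \<rho> u" "P = p u * R * (K - L)\<^sup>2" "Q = q u * R * (K - L)\<^sup>2"
  let ?A = "2 * (K + L) + \<alpha> * K" and ?B = "2 * (K + L) + \<alpha> * L"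
  have P: "P = - (K * ?B * b u)" using p[OF u] unfolding defs .
  have Q: "Q = L * ?A * a u" using q[OF u] unfolding defs .
  have Rdef: "R = (a u)\<^sup>2 + (b u)\<^sup>2 + S\<^sup>2" unfolding defs ..
  have H: "(K + L) * R = \<alpha> * S" using H[OF u] unfolding defs .
  have p2': "p2 u * (R * (K - L)\<^sup>2)\<^sup>2 = K * ?B *
    ((b u)\<^sup>2 * (2 * (K - L)\<^sup>2 - 2 * (K + L) * ?B + (K - L) * ?B
      + (K - L) * (2 * (K - L) - \<alpha> * L))
     - R * (K - L)\<^sup>2 + L * ?A * (a u)\<^sup>2 - L * S * R * (K - L)\<^sup>2)"
    using p2_eq[OF u] unfolding defs .
  have q1': "- q1 u * (R * (K - L)\<^sup>2)\<^sup>2 = L * ?A *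
    ((a u)\<^sup>2 * (2 * (K - L)\<^sup>2 - 2 * (K + L) * ?A - (K - L) * ?A
      + (K - L) * (2 * (K - L) + \<alpha> * K))
     - R * (K - L)\<^sup>2 + K * ?B * (b u)\<^sup>2 - K * S * R * (K - L)\<^sup>2)"
    using curvature_frame.p2_eq[OF swap u] unfolding defs
    by (simp add: add.commute[of "l u"] add.commute[of "(b u)\<^sup>2"] power2_commute[of "l u"]) (simp add: algebra_simps)
  have "K * L * (R * (K - L)\<^sup>2)\<^sup>2 = p2 u * (R * (K - L)\<^sup>2)\<^sup>2 + (- q1 u * (R * (K - L)\<^sup>2)\<^sup>2) - P\<^sup>2 - Q\<^sup>2"
    using gauss[OF u] kl(2)[OF u] unfolding defs(5,6) defs(1,2) by algebra
  note g = this[unfolded p2' q1' P Q]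
  have "K * L * (K - L)^4 * ((K + L) * R)\<^sup>2 = (K + L) *
    (K * ?B *
    ((b u)\<^sup>2 * (K + L) * (2 * (K - L)\<^sup>2 - 2 * (K + L) * ?B + (K - L) * ?B
      + (K - L) * (2 * (K - L) - \<alpha> * L))
     - (K + L) * ((a u)\<^sup>2 + (b u)\<^sup>2 + S\<^sup>2) * (K - L)\<^sup>2 + (K + L) * L * ?A * (a u)\<^sup>2 - L * S * ((K + L) * R) * (K - L)\<^sup>2)
   + L * ?A *
    ((a u)\<^sup>2 * (K + L) * (2 * (K - L)\<^sup>2 - 2 * (K + L) * ?A - (K - L) * ?A
      + (K - L) * (2 * (K - L) + \<alpha> * K))
     - (K + L) * ((a u)\<^sup>2 + (b u)\<^sup>2 + S\<^sup>2) * (K - L)\<^sup>2 + (K + L) * K * ?B * (b u)\<^sup>2 - K * S * ((K + L) * R) * (K - L)\<^sup>2)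
   - (K + L) * (K * ?B * b u)\<^sup>2 - (K + L) * (L * ?A * a u)\<^sup>2)"
    unfolding Rdef[symmetric] using g by algebra
  from this[unfolded H]
  have "2 * ((K + L)\<^sup>2 * (PX \<alpha> K L * (a u)\<^sup>2 + PX \<alpha> L K * (b u)\<^sup>2) + (K - L)\<^sup>2 * PZ \<alpha> K L * S\<^sup>2) = 0"
    unfolding PX_def PZ_def by algebra
  then show ?thesis unfolding defs by simp
qed

text \<open>The derivative of the preceding relation along \<open>e\<^sub>1\<close> is linear in the squares again.
  Subtracting a multiple of the relation itself splits off the factor \<open>2 r (k - l) k l\<close>; the
  coefficients \<open>QX\<close>, \<open>QY\<close>, \<open>QZ\<close> are what is left.\<close>

lemma gauss_polynomial_prolonged:
  assumes u: "u \<in> W" and au: "a u \<noteq> 0" and Hu: "k u + l u \<noteq> 0"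
  shows "(k u + l u)\<^sup>2 * (QX \<alpha> (k u) (l u) * (a u)\<^sup>2 + QY \<alpha> (k u) (l u) * (b u)\<^sup>2)
       + (k u - l u)\<^sup>2 * QZ \<alpha> (k u) (l u) * (s u)\<^sup>2 = 0"
proof -
  define K L R where defs: "K = k u" "L = l u" "R = \<rho> u"
  let ?A = "2 * (K + L) + \<alpha> * K" and ?B = "2 * (K + L) + \<alpha> * L"
  \<comment> \<open>All derivatives along \<open>e\<^sub>1\<close> are multiples of \<open>a\<close>; with \<open>r\<close> as unit they become polynomials.\<close>
  define r where "r = a u / (R * (K - L)\<^sup>2 * (K + L))"
  have nz: "R \<noteq> 0" "K - L \<noteq> 0" "K + L \<noteq> 0" "K \<noteq> 0" "L \<noteq> 0"
    using pos[OF u] kl(1)[OF u] Hu kl0[OF u] unfolding defs by auto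
  have ar: "a u = r * R * (K - L)\<^sup>2 * (K + L)" unfolding r_def using nz by simp
  have r0: "r \<noteq> 0" using au ar by auto
  have H: "(K + L) * R = \<alpha> * s u" using H[OF u] unfolding defs .
  have qr: "q u * (K - L) = L * ?A * (K - L) * (K + L) * r"
  proof -
    have "q u * R * (K - L)\<^sup>2 = L * ?A * a u" using q[OF u] unfolding defs .
    then have "(q u * (K - L)) * (R * (K - L)) = (L * ?A * (K - L) * (K + L) * r) * (R * (K - L))"
      unfolding ar by algebra
    moreover have "R * (K - L) \<noteq> 0" using nz by simp
    ultimately show ?thesis using mult_right_cancel by blast
  qed
  obtain d where d: "line_deriv V1 k u d" "d * L = - K * (q u * (K - L))" using k1'[OF u] unfolding defs by blast
  have dr: "d = - K * ?A * (K - L) * (K + L) * r"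
  proof (rule mult_right_cancel[OF nz(5), THEN iffD1])
    show "d * L = - K * ?A * (K - L) * (K + L) * r * L" unfolding d(2) qr by algebra
  qed
  have pr: "p u * b u * a u = - (K * ?B * (K + L) * r * (b u)\<^sup>2)"
  proof -
    have "p u * R * (K - L)\<^sup>2 = - (K * ?B * b u)" using p[OF u] unfolding defs .
    then have "p u * b u * a u * (R * (K - L)\<^sup>2) = - (K * ?B * (K + L) * r * (b u)\<^sup>2) * (R * (K - L)\<^sup>2)"
      unfolding ar by algebra
    moreover have "R * (K - L)\<^sup>2 \<noteq> 0" using nz by simp
    ultimately show ?thesis using mult_right_cancel by blast
  qed
  \<comment> \<open>Restriction of a function to the line along which \<open>line_deriv V1\<close> differentiates.\<close>
  define Z where "Z = (\<lambda>f :: 'a \<Rightarrow> real. \<lambda>t. f (u + t *\<^sub>R V1 u))"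
  have Z0: "Z f 0 = f u" for f unfolding Z_def by simp
  have dk: "(Z k has_real_derivative - K * ?A * (K - L) * (K + L) * r) (at 0)"
    using d(1) unfolding dr line_deriv_def Z_def .
  have dl: "(Z l has_real_derivative L * ?A * (K - L) * (K + L) * r) (at 0)"
    using l1[OF u] unfolding line_deriv_def Z_def defs(1,2)[symmetric] qr .
  have da: "((\<lambda>t. (Z a t)\<^sup>2) has_real_derivative 2 * r * ((K - L)\<^sup>2 * (K + L) * ((a u)\<^sup>2 + (b u)\<^sup>2 + (s u)\<^sup>2)
      - K * ?B * (K + L) * (b u)\<^sup>2 + K * \<alpha> * (K - L)\<^sup>2 * (s u)\<^sup>2)) (at 0)"
  proof (rule DERIV_cong[OF DERIV_power[of "Z a" _ _ _ 2]])
    show "(Z a has_real_derivative (1 + p u * b u + k u * s u)) (at 0)" using a1[OF u] unfolding line_deriv_def Z_def .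
    have "a u * (1 + p u * b u + K * s u) = r * (K - L)\<^sup>2 * (K + L) * R + p u * b u * a u + r * (K - L)\<^sup>2 * K * ((K + L) * R) * s u"
      unfolding ar by algebra
    then have "a u * (1 + p u * b u + K * s u) = r * ((K - L)\<^sup>2 * (K + L) * R
      - K * ?B * (K + L) * (b u)\<^sup>2 + K * \<alpha> * (K - L)\<^sup>2 * (s u)\<^sup>2)"
      unfolding pr H by algebra
    then show "of_nat 2 * ((1 + p u * b u + k u * s u) * Z a 0 ^ (2 - Suc 0)) = 2 * r * ((K - L)\<^sup>2 * (K + L) * ((a u)\<^sup>2 + (b u)\<^sup>2 + (s u)\<^sup>2)
      - K * ?B * (K + L) * (b u)\<^sup>2 + K * \<alpha> * (K - L)\<^sup>2 * (s u)\<^sup>2)"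
      unfolding Z0 defs by (simp add: mult.commute)
  qed
  have db: "((\<lambda>t. (Z b t)\<^sup>2) has_real_derivative 2 * r * (K * ?B * (K + L) * (b u)\<^sup>2)) (at 0)"
  proof (rule DERIV_cong[OF DERIV_power[of "Z b" _ _ _ 2]])
    show "(Z b has_real_derivative (- p u * a u)) (at 0)" using b1[OF u] unfolding line_deriv_def Z_def .
    show "of_nat 2 * ((- p u * a u) * Z b 0 ^ (2 - Suc 0)) = 2 * r * (K * ?B * (K + L) * (b u)\<^sup>2)"
      unfolding Z0 using pr by (simp add: algebra_simps)
  qed
  have ds: "((\<lambda>t. (Z s t)\<^sup>2) has_real_derivative - 2 * r * (K * \<alpha> * (K - L)\<^sup>2 * (s u)\<^sup>2)) (at 0)"
  proof (rule DERIV_cong[OF DERIV_power[of "Z s" _ _ _ 2]])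
    show "(Z s has_real_derivative (- k u * a u)) (at 0)" using s1[OF u] unfolding line_deriv_def Z_def .
    have "K * a u * s u = r * K * (K - L)\<^sup>2 * ((K + L) * R) * s u" unfolding ar by algebra
    then have "K * a u * s u = r * K * (K - L)\<^sup>2 * \<alpha> * (s u)\<^sup>2" unfolding H by algebra
    then show "of_nat 2 * ((- k u * a u) * Z s 0 ^ (2 - Suc 0)) = - 2 * r * (K * \<alpha> * (K - L)\<^sup>2 * (s u)\<^sup>2)"
      unfolding Z0 defs(1)[symmetric] by (simp add: algebra_simps)
  qed
  define k' l' where k'l': "k' = - K * ?A * (K - L) * (K + L) * r" "l' = L * ?A * (K - L) * (K + L) * r"
  \<comment> \<open>The partial derivatives of \<open>PX \<alpha> K L\<close>, \<open>PX \<alpha> L K\<close> and \<open>PZ \<alpha> K L\<close> with respect to \<open>K\<close> and \<open>L\<close>.\<close>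
  let ?PXK = "4 * K^3 + (9*\<alpha> + 3*\<alpha>^2) * K^2 * L + (28 + 20*\<alpha> + 2*\<alpha>^2) * K * L^2 + (16 + 3*\<alpha>) * L^3"
  let ?PXL = "(3*\<alpha> + 1*\<alpha>^2) * K^3 + (28 + 20*\<alpha> + 2*\<alpha>^2) * K^2 * L + (48 + 9*\<alpha>) * K * L^2 + 4 * L^3"
  let ?PYK = "4 * K^3 + (48 + 9*\<alpha>) * K^2 * L + (28 + 20*\<alpha> + 2*\<alpha>^2) * K * L^2 + (3*\<alpha> + 1*\<alpha>^2) * L^3"
  let ?PYL = "(16 + 3*\<alpha>) * K^3 + (28 + 20*\<alpha> + 2*\<alpha>^2) * K^2 * L + (9*\<alpha> + 3*\<alpha>^2) * K * L^2 + 4 * L^3"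
  let ?PZK = "4 * K^3 + (12 + 9*\<alpha> + 3*\<alpha>^2) * K^2 * L + (12 + 12*\<alpha>) * K * L^2 + (4 + 3*\<alpha> + 1*\<alpha>^2) * L^3"
  let ?PZL = "(4 + 3*\<alpha> + 1*\<alpha>^2) * K^3 + (12 + 12*\<alpha>) * K^2 * L + (12 + 9*\<alpha> + 3*\<alpha>^2) * K * L^2 + 4 * L^3"
  note [derivative_intros] = dk[folded k'l'] dl[folded k'l'] da db ds
  have dPX: "((\<lambda>t. PX \<alpha> (Z k t) (Z l t)) has_real_derivative ?PXK * k' + ?PXL * l') (at 0)"
    unfolding PX_def by (rule derivative_eq_intros refl)+ (simp add: Z0 defs[symmetric], algebra)
  have dPY: "((\<lambda>t. PX \<alpha> (Z l t) (Z k t)) has_real_derivative ?PYK * k' + ?PYL * l') (at 0)"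
    unfolding PX_def by (rule derivative_eq_intros refl)+ (simp add: Z0 defs[symmetric], algebra)
  have dPZ: "((\<lambda>t. PZ \<alpha> (Z k t) (Z l t)) has_real_derivative ?PZK * k' + ?PZL * l') (at 0)"
    unfolding PZ_def by (rule derivative_eq_intros refl)+ (simp add: Z0 defs[symmetric], algebra)
  note [derivative_intros] = dPX dPY dPZ
  have "line_deriv V1 (\<lambda>u. (k u + l u)\<^sup>2 * (PX \<alpha> (k u) (l u) * (a u)\<^sup>2 + PX \<alpha> (l u) (k u) * (b u)\<^sup>2)
       + (k u - l u)\<^sup>2 * PZ \<alpha> (k u) (l u) * (s u)\<^sup>2) u
    (2 * (K + L) * (k' + l') * (PX \<alpha> K L * (a u)\<^sup>2 + PX \<alpha> L K * (b u)\<^sup>2)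
     + (K + L)\<^sup>2 * ((?PXK * k' + ?PXL * l') * (a u)\<^sup>2
        + PX \<alpha> K L * (2 * r * ((K - L)\<^sup>2 * (K + L) * ((a u)\<^sup>2 + (b u)\<^sup>2 + (s u)\<^sup>2)
      - K * ?B * (K + L) * (b u)\<^sup>2 + K * \<alpha> * (K - L)\<^sup>2 * (s u)\<^sup>2))
        + (?PYK * k' + ?PYL * l') * (b u)\<^sup>2 + PX \<alpha> L K * (2 * r * (K * ?B * (K + L) * (b u)\<^sup>2)))
     + 2 * (K - L) * (k' - l') * PZ \<alpha> K L * (s u)\<^sup>2 + (K - L)\<^sup>2 * (?PZK * k' + ?PZL * l') * (s u)\<^sup>2
     + (K - L)\<^sup>2 * PZ \<alpha> K L * (- 2 * r * (K * \<alpha> * (K - L)\<^sup>2 * (s u)\<^sup>2)))"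
    (is "line_deriv _ _ _ ?E")
  proof -
    have "((\<lambda>t. (Z k t + Z l t)\<^sup>2 * (PX \<alpha> (Z k t) (Z l t) * (Z a t)\<^sup>2 + PX \<alpha> (Z l t) (Z k t) * (Z b t)\<^sup>2)
       + (Z k t - Z l t)\<^sup>2 * PZ \<alpha> (Z k t) (Z l t) * (Z s t)\<^sup>2) has_real_derivative ?E) (at 0)"
      by (rule derivative_eq_intros refl)+ (simp only: Z0 defs[symmetric], simp, algebra)
    then show ?thesis unfolding line_deriv_def Z_def .
  qed
  from line_deriv_const_open[OF W(1) u gauss_polynomial this] have E0: "?E = 0" .
  have "?E = 2 * r * (K - L) * (((-5) + (-3)*\<alpha>) * K^2 + ((-24) + (-3)*\<alpha>) * K * L + 5 * L^2) * ((K + L)\<^sup>2 * (PX \<alpha> K L * (a u)\<^sup>2 + PX \<alpha> L K * (b u)\<^sup>2) + (K - L)\<^sup>2 * PZ \<alpha> K L * (s u)\<^sup>2)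
     + 2 * r * (K - L) * K * L * ((K + L)\<^sup>2 * (QX \<alpha> K L * (a u)\<^sup>2 + QY \<alpha> K L * (b u)\<^sup>2) + (K - L)\<^sup>2 * QZ \<alpha> K L * (s u)\<^sup>2)"
    unfolding k'l' PX_def PZ_def QX_def QY_def QZ_def by algebra
  then show ?thesis using gauss_polynomial[OF u] r0 nz E0 unfolding defs by auto
qed


text \<open>If \<open>k / l\<close> and \<open>k l\<close> are both constant, then so are \<open>k\<close> and \<open>l\<close>, and \<open>q\<close> measures the
  derivative of \<open>l\<close>.\<close>

lemma q_zero_if_ratio_const:
  assumes "open U" "U \<subseteq> W" "u \<in> U" "\<And>w. w \<in> U \<Longrightarrow> l w = m * k w"
  shows "q u = 0"
proof -
  have u: "u \<in> W" using assms by blast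
  obtain d where d: "line_deriv V1 k u d" "d * l u = - k u * (q u * (k u - l u))" using k1'[OF u] by blast
  have "line_deriv V1 (\<lambda>u. m * k u) u (m * d)"
    using DERIV_cmult[OF d(1)[unfolded line_deriv_def], of m] unfolding line_deriv_def .
  from line_deriv_unique_open[OF assms(1,3,4) l1[OF u] this]
  have "q u * (k u - l u) = m * d" .
  then have "k u * (q u * (k u - l u)) = (m * k u) * d" by algebra
  also have "m * k u = l u" using assms(3,4) by simp
  finally have "k u * (q u * (k u - l u)) = 0" using d(2) by (simp add: mult.commute)
  then show ?thesis using kl0[OF u] kl(1)[OF u] by simp
qed

text \<open>The ratio \<open>\<kappa>\<^sub>2/\<kappa>\<^sub>1\<close> cannot be locally constant: a surface with constant principal curvatures
  \<open>\<kappa>\<^sub>1 \<noteq> \<kappa>\<^sub>2\<close> is flat.  As the ratio is continuous, it cannot take only finitely many values either.\<close>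

lemma ratio_not_root:
  assumes P: "P \<noteq> 0" "\<And>u. u \<in> W \<Longrightarrow> poly P (l u / k u) = 0"
  shows False
proof -
  obtain u0 where u0: "u0 \<in> W" using W(2) by blast
  obtain e where e: "e > 0" "ball u0 e \<subseteq> W" using W(1) u0 openE by blast
  let ?m = "\<lambda>u. l u / k u"
  have "connected (?m ` ball u0 e)"
    by (intro connected_continuous_image continuous_on_divide continuous_on_subset[OF cont(4)]
        continuous_on_subset[OF cont(3)] e convex_connected convex_ball) (use e kl0 in blast)
  moreover have "finite (?m ` ball u0 e)"
    by (rule finite_subset[OF _ poly_roots_finite[OF P(1)]]) (use e P(2) in auto)
  ultimately have "\<exists>m. ?m ` ball u0 e = {m}"
    using e(1) connected_finite_iff_sing by (metis ball_eq_empty image_is_empty linorder_not_le)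
  then obtain m where m: "l u / k u = m" if "u \<in> ball u0 e" for u by blast
  have lk: "l u = m * k u" if "u \<in> ball u0 e" for u
    using m[OF that] kl0[of u] e that by (auto simp: field_simps)
  have m0: "m \<noteq> 0" using lk[of u0] kl0[OF u0] e by auto
  have q0: "q u = 0" if "u \<in> ball u0 e" for u
    using q_zero_if_ratio_const[OF open_ball e(2) that lk] .
  have "k u = (1 / m) * l u" if "u \<in> ball u0 e" for u using lk[OF that] m0 by simp
  from curvature_frame.q_zero_if_ratio_const[OF swap open_ball e(2) _ this]
  have p0: "p u = 0" if "u \<in> ball u0 e" for u using that by simp
  have c: "u0 \<in> ball u0 e" using e by simp
  have "p2 u0 = 0" by (rule line_deriv_const_open[OF open_ball c p0 p2[OF u0]])
  moreover have "q1 u0 = 0" by (rule line_deriv_const_open[OF open_ball c q0 q1[OF u0]])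
  ultimately show False using gauss[OF u0] p0[OF c] q0[OF c] not_flat by simp
qed

text \<open>The Gauss relation and its derivatives along \<open>e\<^sub>1\<close> and \<open>e\<^sub>2\<close> are three homogeneous linear
  equations for \<open>a\<^sup>2, b\<^sup>2, s\<^sup>2\<close>, so their determinant vanishes. It is a polynomial in \<open>l / k\<close>,
  up to factors that are not zero, and it is not the zero polynomial unless \<open>\<alpha>\<^sup>2 = 16\<close>. For \<open>\<alpha> =
  4\<close> and \<open>\<alpha> = -4\<close> the first two equations involve only \<open>a\<^sup>2 + b\<^sup>2\<close> and \<open>s\<^sup>2\<close>, and their two by
  two determinant serves instead.\<close>

lemma not_both_nonzero:
  assumes Hn: "\<And>u. u \<in> W \<Longrightarrow> k u + l u \<noteq> 0" and ab: "\<And>u. u \<in> W \<Longrightarrow> a u \<noteq> 0" "\<And>u. u \<in> W \<Longrightarrow> b u \<noteq> 0"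
  shows False
proof -
  have *: "PX \<alpha> (k u) (l u) * ((k u + l u) * a u)\<^sup>2 + PX \<alpha> (l u) (k u) * ((k u + l u) * b u)\<^sup>2 + PZ \<alpha> (k u) (l u) * ((k u - l u) * s u)\<^sup>2 = 0"
    "QX \<alpha> (k u) (l u) * ((k u + l u) * a u)\<^sup>2 + QY \<alpha> (k u) (l u) * ((k u + l u) * b u)\<^sup>2 + QZ \<alpha> (k u) (l u) * ((k u - l u) * s u)\<^sup>2 = 0"
    "QY \<alpha> (l u) (k u) * ((k u + l u) * a u)\<^sup>2 + QX \<alpha> (l u) (k u) * ((k u + l u) * b u)\<^sup>2 + QZ \<alpha> (l u) (k u) * ((k u - l u) * s u)\<^sup>2 = 0"
    if u: "u \<in> W" for u
    using gauss_polynomial[OF u] gauss_polynomial_prolonged[OF u ab(1)[OF u] Hn[OF u]]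
      curvature_frame.gauss_polynomial_prolonged[OF swap u ab(2)[OF u]] Hn[OF u]
    unfolding add.commute[of "l u"] power2_commute[of "l u"] power_mult_distrib by (simp_all add: algebra_simps)
  have nz: "((k u + l u) * a u)\<^sup>2 > 0" "((k u + l u) * b u)\<^sup>2 > 0" "k u \<noteq> 0" "l u \<noteq> 0" "k u - l u \<noteq> 0" "k u + l u \<noteq> 0" if "u \<in> W" for u
    using Hn[OF that] ab[OF that] kl0[OF that] kl(1)[OF that] by simp_all
  have el: "(A1 * (B2 * C3 - C2 * B3) - B1 * (A2 * C3 - C2 * A3) + C1 * (A2 * B3 - B2 * A3)) * X = 0"
    if "A1 * X + B1 * Y + C1 * Z = 0" "A2 * X + B2 * Y + C2 * Z = 0" "A3 * X + B3 * Y + C3 * Z = 0" for A1 B1 C1 A2 B2 C2 A3 B3 C3 X Y Z :: real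
    using that by algebra
  consider "\<alpha> = 4" | "\<alpha> = - 4" | "16 - \<alpha>\<^sup>2 \<noteq> 0"
  proof -
    have "\<alpha> = 4 \<or> \<alpha> = - 4" if "16 - \<alpha>\<^sup>2 = 0" 
      using power2_eq_iff[of \<alpha> 4] that by simp
    then show ?thesis using that by blast
  qed
  then show False
  proof cases
    case 1
    have "poly [: - 35, -293, 50, 550, 225, 15:] (l u / k u) = 0" if u: "u \<in> W" for u
    proof -
      define X where "X = ((k u + l u) * a u)\<^sup>2 + ((k u + l u) * b u)\<^sup>2"
      define Z where "Z = ((k u - l u) * s u)\<^sup>2"
      have "PX \<alpha> (k u) (l u) * X + PZ \<alpha> (k u) (l u) * Z = 0" "QX \<alpha> (k u) (l u) * X + QZ \<alpha> (k u) (l u) * Z = 0"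
        using *(1,2)[OF u] unfolding X_def Z_def 1 PX_def QX_def QY_def by (simp_all add: algebra_simps)
      then have "(PX \<alpha> (k u) (l u) * QZ \<alpha> (k u) (l u) - PZ \<alpha> (k u) (l u) * QX \<alpha> (k u) (l u)) * X = 0" by algebra
      then have "PX \<alpha> (k u) (l u) * QZ \<alpha> (k u) (l u) - PZ \<alpha> (k u) (l u) * QX \<alpha> (k u) (l u) = 0"
        using nz(1,2)[OF u] unfolding X_def by simp
      then have "32 * k u * l u * (k u + l u) * (- 35 * (k u)^5 - 293 * (k u)^4 * l u + 50 * (k u)^3 * (l u)^2 + 550 * (k u)^2 * (l u)^3 + 225 * k u * (l u)^4 + 15 * (l u)^5) = 0"
        unfolding PX_def QX_def PZ_def QZ_def 1 by algebra
      then have "- 35 * (k u)^5 - 293 * (k u)^4 * l u + 50 * (k u)^3 * (l u)^2 + 550 * (k u)^2 * (l u)^3 + 225 * k u * (l u)^4 + 15 * (l u)^5 = 0"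
        using nz[OF u] by simp
      moreover have "(k u)^5 * poly [: - 35, -293, 50, 550, 225, 15:] (l u / k u) = - 35 * (k u)^5 - 293 * (k u)^4 * l u + 50 * (k u)^3 * (l u)^2 + 550 * (k u)^2 * (l u)^3 + 225 * k u * (l u)^4 + 15 * (l u)^5"
        using nz(3)[OF u] by (simp add: field_simps power_numeral_reduce)
      ultimately show ?thesis using nz(3)[OF u] by simp
    qed
    then show False by (intro ratio_not_root[of "[: - 35, -293, 50, 550, 225, 15:]"]) auto
  next
    case 2
    have "poly [: - 1, 6, 3:] (l u / k u) = 0" if u: "u \<in> W" for u
    proof -
      define X where "X = ((k u + l u) * a u)\<^sup>2 + ((k u + l u) * b u)\<^sup>2"
      define Z where "Z = ((k u - l u) * s u)\<^sup>2"
      have "PX \<alpha> (k u) (l u) * X + PZ \<alpha> (k u) (l u) * Z = 0" "QX \<alpha> (k u) (l u) * X + QZ \<alpha> (k u) (l u) * Z = 0"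
        using *(1,2)[OF u] unfolding X_def Z_def 2 PX_def QX_def QY_def by (simp_all add: algebra_simps)
      then have "(PX \<alpha> (k u) (l u) * QZ \<alpha> (k u) (l u) - PZ \<alpha> (k u) (l u) * QX \<alpha> (k u) (l u)) * X = 0" by algebra
      then have "PX \<alpha> (k u) (l u) * QZ \<alpha> (k u) (l u) - PZ \<alpha> (k u) (l u) * QX \<alpha> (k u) (l u) = 0"
        using nz(1,2)[OF u] unfolding X_def by simp
      then have "32 * k u * l u * (k u + l u) * (k u - l u)^3 * ((- 1) * (k u)^2 + 6 * k u * l u + 3 * (l u)^2) = 0"
        unfolding PX_def QX_def PZ_def QZ_def 2 by algebra
      then have "(- 1) * (k u)^2 + 6 * k u * l u + 3 * (l u)^2 = 0"
        using nz[OF u] by simp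
      moreover have "(k u)^2 * poly [: - 1, 6, 3:] (l u / k u) = (- 1) * (k u)^2 + 6 * k u * l u + 3 * (l u)^2"
        using nz(3)[OF u] by (simp add: field_simps power_numeral_reduce)
      ultimately show ?thesis using nz(3)[OF u] by simp
    qed
    then show False by (intro ratio_not_root[of "[: - 1, 6, 3:]"]) auto
  next
    case 3
    define c0 where "c0 = 18 + 9 * \<alpha> + \<alpha>\<^sup>2"
    define c1 where "c1 = 120 + 72 * \<alpha> + 15 * \<alpha>\<^sup>2 + \<alpha>^3"
    define c2 where "c2 = 204 + 126 * \<alpha> + 26 * \<alpha>\<^sup>2 + 2 * \<alpha>^3"
    have "poly [:c0, c1, c2, c1, c0:] (l u / k u) = 0" if u: "u \<in> W" for u
    proof -
      note el[OF *[OF u]]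
      then have "(PX \<alpha> (k u) (l u) * (QY \<alpha> (k u) (l u) * QZ \<alpha> (l u) (k u) - QZ \<alpha> (k u) (l u) * QX \<alpha> (l u) (k u))
        - PX \<alpha> (l u) (k u) * (QX \<alpha> (k u) (l u) * QZ \<alpha> (l u) (k u) - QZ \<alpha> (k u) (l u) * QY \<alpha> (l u) (k u))
        + PZ \<alpha> (k u) (l u) * (QX \<alpha> (k u) (l u) * QX \<alpha> (l u) (k u) - QY \<alpha> (k u) (l u) * QY \<alpha> (l u) (k u))) = 0"
        using nz(1)[OF u] by simp
      then have "2 * \<alpha>\<^sup>2 * k u * l u * (k u - l u)^4 * (k u + l u)^2 * (16 - \<alpha>\<^sup>2) *
          (c0 * (k u)^4 + c1 * (k u)^3 * l u + c2 * (k u)^2 * (l u)^2 + c1 * k u * (l u)^3 + c0 * (l u)^4) = 0"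
        unfolding PX_def PZ_def QX_def QY_def QZ_def c0_def c1_def c2_def by algebra
      then have "c0 * (k u)^4 + c1 * (k u)^3 * l u + c2 * (k u)^2 * (l u)^2 + c1 * k u * (l u)^3 + c0 * (l u)^4 = 0"
        using nz[OF u] 3 \<alpha> by simp
      moreover have "(k u)^4 * poly [:c0, c1, c2, c1, c0:] (l u / k u) = c0 * (k u)^4 + c1 * (k u)^3 * l u + c2 * (k u)^2 * (l u)^2 + c1 * k u * (l u)^3 + c0 * (l u)^4"
        using nz(3)[OF u] by (simp add: field_simps power_numeral_reduce)
      ultimately show ?thesis using nz(3)[OF u] by simp
    qed
    moreover have "[:c0, c1, c2, c1, c0:] \<noteq> 0"
    proof
      assume "[:c0, c1, c2, c1, c0:] = 0"
      then have c: "c0 = 0" "c1 = 0" by simp_all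
      have "(\<alpha> + 3) * (\<alpha> + 6) = 0" using c(1) unfolding c0_def by algebra
      then consider "\<alpha> = - 3" | "\<alpha> = - 6" unfolding mult_eq_0_iff by linarith
      then show False by cases (use c(2) in \<open>auto simp: c1_def\<close>)
    qed
    ultimately show False by (intro ratio_not_root[of "[:c0, c1, c2, c1, c0:]"]) auto
  qed
qed

text \<open>Along \<open>a = 0\<close> the relation cannot be divided by \<open>a\<close> after differentiation. But then the
  derivative of \<open>a\<close> along \<open>e\<^sub>1\<close> vanishes as well, which is a second linear equation for \<open>b\<^sup>2\<close>
  and \<open>s\<^sup>2\<close>.\<close>

lemma not_a_zero:
  assumes Hn: "\<And>u. u \<in> W \<Longrightarrow> k u + l u \<noteq> 0" and ab: "\<And>u. u \<in> W \<Longrightarrow> a u = 0" "\<And>u. u \<in> W \<Longrightarrow> b u \<noteq> 0"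
  shows False
proof -
  define c1 where "c1 = 26 + 24 * \<alpha> + 4 * \<alpha>\<^sup>2"
  define c2 where "c2 = 68 + 68 * \<alpha> + 21 * \<alpha>\<^sup>2 + 2 * \<alpha>^3"
  define c3 where "c3 = 68 + 70 * \<alpha> + 22 * \<alpha>\<^sup>2 + 2 * \<alpha>^3"
  define c4 where "c4 = 26 + 27 * \<alpha> + 13 * \<alpha>\<^sup>2 + 2 * \<alpha>^3"
  let ?P = "[:2 + \<alpha>, c1, c2, c3, c4, 2 + 2 * \<alpha>:]"
  have "poly ?P (l u / k u) = 0" if u: "u \<in> W" for u
  proof -
    define K L R S B where defs: "K = k u" "L = l u" "R = \<rho> u" "S = s u" "B = b u"
    have nz: "R \<noteq> 0" "K - L \<noteq> 0" "K + L \<noteq> 0" "K \<noteq> 0" "L \<noteq> 0" "B \<noteq> 0"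
      using pos[OF u] kl(1)[OF u] Hn[OF u] kl0[OF u] ab[OF u] unfolding defs by auto
    have a0: "a u = 0" using ab u by simp
    have e: "1 + p u * B + K * S = 0"
      using line_deriv_const_open[OF W(1) u ab(1) a1[OF u]] unfolding defs by simp
    have R: "R = B\<^sup>2 + S\<^sup>2" unfolding defs a0 by simp
    have H: "(K + L) * R = \<alpha> * S" using H[OF u] unfolding defs .
    have P: "p u * R * (K - L)\<^sup>2 = - (K * (2 * (K + L) + \<alpha> * L) * B)" using p[OF u] unfolding defs .
    have g: "(K + L)\<^sup>2 * (PX \<alpha> L K * B\<^sup>2) + (K - L)\<^sup>2 * PZ \<alpha> K L * S\<^sup>2 = 0"
      using gauss_polynomial[OF u] unfolding defs a0 by simp
    have "(K + L) * (K - L)\<^sup>2 * R + (K + L) * (p u * R * (K - L)\<^sup>2) * B + K * ((K + L) * R) * S * (K - L)\<^sup>2 = 0"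
      using arg_cong[OF e, of "\<lambda>z. z * ((K + L) * (K - L)\<^sup>2 * R)"] by algebra
    then have f: "(K + L) * ((K - L)\<^sup>2 - K * (2 * (K + L) + \<alpha> * L)) * B\<^sup>2 + (K - L)\<^sup>2 * (K + L + \<alpha> * K) * S\<^sup>2 = 0"
      unfolding H P unfolding R by algebra
    have "(K + L) * (((K - L)\<^sup>2 - K * (2 * (K + L) + \<alpha> * L)) * PZ \<alpha> K L - (K + L) * (K + L + \<alpha> * K) * PX \<alpha> L K) * B\<^sup>2 = 0"
      using f g by algebra
    then have "((K - L)\<^sup>2 - K * (2 * (K + L) + \<alpha> * L)) * PZ \<alpha> K L - (K + L) * (K + L + \<alpha> * K) * PX \<alpha> L K = 0"
      using nz by simp
    then have "K * ((2 + \<alpha>) * K^5 + c1 * K^4 * L + c2 * K^3 * L^2 + c3 * K^2 * L^3 + c4 * K * L^4 + (2 + 2 * \<alpha>) * L^5) = 0"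
      unfolding PX_def PZ_def c1_def c2_def c3_def c4_def by algebra
    then have "(2 + \<alpha>) * K^5 + c1 * K^4 * L + c2 * K^3 * L^2 + c3 * K^2 * L^3 + c4 * K * L^4 + (2 + 2 * \<alpha>) * L^5 = 0"
      using nz by simp
    moreover have "K^5 * poly ?P (L / K) = (2 + \<alpha>) * K^5 + c1 * K^4 * L + c2 * K^3 * L^2 + c3 * K^2 * L^3 + c4 * K * L^4 + (2 + 2 * \<alpha>) * L^5"
      using nz(4) by (simp add: field_simps power_numeral_reduce)
    ultimately show ?thesis using nz(4) unfolding defs by simp
  qed
  moreover have "?P \<noteq> 0" by auto
  ultimately show False by (rule ratio_not_root[rotated]) auto
qed

lemma open_nonzero: "continuous_on W (f :: 'a \<Rightarrow> real) \<Longrightarrow> open {u\<in>W. f u \<noteq> 0}"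
proof -
  assume "continuous_on W f"
  from continuous_open_preimage[OF this W(1) open_Compl[OF closed_singleton, of 0]]
  show ?thesis by (simp add: vimage_def Int_def)
qed

lemma H_not_nowhere_zero:
  assumes Hn: "\<And>u. u \<in> W \<Longrightarrow> k u + l u \<noteq> 0"
  shows False
proof -
  have sub: "{u\<in>W. f u \<noteq> 0} \<subseteq> W" for f :: "'a \<Rightarrow> real" by blast
  have ab: "a u * b u = 0" if "u \<in> W" for u
  proof (rule ccontr)
    assume "a u * b u \<noteq> 0"
    then have "{u\<in>W. a u * b u \<noteq> 0} \<noteq> {}" using that by blast
    note ne = this
    show False
    proof (rule curvature_frame.not_both_nonzero[OF restrict[OF open_nonzero[OF continuous_on_mult[OF cont(1,2)]] ne sub]])
      fix w assume "w \<in> {u\<in>W. a u * b u \<noteq> 0}"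
      then show "k w + l w \<noteq> 0" "a w \<noteq> 0" "b w \<noteq> 0" using Hn[of w] by simp_all
    qed
  qed
  have a0: "a u = 0" if "u \<in> W" for u
  proof (rule ccontr)
    assume "a u \<noteq> 0"
    then have ne: "{u\<in>W. a u \<noteq> 0} \<noteq> {}" using that by blast
    show False
    proof (rule curvature_frame.not_a_zero[OF curvature_frame.swap[OF restrict[OF open_nonzero[OF cont(1)] ne sub]]])
      fix w assume "w \<in> {u\<in>W. a u \<noteq> 0}"
      then show "l w + k w \<noteq> 0" "b w = 0" "a w \<noteq> 0" using Hn[of w] ab[of w] by (simp_all add: add.commute)
    qed
  qed
  have b0: "b u = 0" if "u \<in> W" for u
  proof (rule ccontr)
    assume "b u \<noteq> 0"
    then have ne: "{u\<in>W. b u \<noteq> 0} \<noteq> {}" using that by blast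
    show False
    proof (rule curvature_frame.not_a_zero[OF restrict[OF open_nonzero[OF cont(2)] ne sub]])
      fix w assume "w \<in> {u\<in>W. b u \<noteq> 0}"
      then show "k w + l w \<noteq> 0" "a w = 0" "b w \<noteq> 0" using Hn[of w] a0[of w] by simp_all
    qed
  qed
  obtain u where u: "u \<in> W" using W(2) by blast
  have "1 + k u * s u = 0" using line_deriv_const_open[OF W(1) u a0 a1[OF u]] b0[OF u] by simp
  moreover have "1 + l u * s u = 0" using line_deriv_const_open[OF W(1) u b0 b2[OF u]] a0[OF u] by simp
  ultimately have "(k u - l u) * s u = 0" "1 + k u * s u = 0" by algebra+
  then show False using kl(1)[OF u] by auto
qed

text \<open>Either \<open>H \<noteq> 0\<close> on some open set, where the eliminations above apply, or \<open>\<kappa>\<^sub>2/\<kappa>\<^sub>1 = -1\<close> throughout. So a principal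
  frame with \<open>\<kappa>\<^sub>1 \<noteq> \<kappa>\<^sub>2\<close> exists on no non-empty open set.\<close>

theorem inconsistent: False
proof (cases "\<exists>u\<in>W. k u + l u \<noteq> 0")
  case True
  then have "{u\<in>W. k u + l u \<noteq> 0} \<noteq> {}" by blast
  note ne = this
  show False
    by (rule curvature_frame.H_not_nowhere_zero[OF restrict[OF open_nonzero[OF continuous_on_add[OF cont(3,4)]] ne]])
      simp_all
next
  case False
  then have "poly [:1, 1:] (l u / k u) = 0" if "u \<in> W" for u
    using that kl0(1)[OF that] by (auto simp: field_simps)
  then show False by (intro ratio_not_root[of "[:1, 1:]"]) auto
qed

end

section \<open>Moving frames on a surface patch\<close>

subsection \<open>Derivations along vector fields\<close>

definition dir_deriv :: "('a::real_normed_vector \<Rightarrow> 'a) \<Rightarrow> ('a \<Rightarrow> 'b::real_normed_vector) \<Rightarrow> 'a \<Rightarrow> 'b" where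
  "dir_deriv V g u = frechet_derivative g (at u) (V u)"

lemma dir_deriv_bounded_bilinear:
  assumes "bounded_bilinear h" "smooth_on W f" "smooth_on W g" "u \<in> W"
  shows "dir_deriv V (\<lambda>u. h (f u) (g u)) u = h (f u) (dir_deriv V g u) + h (dir_deriv V f u) (g u)"
  unfolding dir_deriv_def
  using frechet_derivative_at[OF bounded_bilinear.FDERIV[OF assms(1) smooth_on_has_derivative[OF assms(2,4)]
        smooth_on_has_derivative[OF assms(3,4)]]]
  by (metis (no_types, lifting))

lemmas dir_deriv_inner = dir_deriv_bounded_bilinear[OF bounded_bilinear_inner]
lemmas dir_deriv_scaleR = dir_deriv_bounded_bilinear[OF bounded_bilinear_scaleR]
lemmas dir_deriv_mult = dir_deriv_bounded_bilinear[OF bounded_bilinear_mult]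

lemma dir_deriv_add:
  assumes "smooth_on W f" "smooth_on W g" "u \<in> W"
  shows "dir_deriv V (\<lambda>u. f u + g u) u = dir_deriv V f u + dir_deriv V g u"
  unfolding dir_deriv_def
  using frechet_derivative_at[OF has_derivative_add[OF smooth_on_has_derivative[OF assms(1,3)]
        smooth_on_has_derivative[OF assms(2,3)]]]
  by (metis (no_types, lifting))

lemma dir_deriv_minus:
  assumes "smooth_on W f" "u \<in> W"
  shows "dir_deriv V (\<lambda>u. - f u) u = - dir_deriv V f u"
  unfolding dir_deriv_def
  using frechet_derivative_at[OF has_derivative_minus[OF smooth_on_has_derivative[OF assms]]]
  by (metis (no_types, lifting))

lemma dir_deriv_cong_open:
  assumes "open W" "smooth_on W f" "u \<in> W" "\<And>w. w \<in> W \<Longrightarrow> f w = g w"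
  shows "dir_deriv V f u = dir_deriv V g u"
  unfolding dir_deriv_def
  using frechet_derivative_transform_within_open[OF differentiableI[OF smooth_on_has_derivative[OF assms(2,3)]] assms(1,3,4)]
  by simp

lemma dir_deriv_orthogonal:
  assumes W: "open W" and s: "smooth_on W f" "smooth_on W g" and c: "\<And>w. w \<in> W \<Longrightarrow> f w \<bullet> g w = (c::real)" and u: "u \<in> W"
  shows "dir_deriv V f u \<bullet> g u = - (f u \<bullet> dir_deriv V g u)"
proof -
  have "dir_deriv V (\<lambda>u. f u \<bullet> g u) u = dir_deriv V (\<lambda>u. c) u"
    by (rule dir_deriv_cong_open[OF W smooth_on_inner[OF W s] u c])
  then have "dir_deriv V (\<lambda>u. f u \<bullet> g u) u = 0" unfolding dir_deriv_def by simp
  then show ?thesis unfolding dir_deriv_inner[OF s u] by simp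
qed

lemma line_deriv_dir_deriv:
  assumes "smooth_on W f" "u \<in> W"
  shows "line_deriv V f u (dir_deriv V f u)"
proof -
  note d = smooth_on_has_derivative[OF assms]
  have "((\<lambda>t. u + t *\<^sub>R V u) has_derivative (\<lambda>t. t *\<^sub>R V u)) (at 0)"
    by (auto intro!: derivative_eq_intros)
  from has_derivative_compose[OF this, of f "frechet_derivative f (at u)"] d
  have "((\<lambda>t. f (u + t *\<^sub>R V u)) has_derivative (\<lambda>t. frechet_derivative f (at u) (t *\<^sub>R V u))) (at 0)"
    by simp
  moreover have "(\<lambda>t. frechet_derivative f (at u) (t *\<^sub>R V u)) = (*) (dir_deriv V f u)"
    unfolding dir_deriv_def linear_scale[OF has_derivative_linear[OF d]] by (auto simp: mult.commute)
  ultimately show ?thesis unfolding line_deriv_def has_field_derivative_def by simp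
qed

abbreviation "pd1 g u \<equiv> frechet_derivative g (at u) (axis (1::2) (1::real))"
abbreviation "pd2 g u \<equiv> frechet_derivative g (at u) (axis (2::2) (1::real))"

lemma vec2_axis: "(v :: real^2) = (v$1) *\<^sub>R axis 1 1 + (v$2) *\<^sub>R axis 2 1"
  by (simp add: vec_eq_iff forall_2 axis_def)

lemma linear_vec2: "linear L \<Longrightarrow> L (v :: real^2) = (v$1) *\<^sub>R L (axis 1 1) + (v$2) *\<^sub>R L (axis 2 1)"
  by (rule trans[OF arg_cong[OF vec2_axis[of v], of L]]) (simp only: linear_add linear_scale)

lemma dir_deriv_partials:
  assumes "smooth_on W g" "u \<in> W"
  shows "dir_deriv V g u = (V u $ 1) *\<^sub>R pd1 g u + (V u $ 2) *\<^sub>R pd2 g u"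
  unfolding dir_deriv_def by (rule linear_vec2[OF has_derivative_linear[OF smooth_on_has_derivative[OF assms]]])

lemma smooth_on_dir_deriv:
  fixes V :: "real^2 \<Rightarrow> real^2"
  assumes "open W" "smooth_on W V" "smooth_on W g"
  shows "smooth_on W (dir_deriv V g)"
proof (rule smooth_on_cong_open[OF assms(1)])
  show "smooth_on W (\<lambda>u. (V u $ 1) *\<^sub>R pd1 g u + (V u $ 2) *\<^sub>R pd2 g u)"
    by (intro smooth_on_add smooth_on_scaleR smooth_on_vec_nth smooth_on_frechet_derivative assms)
qed (simp add: dir_deriv_partials[OF assms(3)])

lemma dir_deriv_vec_nth:
  assumes "smooth_on W U" "u \<in> W"
  shows "dir_deriv V (\<lambda>u. U u $ i) u = dir_deriv V U u $ i"
  unfolding dir_deriv_def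
  by (rule frechet_derivative_bounded_linear[OF bounded_linear_vec_nth differentiableI[OF smooth_on_has_derivative[OF assms]]])

text \<open>The commutator of two derivations is the derivation along the Lie bracket of the vector fields.\<close>

lemma dir_deriv_commutator:
  fixes V U :: "real^2 \<Rightarrow> real^2" and g :: "real^2 \<Rightarrow> 'b::real_inner"
  assumes W: "open W" and s: "smooth_on W V" "smooth_on W U" "smooth_on W g" and u: "u \<in> W"
  shows "dir_deriv V (dir_deriv U g) u - dir_deriv U (dir_deriv V g) u = frechet_derivative g (at u) (dir_deriv V U u - dir_deriv U V u)"
proof -
  have *: "dir_deriv V (dir_deriv U g) u = (dir_deriv V U u $ 1) *\<^sub>R pd1 g u + (dir_deriv V U u $ 2) *\<^sub>R pd2 g u
      + (U u $ 1 * V u $ 1) *\<^sub>R pd1 (pd1 g) u + (U u $ 1 * V u $ 2) *\<^sub>R pd2 (pd1 g) u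
      + (U u $ 2 * V u $ 1) *\<^sub>R pd1 (pd2 g) u + (U u $ 2 * V u $ 2) *\<^sub>R pd2 (pd2 g) u"
    if s: "smooth_on W V" "smooth_on W U" for V U :: "real^2 \<Rightarrow> real^2"
  proof -
    note sm = smooth_on_frechet_derivative[OF assms(4)] smooth_on_vec_nth[OF W s(2)]
    have "dir_deriv V (dir_deriv U g) u = dir_deriv V (\<lambda>u. (U u $ 1) *\<^sub>R pd1 g u + (U u $ 2) *\<^sub>R pd2 g u) u"
      by (rule dir_deriv_cong_open[OF W smooth_on_dir_deriv[OF W s(2) assms(4)] u]) (rule dir_deriv_partials[OF assms(4)])
    also have "\<dots> = dir_deriv V (\<lambda>u. (U u $ 1) *\<^sub>R pd1 g u) u + dir_deriv V (\<lambda>u. (U u $ 2) *\<^sub>R pd2 g u) u"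
      by (rule dir_deriv_add[OF smooth_on_scaleR[OF W sm(2,1)] smooth_on_scaleR[OF W sm(2,1)] u])
    also have "\<dots> = (U u $ 1) *\<^sub>R dir_deriv V (pd1 g) u + (dir_deriv V U u $ 1) *\<^sub>R pd1 g u
        + ((U u $ 2) *\<^sub>R dir_deriv V (pd2 g) u + (dir_deriv V U u $ 2) *\<^sub>R pd2 g u)"
      unfolding dir_deriv_scaleR[OF sm(2,1) u] dir_deriv_vec_nth[OF s(2) u] ..
    finally show ?thesis
      unfolding dir_deriv_partials[OF sm(1) u] by (simp add: algebra_simps)
  qed
  have "dir_deriv V (dir_deriv U g) u - dir_deriv U (dir_deriv V g) u = ((dir_deriv V U u - dir_deriv U V u) $ 1) *\<^sub>R pd1 g u + ((dir_deriv V U u - dir_deriv U V u) $ 2) *\<^sub>R pd2 g u"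
    unfolding *[OF s(1,2)] *[OF s(2,1)] second_derivative_symmetric[OF W s(3) u, of "axis 2 1" "axis 1 1"]
    by (simp add: scaleR_left_diff_distrib mult.commute[of "V u $ _"])
  then show ?thesis
    unfolding linear_vec2[OF has_derivative_linear[OF smooth_on_has_derivative[OF s(3) u]], of "dir_deriv V U u - dir_deriv U V u"] .
qed

subsection \<open>Adapted frames\<close>

lemma frame_inner:
  fixes e1 e2 n :: "real^3"
  assumes "e1 \<bullet> e1 = 1" "n \<bullet> n = 1" "e1 \<bullet> n = 0" "e2 = cross3 n e1"
  shows "e2 \<bullet> e2 = 1" "e1 \<bullet> e2 = 0" "e2 \<bullet> n = 0"
proof -
  have "norm e1 = 1" "norm n = 1" "n \<bullet> e1 = 0" using assms by (simp_all add: norm_eq_1 inner_commute)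
  then have "(norm e2)\<^sup>2 = 1" using norm_cross_dot[of n e1] assms(4) by simp
  then show "e2 \<bullet> e2 = 1" by (simp add: power2_norm_eq_inner)
qed (simp_all add: assms(4) dot_cross_self)

lemma orthonormal_expansion:
  fixes e1 e2 n v :: "real^3"
  assumes "e1 \<bullet> e1 = 1" "n \<bullet> n = 1" "e1 \<bullet> n = 0" "e2 = cross3 n e1"
  shows "v = (v \<bullet> e1) *\<^sub>R e1 + (v \<bullet> e2) *\<^sub>R e2 + (v \<bullet> n) *\<^sub>R n"
proof -
  define w where "w = v - ((v \<bullet> e1) *\<^sub>R e1 + (v \<bullet> e2) *\<^sub>R e2 + (v \<bullet> n) *\<^sub>R n)"
  note f = assms(1-3) frame_inner[OF assms]
  note f' = f(3)[unfolded inner_commute[of e1]] f(5)[unfolded inner_commute[of e1]] f(6)[unfolded inner_commute[of e2]]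
  have w: "w \<bullet> e1 = 0" "w \<bullet> e2 = 0" "w \<bullet> n = 0"
    unfolding w_def using f f' by (simp_all add: inner_diff_left inner_add_left)
  have "cross3 w e2 = 0" unfolding assms(4) Lagrange using w by simp
  then have "w = 0 \<or> e2 = 0" using w(2) norm_and_cross_eq_0 by blast
  moreover have "e2 \<noteq> 0" using f(4) by auto
  ultimately show ?thesis unfolding w_def by simp
qed

text \<open>An orthonormal frame of principal directions, with \<open>dir_deriv V\<^sub>1\<close>, \<open>dir_deriv V\<^sub>2\<close> the derivatives along it:
  these are the structure equations of the surface.\<close>

locale principal_frame =
  fixes W :: "(real^2) set" and F n e1 e2 :: "real^2 \<Rightarrow> real^3" and V1 V2 :: "real^2 \<Rightarrow> real^2" and k l :: "real^2 \<Rightarrow> real"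
  assumes W: "open W"
    and sm: "smooth_on W F" "smooth_on W n" "smooth_on W e1" "smooth_on W e2" "smooth_on W V1" "smooth_on W V2"
      "smooth_on W k" "smooth_on W l"
    and on: "\<And>u. u \<in> W \<Longrightarrow> e1 u \<bullet> e1 u = 1" "\<And>u. u \<in> W \<Longrightarrow> n u \<bullet> n u = 1" "\<And>u. u \<in> W \<Longrightarrow> e1 u \<bullet> n u = 0"
      "\<And>u. u \<in> W \<Longrightarrow> e2 u = cross3 (n u) (e1 u)"
    and inj: "\<And>u. u \<in> W \<Longrightarrow> inj (frechet_derivative F (at u))"
    and F1: "\<And>u. u \<in> W \<Longrightarrow> dir_deriv V1 F u = e1 u" and F2: "\<And>u. u \<in> W \<Longrightarrow> dir_deriv V2 F u = e2 u"
    and n1: "\<And>u. u \<in> W \<Longrightarrow> dir_deriv V1 n u = - k u *\<^sub>R e1 u" and n2: "\<And>u. u \<in> W \<Longrightarrow> dir_deriv V2 n u = - l u *\<^sub>R e2 u"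
begin

definition "p u = dir_deriv V1 e1 u \<bullet> e2 u"
definition "q u = dir_deriv V2 e1 u \<bullet> e2 u"

lemma on2: "u \<in> W \<Longrightarrow> e2 u \<bullet> e2 u = 1" "u \<in> W \<Longrightarrow> e1 u \<bullet> e2 u = 0" "u \<in> W \<Longrightarrow> e2 u \<bullet> n u = 0"
  using frame_inner[OF on(1-4)] by blast+

lemma structure_equations:
  assumes u: "u \<in> W"
  shows "dir_deriv V1 e1 u = p u *\<^sub>R e2 u + k u *\<^sub>R n u" "dir_deriv V2 e1 u = q u *\<^sub>R e2 u"
    "dir_deriv V1 e2 u = - p u *\<^sub>R e1 u" "dir_deriv V2 e2 u = - q u *\<^sub>R e1 u + l u *\<^sub>R n u"
proof -
  note ex = orthonormal_expansion[OF on(1-4)[OF u]]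
  have e1: "dir_deriv V e1 u \<bullet> e1 u = 0" for V using dir_deriv_orthogonal[OF W sm(3,3) on(1) u, of V] by (simp add: inner_commute)
  have e2: "dir_deriv V e2 u \<bullet> e2 u = 0" for V using dir_deriv_orthogonal[OF W sm(4,4) on2(1) u, of V] by (simp add: inner_commute)
  have e1n: "dir_deriv V e1 u \<bullet> n u = - (e1 u \<bullet> dir_deriv V n u)" for V by (rule dir_deriv_orthogonal[OF W sm(3,2) on(3) u])
  have e2n: "dir_deriv V e2 u \<bullet> n u = - (e2 u \<bullet> dir_deriv V n u)" for V by (rule dir_deriv_orthogonal[OF W sm(4,2) on2(3) u])
  have e21: "dir_deriv V e2 u \<bullet> e1 u = - (dir_deriv V e1 u \<bullet> e2 u)" for V
    using dir_deriv_orthogonal[OF W sm(3,4) on2(2) u, of V] by (simp add: inner_commute)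
  note o = on[OF u] on2[OF u] on2(2)[OF u, unfolded inner_commute[of "e1 u"]]
  show "dir_deriv V1 e1 u = p u *\<^sub>R e2 u + k u *\<^sub>R n u"
    using ex[of "dir_deriv V1 e1 u"] e1[of V1] e1n[of V1] o unfolding p_def n1[OF u] by simp
  show "dir_deriv V2 e1 u = q u *\<^sub>R e2 u"
    using ex[of "dir_deriv V2 e1 u"] e1[of V2] e1n[of V2] o unfolding q_def n2[OF u] by simp
  show "dir_deriv V1 e2 u = - p u *\<^sub>R e1 u"
    using ex[of "dir_deriv V1 e2 u"] e2[of V1] e21[of V1] e2n[of V1] o unfolding p_def n1[OF u] by simp
  show "dir_deriv V2 e2 u = - q u *\<^sub>R e1 u + l u *\<^sub>R n u"
    using ex[of "dir_deriv V2 e2 u"] e2[of V2] e21[of V2] e2n[of V2] o unfolding q_def n2[OF u] by simp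
qed

lemma smooth_pq: "smooth_on W p" "smooth_on W q"
  unfolding p_def[abs_def] q_def[abs_def]
  by (intro smooth_on_inner[OF W] smooth_on_dir_deriv[OF W] sm)+

text \<open>The commutator applied to \<open>F\<close> determines the bracket of \<open>V\<^sub>1\<close> and \<open>V\<^sub>2\<close>, because \<open>dF\<close> is injective: the
  induced connection is torsion free.\<close>

lemma commutator:
  fixes g :: "real^2 \<Rightarrow> 'b::real_inner"
  assumes g: "smooth_on W g" and u: "u \<in> W"
  shows "dir_deriv V1 (dir_deriv V2 g) u - dir_deriv V2 (dir_deriv V1 g) u = - p u *\<^sub>R dir_deriv V1 g u - q u *\<^sub>R dir_deriv V2 g u"
proof -
  have lin: "linear (frechet_derivative f (at u))" if "smooth_on W f" for f :: "real^2 \<Rightarrow> 'c::real_normed_vector"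
    by (rule has_derivative_linear[OF smooth_on_has_derivative[OF that u]])
  let ?C = "dir_deriv V1 V2 u - dir_deriv V2 V1 u"
  have "frechet_derivative F (at u) ?C = dir_deriv V1 (dir_deriv V2 F) u - dir_deriv V2 (dir_deriv V1 F) u"
    by (rule dir_deriv_commutator[OF W sm(5,6,1) u, symmetric])
  also have "\<dots> = dir_deriv V1 e2 u - dir_deriv V2 e1 u"
    using dir_deriv_cong_open[OF W smooth_on_dir_deriv[OF W sm(6,1)] u F2, of V1] dir_deriv_cong_open[OF W smooth_on_dir_deriv[OF W sm(5,1)] u F1, of V2]
    by simp
  also have "\<dots> = - p u *\<^sub>R dir_deriv V1 F u - q u *\<^sub>R dir_deriv V2 F u"
    unfolding structure_equations[OF u] F1[OF u] F2[OF u] by simp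
  also have "\<dots> = frechet_derivative F (at u) (- p u *\<^sub>R V1 u - q u *\<^sub>R V2 u)"
    unfolding dir_deriv_def linear_diff[OF lin[OF sm(1)]] linear_scale[OF lin[OF sm(1)]] ..
  finally have C: "?C = - p u *\<^sub>R V1 u - q u *\<^sub>R V2 u" using inj[OF u] by (simp add: inj_eq)
  show ?thesis
    unfolding dir_deriv_commutator[OF W sm(5,6) g u] C linear_diff[OF lin[OF g]] linear_scale[OF lin[OF g]]
    unfolding dir_deriv_def ..
qed

text \<open>The commutator applied to the normal \<open>n\<close>.\<close>

lemma codazzi:
  assumes u: "u \<in> W"
  shows "dir_deriv V2 k u = p u * (k u - l u)" "dir_deriv V1 l u = q u * (k u - l u)"
proof -
  note m = smooth_on_minus[OF W]
  have "dir_deriv V1 (dir_deriv V2 n) u = dir_deriv V1 (\<lambda>u. - l u *\<^sub>R e2 u) u"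
    by (rule dir_deriv_cong_open[OF W smooth_on_dir_deriv[OF W sm(6,2)] u n2])
  also have "\<dots> = (l u * p u) *\<^sub>R e1 u - dir_deriv V1 l u *\<^sub>R e2 u"
    unfolding dir_deriv_scaleR[OF m[OF sm(8)] sm(4) u] dir_deriv_minus[OF sm(8) u] structure_equations[OF u] by simp
  finally have 1: "dir_deriv V1 (dir_deriv V2 n) u = (l u * p u) *\<^sub>R e1 u - dir_deriv V1 l u *\<^sub>R e2 u" .
  have "dir_deriv V2 (dir_deriv V1 n) u = dir_deriv V2 (\<lambda>u. - k u *\<^sub>R e1 u) u"
    by (rule dir_deriv_cong_open[OF W smooth_on_dir_deriv[OF W sm(5,2)] u n1])
  also have "\<dots> = - (k u * q u) *\<^sub>R e2 u - dir_deriv V2 k u *\<^sub>R e1 u"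
    unfolding dir_deriv_scaleR[OF m[OF sm(7)] sm(3) u] dir_deriv_minus[OF sm(7) u] structure_equations[OF u] by simp
  finally have 2: "dir_deriv V2 (dir_deriv V1 n) u = - (k u * q u) *\<^sub>R e2 u - dir_deriv V2 k u *\<^sub>R e1 u" .
  have e: "(l u * p u) *\<^sub>R e1 u - dir_deriv V1 l u *\<^sub>R e2 u - (- (k u * q u) *\<^sub>R e2 u - dir_deriv V2 k u *\<^sub>R e1 u)
     = (p u * k u) *\<^sub>R e1 u + (q u * l u) *\<^sub>R e2 u"
    using commutator[OF sm(2) u] unfolding 1 2 n1[OF u] n2[OF u] by simp
  note o = on[OF u] on2[OF u] on2(2)[OF u, unfolded inner_commute[of "e1 u"]]
  show "dir_deriv V2 k u = p u * (k u - l u)"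
    using arg_cong[OF e, of "\<lambda>v. v \<bullet> e1 u"] o(1,7,8) by (simp add: inner_diff_left inner_add_left algebra_simps)
  show "dir_deriv V1 l u = q u * (k u - l u)"
    using arg_cong[OF e, of "\<lambda>v. v \<bullet> e2 u"] o(5,6) by (simp add: inner_diff_left inner_add_left algebra_simps)
qed

text \<open>The commutator applied to \<open>e\<^sub>1\<close>.\<close>

lemma gauss:
  assumes u: "u \<in> W"
  shows "k u * l u = dir_deriv V2 p u - dir_deriv V1 q u - (p u)\<^sup>2 - (q u)\<^sup>2"
proof -
  have "dir_deriv V1 (dir_deriv V2 e1) u = dir_deriv V1 (\<lambda>u. q u *\<^sub>R e2 u) u"
    by (rule dir_deriv_cong_open[OF W smooth_on_dir_deriv[OF W sm(6,3)] u structure_equations(2)])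
  also have "\<dots> = - (q u * p u) *\<^sub>R e1 u + dir_deriv V1 q u *\<^sub>R e2 u"
    unfolding dir_deriv_scaleR[OF smooth_pq(2) sm(4) u] structure_equations[OF u] by simp
  finally have 1: "dir_deriv V1 (dir_deriv V2 e1) u = - (q u * p u) *\<^sub>R e1 u + dir_deriv V1 q u *\<^sub>R e2 u" .
  have "dir_deriv V2 (dir_deriv V1 e1) u = dir_deriv V2 (\<lambda>u. p u *\<^sub>R e2 u + k u *\<^sub>R n u) u"
    by (rule dir_deriv_cong_open[OF W smooth_on_dir_deriv[OF W sm(5,3)] u structure_equations(1)])
  also have "\<dots> = p u *\<^sub>R (- q u *\<^sub>R e1 u + l u *\<^sub>R n u) + dir_deriv V2 p u *\<^sub>R e2 u + (- (k u * l u) *\<^sub>R e2 u + dir_deriv V2 k u *\<^sub>R n u)"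
    unfolding dir_deriv_add[OF smooth_on_scaleR[OF W smooth_pq(1) sm(4)] smooth_on_scaleR[OF W sm(7,2)] u]
      dir_deriv_scaleR[OF smooth_pq(1) sm(4) u] dir_deriv_scaleR[OF sm(7,2) u] structure_equations[OF u] n2[OF u] by simp
  finally have 2: "dir_deriv V2 (dir_deriv V1 e1) u = p u *\<^sub>R (- q u *\<^sub>R e1 u + l u *\<^sub>R n u) + dir_deriv V2 p u *\<^sub>R e2 u + (- (k u * l u) *\<^sub>R e2 u + dir_deriv V2 k u *\<^sub>R n u)" .
  note o = on[OF u] on2[OF u] on2(3)[OF u, unfolded inner_commute[of "e2 u"]]
  show ?thesis
    using arg_cong[OF commutator[OF sm(3) u, unfolded 1 2 structure_equations[OF u]], of "\<lambda>v. v \<bullet> e2 u"] o(5,6,8)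
    by (simp add: inner_diff_left inner_add_left power2_eq_square algebra_simps)
qed

lemma curvature_frame:
  assumes "W \<noteq> {}" "\<alpha> \<noteq> 0" "\<And>u. u \<in> W \<Longrightarrow> k u \<noteq> l u" "\<And>u. u \<in> W \<Longrightarrow> k u * l u = c" "\<And>u. u \<in> W \<Longrightarrow> F u \<noteq> 0"
    "\<And>u. u \<in> W \<Longrightarrow> (k u + l u) * (F u \<bullet> F u) = \<alpha> * (F u \<bullet> n u)"
  shows "curvature_frame W V1 V2 (\<lambda>u. F u \<bullet> e1 u) (\<lambda>u. F u \<bullet> e2 u) (\<lambda>u. F u \<bullet> n u) k l p q (dir_deriv V2 p) (dir_deriv V1 q) \<alpha> c"
proof
  note si = smooth_on_inner[OF W sm(1)]
  note co = smooth_on_imp_continuous_on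
  show "continuous_on W (\<lambda>u. F u \<bullet> e1 u)" "continuous_on W (\<lambda>u. F u \<bullet> e2 u)" "continuous_on W k" "continuous_on W l"
    by (rule co si sm)+
  fix u assume u: "u \<in> W"
  have "F u \<bullet> F u = (F u \<bullet> e1 u) * (F u \<bullet> e1 u) + (F u \<bullet> e2 u) * (F u \<bullet> e2 u) + (F u \<bullet> n u) * (F u \<bullet> n u)"
    using arg_cong[OF orthonormal_expansion[OF on(1-4)[OF u], of "F u"], of "\<lambda>v. F u \<bullet> v"]
    by (simp add: inner_add_right)
  then have FF: "F u \<bullet> F u = (F u \<bullet> e1 u)\<^sup>2 + (F u \<bullet> e2 u)\<^sup>2 + (F u \<bullet> n u)\<^sup>2" by (simp add: power2_eq_square)
  show "(F u \<bullet> e1 u)\<^sup>2 + (F u \<bullet> e2 u)\<^sup>2 + (F u \<bullet> n u)\<^sup>2 > 0" unfolding FF[symmetric] using assms(5)[OF u] by simp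
  show "(k u + l u) * ((F u \<bullet> e1 u)\<^sup>2 + (F u \<bullet> e2 u)\<^sup>2 + (F u \<bullet> n u)\<^sup>2) = \<alpha> * (F u \<bullet> n u)"
    using assms(6)[OF u] unfolding FF .
  note o = on(1-3)[OF u] on2[OF u] on2(2)[OF u, unfolded inner_commute[of "e1 u"]]
    on(3)[OF u, unfolded inner_commute[of "e1 u"]] on2(3)[OF u, unfolded inner_commute[of "e2 u"]]
  note Di = dir_deriv_inner[OF sm(1) _ u] F1[OF u] F2[OF u] structure_equations[OF u] n1[OF u] n2[OF u]
  have E: "dir_deriv V1 (\<lambda>u. F u \<bullet> e1 u) u = 1 + p u * (F u \<bullet> e2 u) + k u * (F u \<bullet> n u)"
    "dir_deriv V2 (\<lambda>u. F u \<bullet> e1 u) u = q u * (F u \<bullet> e2 u)"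
    "dir_deriv V1 (\<lambda>u. F u \<bullet> e2 u) u = - p u * (F u \<bullet> e1 u)"
    "dir_deriv V2 (\<lambda>u. F u \<bullet> e2 u) u = 1 - q u * (F u \<bullet> e1 u) + l u * (F u \<bullet> n u)"
    "dir_deriv V1 (\<lambda>u. F u \<bullet> n u) u = - k u * (F u \<bullet> e1 u)"
    "dir_deriv V2 (\<lambda>u. F u \<bullet> n u) u = - l u * (F u \<bullet> e2 u)"
    unfolding dir_deriv_inner[OF sm(1,2) u] dir_deriv_inner[OF sm(1,3) u] dir_deriv_inner[OF sm(1,4) u] F1[OF u] F2[OF u] structure_equations[OF u] n1[OF u] n2[OF u]
    using o by (simp_all add: inner_add_right inner_diff_right)
  note L = line_deriv_dir_deriv[OF _ u]
  show "line_deriv V1 (\<lambda>u. F u \<bullet> e1 u) u (1 + p u * (F u \<bullet> e2 u) + k u * (F u \<bullet> n u))" using L[OF si[OF sm(3)], of V1] unfolding E .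
  show "line_deriv V2 (\<lambda>u. F u \<bullet> e1 u) u (q u * (F u \<bullet> e2 u))" using L[OF si[OF sm(3)], of V2] unfolding E .
  show "line_deriv V1 (\<lambda>u. F u \<bullet> e2 u) u (- p u * (F u \<bullet> e1 u))" using L[OF si[OF sm(4)], of V1] unfolding E .
  show "line_deriv V2 (\<lambda>u. F u \<bullet> e2 u) u (1 - q u * (F u \<bullet> e1 u) + l u * (F u \<bullet> n u))" using L[OF si[OF sm(4)], of V2] unfolding E .
  show "line_deriv V1 (\<lambda>u. F u \<bullet> n u) u (- k u * (F u \<bullet> e1 u))" using L[OF si[OF sm(2)], of V1] unfolding E .
  show "line_deriv V2 (\<lambda>u. F u \<bullet> n u) u (- l u * (F u \<bullet> e2 u))" using L[OF si[OF sm(2)], of V2] unfolding E .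
  show "\<exists>d. line_deriv V1 k u d" "\<exists>d. line_deriv V2 l u d" using L[OF sm(7)] L[OF sm(8)] by blast+
  show "line_deriv V2 k u (p u * (k u - l u))" using L[OF sm(7), of V2] unfolding codazzi[OF u] .
  show "line_deriv V1 l u (q u * (k u - l u))" using L[OF sm(8), of V1] unfolding codazzi[OF u] .
  show "line_deriv V2 p u (dir_deriv V2 p u)" "line_deriv V1 q u (dir_deriv V1 q u)" by (rule L smooth_pq)+
  show "c = dir_deriv V2 p u - dir_deriv V1 q u - (p u)\<^sup>2 - (q u)\<^sup>2" using gauss[OF u] assms(4)[OF u] by simp
  show "k u \<noteq> l u" "k u * l u = c" using assms u by auto
qed (use W assms in auto)

end

subsection \<open>Principal directions away from umbilics\<close>

text \<open>\<open>F\<^sub>2 \<times> n / J\<close> and \<open>n \<times> F\<^sub>1 / J\<close> form the basis of the tangent plane dual to \<open>F\<^sub>1\<close>, \<open>F\<^sub>2\<close>.\<close>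

lemma tangent_coordinates:
  fixes F1 F2 n T :: "real^3"
  assumes c: "cross3 F1 F2 = J *\<^sub>R n" "J \<noteq> 0" "n \<bullet> n = 1" and T: "T \<bullet> n = 0"
  shows "T = (T \<bullet> cross3 F2 n / J) *\<^sub>R F1 + (T \<bullet> cross3 n F1 / J) *\<^sub>R F2"
proof -
  define w where "w = T - ((T \<bullet> cross3 F2 n / J) *\<^sub>R F1 + (T \<bullet> cross3 n F1 / J) *\<^sub>R F2)"
  have n: "n = (1 / J) *\<^sub>R cross3 F1 F2" using c by simp
  have F: "F1 \<bullet> n = 0" "F2 \<bullet> n = 0" unfolding n by (simp_all add: dot_cross_self)
  have tr: "F1 \<bullet> cross3 F2 n = J" "F2 \<bullet> cross3 n F1 = J"
  proof -
    have "F1 \<bullet> cross3 F2 n = cross3 F1 F2 \<bullet> n" "F2 \<bullet> cross3 n F1 = cross3 F1 F2 \<bullet> n"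
      by (simp_all add: cross3_simps)
    then show "F1 \<bullet> cross3 F2 n = J" "F2 \<bullet> cross3 n F1 = J" unfolding c(1) using c(3) by simp_all
  qed
  have w: "w \<bullet> n = 0" "w \<bullet> cross3 F2 n = 0" "w \<bullet> cross3 n F1 = 0"
    unfolding w_def using T F tr c(2) by (simp_all add: inner_diff_left inner_add_left dot_cross_self)
  define x where "x = cross3 w n"
  have x: "x \<bullet> F1 = 0" "x \<bullet> F2 = 0" "x \<bullet> n = 0"
  proof -
    have "x \<bullet> F1 = w \<bullet> cross3 n F1" "x \<bullet> F2 = - (w \<bullet> cross3 F2 n)" "x \<bullet> n = 0"
      unfolding x_def by (simp_all add: cross3_simps)
    then show "x \<bullet> F1 = 0" "x \<bullet> F2 = 0" "x \<bullet> n = 0" using w by simp_all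
  qed
  have n0: "n \<noteq> 0" using c(3) by auto
  have "cross3 x n = 0" unfolding n cross_mult_right Lagrange using x by simp
  then have "x = 0" using x(3) norm_and_cross_eq_0 n0 by blast
  then have "w = 0" using w(1) norm_and_cross_eq_0 n0 unfolding x_def by blast
  then show ?thesis unfolding w_def by simp
qed

lemma coordinates_unique:
  fixes F1 F2 n :: "real^3"
  assumes c: "cross3 F1 F2 = J *\<^sub>R n" "J \<noteq> 0" "n \<bullet> n = 1"
  shows "(x *\<^sub>R F1 + y *\<^sub>R F2) \<bullet> cross3 F2 n / J = x" "(x *\<^sub>R F1 + y *\<^sub>R F2) \<bullet> cross3 n F1 / J = y"
proof -
  have "F1 \<bullet> cross3 F2 n = cross3 F1 F2 \<bullet> n" "F2 \<bullet> cross3 n F1 = cross3 F1 F2 \<bullet> n"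
    by (simp_all add: cross3_simps)
  then have tr: "F1 \<bullet> cross3 F2 n = J" "F2 \<bullet> cross3 n F1 = J" unfolding c(1) using c(3) by simp_all
  show "(x *\<^sub>R F1 + y *\<^sub>R F2) \<bullet> cross3 F2 n / J = x" "(x *\<^sub>R F1 + y *\<^sub>R F2) \<bullet> cross3 n F1 / J = y"
    using c(2) by (simp_all add: inner_add_left tr dot_cross_self)
qed

text \<open>Both sides are alternating in the two coordinate vectors. So the mean curvature, like the
  determinant, can be read off from any basis of the plane.\<close>

lemma cross3_alternating:
  fixes F1 F2 n1 n2 :: "real^3"
  shows "cross3 (x1 *\<^sub>R F1 + x2 *\<^sub>R F2) (y1 *\<^sub>R n1 + y2 *\<^sub>R n2) + cross3 (x1 *\<^sub>R n1 + x2 *\<^sub>R n2) (y1 *\<^sub>R F1 + y2 *\<^sub>R F2)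
     = (x1 * y2 - x2 * y1) *\<^sub>R (cross3 F1 n2 + cross3 n1 F2)"
  by (simp add: vec_eq_iff forall_3 cross_components) (simp add: algebra_simps)

lemma cross3_det:
  fixes F1 F2 :: "real^3"
  shows "cross3 (x1 *\<^sub>R F1 + x2 *\<^sub>R F2) (y1 *\<^sub>R F1 + y2 *\<^sub>R F2) = (x1 * y2 - x2 * y1) *\<^sub>R cross3 F1 F2"
  by (simp add: vec_eq_iff forall_3 cross_components) (simp add: algebra_simps)

text \<open>In the basis \<open>F\<^sub>1\<close>, \<open>F\<^sub>2\<close> of the tangent plane the hypotheses say that \<open>-S\<close> has trace \<open>-H\<close> and determinant \<open>c\<close>; so
  by Cayley and Hamilton \<open>(S - \<kappa>\<^sub>2)\<close> maps into the eigenspace of \<open>\<kappa>\<^sub>1\<close>.\<close>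

lemma weingarten_eigenvector:
  fixes F1 F2 n n1 n2 :: "real^3"
  assumes c: "cross3 F1 F2 = J *\<^sub>R n" "J \<noteq> 0" "n \<bullet> n = 1" and n: "n1 \<bullet> n = 0" "n2 \<bullet> n = 0"
    and mean: "cross3 F1 n2 + cross3 n1 F2 = - (k + l) *\<^sub>R cross3 F1 F2"
    and gauss: "cross3 n1 n2 = (k * l) *\<^sub>R cross3 F1 F2"
    and w: "w = n1 + l *\<^sub>R F1 \<or> w = n2 + l *\<^sub>R F2"
  shows "(r *\<^sub>R w \<bullet> cross3 F2 n / J) *\<^sub>R n1 + (r *\<^sub>R w \<bullet> cross3 n F1 / J) *\<^sub>R n2 = - k *\<^sub>R (r *\<^sub>R w)"
proof -
  obtain a11 a12 where 1: "n1 = a11 *\<^sub>R F1 + a12 *\<^sub>R F2" using tangent_coordinates[OF c n(1)] by blast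
  obtain a21 a22 where 2: "n2 = a21 *\<^sub>R F1 + a22 *\<^sub>R F2" using tangent_coordinates[OF c n(2)] by blast
  have X: "cross3 F1 F2 \<noteq> 0" using c by auto
  have h: "cross3 F1 n2 + cross3 n1 F2 = (a11 + a22) *\<^sub>R cross3 F1 F2"
    unfolding 1 2 by (simp add: vec_eq_iff forall_3 cross_components) (simp add: algebra_simps)
  have tr: "a11 + a22 = - (k + l)" using trans[OF h[symmetric] mean] X scaleR_cancel_right by blast
  have h: "cross3 n1 n2 = (a11 * a22 - a12 * a21) *\<^sub>R cross3 F1 F2" unfolding 1 2 by (rule cross3_det)
  have dt: "a11 * a22 - a12 * a21 = k * l" using trans[OF h[symmetric] gauss] X scaleR_cancel_right by blast
  have *: "(r *\<^sub>R w \<bullet> cross3 F2 n / J) *\<^sub>R n1 + (r *\<^sub>R w \<bullet> cross3 n F1 / J) *\<^sub>R n2 = - k *\<^sub>R (r *\<^sub>R w)"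
    if "w = x *\<^sub>R F1 + y *\<^sub>R F2" "x * a11 + y * a21 = - k * x" "x * a12 + y * a22 = - k * y" for x y
  proof -
    have e: "r *\<^sub>R w = (r * x) *\<^sub>R F1 + (r * y) *\<^sub>R F2" unfolding that(1) by (simp add: scaleR_add_right)
    have "(r * x) *\<^sub>R n1 + (r * y) *\<^sub>R n2 = (r * (x * a11 + y * a21)) *\<^sub>R F1 + (r * (x * a12 + y * a22)) *\<^sub>R F2"
      unfolding 1 2 by (simp add: scaleR_add_right distrib_left scaleR_add_left mult.assoc)
    also have "\<dots> = - k *\<^sub>R ((r * x) *\<^sub>R F1 + (r * y) *\<^sub>R F2)"
      unfolding that(2,3) by (simp add: scaleR_add_right mult.left_commute)
    finally show ?thesis unfolding e coordinates_unique[OF c] .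
  qed
  from w show ?thesis
  proof
    assume "w = n1 + l *\<^sub>R F1"
    then have "w = (a11 + l) *\<^sub>R F1 + a12 *\<^sub>R F2" unfolding 1 by (simp add: scaleR_add_left)
    then show ?thesis by (rule *) (use tr dt in algebra)+
  next
    assume "w = n2 + l *\<^sub>R F2"
    then have "w = a21 *\<^sub>R F1 + (a22 + l) *\<^sub>R F2" unfolding 2 by (simp add: scaleR_add_left)
    then show ?thesis by (rule *) (use tr dt in algebra)+
  qed
qed

text \<open>Since \<open>S\<close> is self-adjoint, it maps the orthogonal complement of \<open>e\<^sub>1\<close> in the tangent plane
  to itself; the trace gives the eigenvalue.\<close>

lemma weingarten_second_eigenvector:
  fixes F1 F2 n n1 n2 :: "real^3"
  assumes c: "cross3 F1 F2 = J *\<^sub>R n" "J \<noteq> 0" "n \<bullet> n = 1" and n: "n1 \<bullet> n = 0" "n2 \<bullet> n = 0"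
    and sym: "F1 \<bullet> n2 = F2 \<bullet> n1"
    and mean: "cross3 F1 n2 + cross3 n1 F2 = - (k + l) *\<^sub>R cross3 F1 F2"
    and e: "e1 \<bullet> e1 = 1" "e1 \<bullet> n = 0" "e2 = cross3 n e1"
    and e1: "(e1 \<bullet> cross3 F2 n / J) *\<^sub>R n1 + (e1 \<bullet> cross3 n F1 / J) *\<^sub>R n2 = - k *\<^sub>R e1"
  shows "(e2 \<bullet> cross3 F2 n / J) *\<^sub>R n1 + (e2 \<bullet> cross3 n F1 / J) *\<^sub>R n2 = - l *\<^sub>R e2"
proof -
  define x1 x2 y1 y2 where xy: "x1 = e1 \<bullet> cross3 F2 n / J" "x2 = e1 \<bullet> cross3 n F1 / J"
    "y1 = e2 \<bullet> cross3 F2 n / J" "y2 = e2 \<bullet> cross3 n F1 / J"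
  note fi = frame_inner[OF e(1) c(3) e(2,3)]
  have E1: "e1 = x1 *\<^sub>R F1 + x2 *\<^sub>R F2" unfolding xy by (rule tangent_coordinates[OF c e(2)])
  have E2: "e2 = y1 *\<^sub>R F1 + y2 *\<^sub>R F2" unfolding xy by (rule tangent_coordinates[OF c fi(3)])
  define v where "v = y1 *\<^sub>R n1 + y2 *\<^sub>R n2"
  have N1: "x1 *\<^sub>R n1 + x2 *\<^sub>R n2 = - k *\<^sub>R e1" using e1 unfolding xy .
  have "v \<bullet> e1 = (x1 *\<^sub>R n1 + x2 *\<^sub>R n2) \<bullet> e2"
    unfolding v_def E1 E2 using sym by (simp add: inner_add_left inner_add_right inner_commute algebra_simps)
  then have v1: "v \<bullet> e1 = 0" unfolding N1 using fi(2) by simp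
  have vn: "v \<bullet> n = 0" unfolding v_def using n by (simp add: inner_add_left)
  define m where "m = v \<bullet> e2"
  have v: "v = m *\<^sub>R e2" using orthonormal_expansion[OF e(1) c(3) e(2,3), of v] v1 vn unfolding m_def by simp
  have "cross3 e1 v + cross3 (- k *\<^sub>R e1) e2 = - (k + l) *\<^sub>R cross3 e1 e2"
  proof -
    have "cross3 e1 v + cross3 (- k *\<^sub>R e1) e2 = (x1 * y2 - x2 * y1) *\<^sub>R (cross3 F1 n2 + cross3 n1 F2)"
      unfolding N1[symmetric] v_def unfolding E1 E2 by (rule cross3_alternating)
    also have "\<dots> = - (k + l) *\<^sub>R ((x1 * y2 - x2 * y1) *\<^sub>R cross3 F1 F2)" unfolding mean by simp
    also have "\<dots> = - (k + l) *\<^sub>R cross3 e1 e2" unfolding E1 E2 cross3_det ..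
    finally show ?thesis .
  qed
  then have "(m - k) *\<^sub>R cross3 e1 e2 = (- (k + l)) *\<^sub>R cross3 e1 e2"
    unfolding v cross_mult_right cross_mult_left by (simp add: scaleR_left_diff_distrib)
  moreover have "cross3 e1 e2 = n" unfolding e(3) Lagrange using e by (simp add: inner_commute)
  moreover have "n \<noteq> 0" using c(3) by auto
  ultimately have "m = - l" by (simp only: scaleR_cancel_right) simp
  then show ?thesis using v unfolding v_def xy by simp
qed

text \<open>Where \<open>H\<^sup>2 > 4 c\<close> the principal curvatures \<open>k > l\<close> are smooth functions of \<open>H\<close>. One of \<open>(S
  - l) F\<^sub>1\<close>, \<open>(S - l) F\<^sub>2\<close> is not zero at a given point, and after normalisation it is a smooth
  principal direction nearby.\<close>

theorem no_nonumbilic_patch: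
  fixes F n :: "real^2 \<Rightarrow> real^3"
  assumes W: "open W" "W \<noteq> {}" and F: "smooth_on W F" "smooth_on W n"
    and nn: "\<And>u. u \<in> W \<Longrightarrow> n u \<bullet> n u = 1"
    and cr: "\<And>u. u \<in> W \<Longrightarrow> cross3 (pd1 F u) (pd2 F u) = J u *\<^sub>R n u" "\<And>u. u \<in> W \<Longrightarrow> J u \<noteq> 0"
    and mean: "\<And>u. u \<in> W \<Longrightarrow> cross3 (pd1 F u) (pd2 n u) + cross3 (pd1 n u) (pd2 F u) = - H u *\<^sub>R cross3 (pd1 F u) (pd2 F u)"
    and gauss: "\<And>u. u \<in> W \<Longrightarrow> cross3 (pd1 n u) (pd2 n u) = c *\<^sub>R cross3 (pd1 F u) (pd2 F u)"
    and F0: "\<And>u. u \<in> W \<Longrightarrow> F u \<noteq> 0" and H: "\<And>u. u \<in> W \<Longrightarrow> H u * (F u \<bullet> F u) = \<alpha> * (F u \<bullet> n u)" and \<alpha>: "\<alpha> \<noteq> 0"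
    and nonumbilic: "\<And>u. u \<in> W \<Longrightarrow> (H u)\<^sup>2 - 4 * c > 0"
  shows False
proof -
  define k where "k = (\<lambda>u. (H u + sqrt ((H u)\<^sup>2 - 4 * c)) / 2)"
  define l where "l = (\<lambda>u. (H u - sqrt ((H u)\<^sup>2 - 4 * c)) / 2)"
  have kl: "k u + l u = H u" "k u * l u = c" "k u \<noteq> l u" if u: "u \<in> W" for u
  proof -
    have "sqrt ((H u)\<^sup>2 - 4 * c) ^ 2 = (H u)\<^sup>2 - 4 * c" using nonumbilic[OF u] by simp
    moreover have "(h + r) / 2 * ((h - r) / 2) = (h\<^sup>2 - r\<^sup>2) / 4" for h r :: real
      by (simp add: field_simps power2_eq_square)
    ultimately show "k u * l u = c" unfolding k_def l_def by simp
    show "k u + l u = H u" unfolding k_def l_def by (simp add: field_simps)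
    have "sqrt ((H u)\<^sup>2 - 4 * c) > 0" using nonumbilic[OF u] by simp
    then show "k u \<noteq> l u" unfolding k_def l_def by (auto simp: field_simps)
  qed
  have smF: "smooth_on W (\<lambda>u. F u \<bullet> F u)" "smooth_on W (\<lambda>u. F u \<bullet> n u)" by (rule smooth_on_inner[OF W(1)] F)+
  have "smooth_on W (\<lambda>u. \<alpha> * (F u \<bullet> n u) / (F u \<bullet> F u))"
    by (rule smooth_on_divide[OF W(1) smooth_on_mult[OF W(1) smooth_on_const[OF W(1)] smF(2)] smF(1)]) (use F0 in simp)
  then have smH: "smooth_on W H"
    by (rule smooth_on_cong_open[OF W(1), rotated]) (use H F0 in \<open>simp add: field_simps\<close>)
  have smd: "smooth_on W (\<lambda>u. sqrt ((H u)\<^sup>2 - 4 * c))"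
    unfolding power2_eq_square
    by (rule smooth_on_sqrt[OF W(1) smooth_on_diff[OF W(1) smooth_on_mult[OF W(1) smH smH] smooth_on_const[OF W(1)]]])
      (use nonumbilic in \<open>simp add: power2_eq_square\<close>)
  have smk: "smooth_on W k" "smooth_on W l"
    unfolding k_def l_def
    by (rule smooth_on_divide[OF W(1) smooth_on_add[OF W(1) smH smd] smooth_on_const[OF W(1)]], simp)
      (rule smooth_on_divide[OF W(1) smooth_on_diff[OF W(1) smH smd] smooth_on_const[OF W(1)]], simp)
  note pd = smooth_on_frechet_derivative[OF F(1)] smooth_on_frechet_derivative[OF F(2)]
  have n0: "frechet_derivative n (at u) v \<bullet> n u = 0" if u: "u \<in> W" for u v
    using dir_deriv_orthogonal[OF W(1) F(2,2) nn u, of "\<lambda>_. v"] unfolding dir_deriv_def by (simp add: inner_commute)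
  have Fn: "pd1 F u \<bullet> n u = 0" "pd2 F u \<bullet> n u = 0" if u: "u \<in> W" for u
  proof -
    have "n u = (1 / J u) *\<^sub>R cross3 (pd1 F u) (pd2 F u)" using cr[OF u] by simp
    then show "pd1 F u \<bullet> n u = 0" "pd2 F u \<bullet> n u = 0" by (simp_all add: dot_cross_self)
  qed
  have sym: "pd1 F u \<bullet> pd2 n u = pd2 F u \<bullet> pd1 n u" if u: "u \<in> W" for u
  proof -
    have "pd2 (pd1 F) u \<bullet> n u = - (pd1 F u \<bullet> pd2 n u)"
      using dir_deriv_orthogonal[OF W(1) pd(1) F(2) Fn(1) u, of "\<lambda>_. axis 2 1"] unfolding dir_deriv_def .
    moreover have "pd1 (pd2 F) u \<bullet> n u = - (pd2 F u \<bullet> pd1 n u)"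
      using dir_deriv_orthogonal[OF W(1) pd(1) F(2) Fn(2) u, of "\<lambda>_. axis 1 1"] unfolding dir_deriv_def .
    ultimately show ?thesis unfolding second_derivative_symmetric[OF W(1) F(1) u, of "axis 2 1" "axis 1 1"] by simp
  qed
  have mean': "cross3 (pd1 F u) (pd2 n u) + cross3 (pd1 n u) (pd2 F u) = - (k u + l u) *\<^sub>R cross3 (pd1 F u) (pd2 F u)"
    and gauss': "cross3 (pd1 n u) (pd2 n u) = (k u * l u) *\<^sub>R cross3 (pd1 F u) (pd2 F u)" if u: "u \<in> W" for u
    unfolding kl[OF u] by (rule mean[OF u], rule gauss[OF u])
  obtain u0 where u0: "u0 \<in> W" using W(2) by blast
  define w1 where "w1 = (\<lambda>u. pd1 n u + l u *\<^sub>R pd1 F u)"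
  define w2 where "w2 = (\<lambda>u. pd2 n u + l u *\<^sub>R pd2 F u)"
  have "w1 u0 \<noteq> 0 \<or> w2 u0 \<noteq> 0"
  proof (rule ccontr)
    assume "\<not> ?thesis"
    then have "pd1 n u0 = - l u0 *\<^sub>R pd1 F u0" "pd2 n u0 = - l u0 *\<^sub>R pd2 F u0"
      unfolding w1_def w2_def by (simp_all add: add_eq_0_iff2)
    from mean'[OF u0, unfolded this]
    have "(- l u0 + - l u0) *\<^sub>R cross3 (pd1 F u0) (pd2 F u0) = (- (k u0 + l u0)) *\<^sub>R cross3 (pd1 F u0) (pd2 F u0)"
      unfolding cross_mult_left cross_mult_right scaleR_left_distrib[of "- l u0" "- l u0"] .
    moreover have "cross3 (pd1 F u0) (pd2 F u0) \<noteq> 0"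
    proof -
      have "n u0 \<noteq> 0" using nn[OF u0] by (metis inner_zero_left zero_neq_one)
      then show ?thesis unfolding cr(1)[OF u0] using cr(2)[OF u0] by simp
    qed
    ultimately have "- l u0 + - l u0 = - (k u0 + l u0)" using scaleR_cancel_right by blast
    then show False using kl(3)[OF u0] by simp
  qed
  moreover have "smooth_on W w1" "smooth_on W w2"
    unfolding w1_def w2_def by (rule smooth_on_add[OF W(1) pd(2) smooth_on_scaleR[OF W(1) smk(2) pd(1)]])+
  ultimately obtain w where w: "smooth_on W w" "w u0 \<noteq> 0" "w = w1 \<or> w = w2" by blast
  define U where "U = {u \<in> W. w u \<noteq> 0}"
  have "open (W \<inter> w -` (- {0}))"
    by (rule continuous_open_preimage[OF smooth_on_imp_continuous_on[OF w(1)] W(1) open_Compl[OF closed_singleton]])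
  then have U: "open U" unfolding U_def by (simp add: vimage_def Int_def)
  have UW: "U \<subseteq> W" "u0 \<in> U" unfolding U_def using u0 w by auto
  note UWD = subsetD[OF UW(1)]
  define e1 where "e1 = (\<lambda>u. sgn (w u))"
  define e2 where "e2 = (\<lambda>u. cross3 (n u) (e1 u))"
  define V where "V = (\<lambda>e u. (e u \<bullet> cross3 (pd2 F u) (n u) / J u) *\<^sub>R axis (1::2) (1::real)
     + (e u \<bullet> cross3 (n u) (pd1 F u) / J u) *\<^sub>R axis (2::2) (1::real))"
  have smJ: "smooth_on W J"
  proof (rule smooth_on_cong_open[OF W(1)])
    show "smooth_on W (\<lambda>u. cross3 (pd1 F u) (pd2 F u) \<bullet> n u)"
      by (rule smooth_on_inner[OF W(1) smooth_on_cross3[OF W(1) pd(1) pd(1)] F(2)])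
  qed (simp add: cr(1) nn)
  have smW: "smooth_on U f" if "smooth_on W f" for f :: "real^2 \<Rightarrow> 'c::real_normed_vector"
    by (rule smooth_on_subset[OF that UW(1)])
  have sme1: "smooth_on U e1" unfolding e1_def by (rule smooth_on_sgn[OF U smW[OF w(1)]]) (simp add: U_def)
  have sme2: "smooth_on U e2" unfolding e2_def by (rule smooth_on_cross3[OF U smW[OF F(2)] sme1])
  have smV: "smooth_on U (V e)" if "smooth_on U e" for e
    unfolding V_def
    by (rule smooth_on_add[OF U smooth_on_scaleR[OF U smooth_on_divide[OF U smooth_on_inner[OF U that
              smooth_on_cross3[OF U smW[OF pd(1)] smW[OF F(2)]]] smW[OF smJ]] smooth_on_const[OF U]]
          smooth_on_scaleR[OF U smooth_on_divide[OF U smooth_on_inner[OF U that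
              smooth_on_cross3[OF U smW[OF F(2)] smW[OF pd(1)]]] smW[OF smJ]] smooth_on_const[OF U]]])
      (use cr(2) UWD in blast)+
  have DV: "dir_deriv (V e) g u = (e u \<bullet> cross3 (pd2 F u) (n u) / J u) *\<^sub>R pd1 g u + (e u \<bullet> cross3 (n u) (pd1 F u) / J u) *\<^sub>R pd2 g u"
    if "smooth_on W g" "u \<in> W" for e and g :: "real^2 \<Rightarrow> real^3" and u
    unfolding dir_deriv_partials[OF that] V_def by (simp add: axis_def)
  have e11: "e1 u \<bullet> e1 u = 1" if "u \<in> U" for u
    using that unfolding e1_def U_def by (simp add: dot_square_norm norm_sgn)
  have e1n: "e1 u \<bullet> n u = 0" if u: "u \<in> U" for u
  proof -
    have "w u \<bullet> n u = 0" using w(3) n0[OF UWD[OF u]] Fn[OF UWD[OF u]] unfolding w1_def w2_def by (auto simp: inner_add_left)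
    then show ?thesis unfolding e1_def sgn_div_norm by simp
  qed
  note en = frame_inner[OF e11 nn[OF UWD] e1n e2_def[THEN fun_cong]]
  have DVn1: "dir_deriv (V e1) n u = - k u *\<^sub>R e1 u" if u: "u \<in> U" for u
  proof -
    note u' = UWD[OF u]
    have "w u = pd1 n u + l u *\<^sub>R pd1 F u \<or> w u = pd2 n u + l u *\<^sub>R pd2 F u" using w(3) unfolding w1_def w2_def by auto
    from weingarten_eigenvector[OF cr(1)[OF u'] cr(2)[OF u'] nn[OF u'] n0[OF u'] n0[OF u'] mean'[OF u'] gauss'[OF u'] this]
    show ?thesis unfolding DV[OF F(2) u'] e1_def sgn_div_norm .
  qed
  have DVn2: "dir_deriv (V e2) n u = - l u *\<^sub>R e2 u" if u: "u \<in> U" for u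
  proof -
    note u' = UWD[OF u]
    show ?thesis unfolding DV[OF F(2) u']
      by (rule weingarten_second_eigenvector[OF cr(1)[OF u'] cr(2)[OF u'] nn[OF u'] n0[OF u'] n0[OF u'] sym[OF u'] mean'[OF u'] e11[OF u] e1n[OF u]])
        (simp_all add: e2_def DVn1[OF u, unfolded DV[OF F(2) u']])
  qed
  interpret principal_frame U F n e1 e2 "V e1" "V e2" k l
  proof
    fix u assume u: "u \<in> U"
    note u' = UWD[OF u]
    show "e1 u \<bullet> e1 u = 1" "n u \<bullet> n u = 1" "e1 u \<bullet> n u = 0" using e11[OF u] nn[OF u'] e1n[OF u] .
    show "e2 u = cross3 (n u) (e1 u)" unfolding e2_def ..
    show "dir_deriv (V e1) n u = - k u *\<^sub>R e1 u" "dir_deriv (V e2) n u = - l u *\<^sub>R e2 u" using DVn1[OF u] DVn2[OF u] .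
    show "dir_deriv (V e1) F u = e1 u" "dir_deriv (V e2) F u = e2 u"
      unfolding DV[OF F(1) u'] by (rule tangent_coordinates[OF cr(1)[OF u'] cr(2)[OF u'] nn[OF u'], symmetric], rule e1n[OF u] en(3)[OF u u u])+
    note lin = has_derivative_linear[OF smooth_on_has_derivative[OF F(1) u']]
    show "inj (frechet_derivative F (at u))"
    proof (rule linear_injective_0[OF lin, THEN iffD2], intro allI impI)
      fix v :: "real^2" assume "frechet_derivative F (at u) v = 0"
      then have z: "(v$1) *\<^sub>R pd1 F u + (v$2) *\<^sub>R pd2 F u = 0" using linear_vec2[OF lin, of v] by simp
      show "v = 0"
        using coordinates_unique[OF cr(1)[OF u'] cr(2)[OF u'] nn[OF u'], of "v$1" "v$2"] unfolding z
        by (simp add: vec_eq_iff forall_2)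
    qed
  qed (use U smW F smk sme1 sme2 smV in auto)
  have "curvature_frame U (V e1) (V e2) (\<lambda>u. F u \<bullet> e1 u) (\<lambda>u. F u \<bullet> e2 u) (\<lambda>u. F u \<bullet> n u) k l p q (dir_deriv (V e2) p) (dir_deriv (V e1) q) \<alpha> c"
    by (rule curvature_frame) (use UW \<alpha> kl F0 H UWD in auto)
  then show False by (rule curvature_frame.inconsistent)
qed

section \<open>The area measure\<close>

subsection \<open>Change of variables for non-negative functions\<close>

text \<open>This carries the change of variables formula over from absolutely integrable functions to
  integrals with values in \<open>[0, \<infinity>]\<close>.\<close>

lemma nn_integral_eq_absolutely_integrable:
  fixes g :: "'a::euclidean_space \<Rightarrow> real"
  assumes m: "(\<lambda>u. indicator S u * g u) \<in> borel_measurable borel" and g: "\<And>u. u \<in> S \<Longrightarrow> 0 \<le> g u"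
  shows "(\<integral>\<^sup>+u. ennreal (g u) * indicator S u \<partial>lborel) =
    (if g absolutely_integrable_on S then ennreal (integral S g) else \<infinity>)"
proof -
  let ?f = "\<lambda>u. indicator S u * g u"
  have f0: "0 \<le> ?f u" for u using g by (simp add: indicator_def)
  have e: "(\<integral>\<^sup>+u. ennreal (g u) * indicator S u \<partial>lborel) = (\<integral>\<^sup>+u. ennreal (?f u) \<partial>lborel)"
    by (rule nn_integral_cong) (simp add: indicator_def)
  have i: "g absolutely_integrable_on S \<longleftrightarrow> integrable lborel ?f"
    unfolding set_integrable_def using m by (simp add: integrable_completion)
  show ?thesis
  proof (cases "integrable lborel ?f")
    case True
    have "integral\<^sup>L lborel ?f = (LINT u:S|lebesgue. g u)"
      unfolding set_lebesgue_integral_def using m by (simp add: integral_completion)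
    also have "\<dots> = integral S g" using i True by (intro set_lebesgue_integral_eq_integral(2)) simp
    finally show ?thesis
      unfolding e nn_integral_eq_integral[OF True AE_I2[OF f0]] using i True by simp
  next
    case False
    have "(\<integral>\<^sup>+u. ennreal (?f u) \<partial>lborel) = \<infinity>"
    proof (rule ccontr)
      assume "(\<integral>\<^sup>+u. ennreal (?f u) \<partial>lborel) \<noteq> \<infinity>"
      then have "integrable lborel ?f"
        using m f0 by (intro integrableI_nonneg) (auto simp: less_top)
      then show False using False by simp
    qed
    then show ?thesis unfolding e using i False by simp
  qed
qed

lemma nn_integral_change_of_variables:
  fixes g :: "real^2 \<Rightarrow> real^2" and f :: "real^2 \<Rightarrow> real"
  assumes der: "\<And>u. u \<in> S \<Longrightarrow> (g has_derivative g' u) (at u)"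
    and h: "\<And>u. u \<in> S \<Longrightarrow> h (g u) = u" "continuous_on (g ` S) h"
    and f0: "\<And>v. v \<in> g ` S \<Longrightarrow> 0 \<le> f v"
    and m1: "(\<lambda>u. indicator S u * (\<bar>det (matrix (g' u))\<bar> * f (g u))) \<in> borel_measurable borel"
    and m2: "(\<lambda>v. indicator (g ` S) v * f v) \<in> borel_measurable borel"
  shows "(\<integral>\<^sup>+u. ennreal (\<bar>det (matrix (g' u))\<bar> * f (g u)) * indicator S u \<partial>lborel) =
    (\<integral>\<^sup>+v. ennreal (f v) * indicator (g ` S) v \<partial>lborel)"
proof -
  let ?D = "\<lambda>u. \<bar>det (matrix (g' u))\<bar> * f (g u)"
  have *: "(\<lambda>u. \<bar>det (matrix (g' u))\<bar> *\<^sub>R (vec (f (g u)) :: real^1)) absolutely_integrable_on S \<and>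
      integral S (\<lambda>u. \<bar>det (matrix (g' u))\<bar> *\<^sub>R (vec (f (g u)) :: real^1)) = b \<longleftrightarrow>
      (\<lambda>v. vec (f v) :: real^1) absolutely_integrable_on (g ` S) \<and> integral (g ` S) (\<lambda>v. vec (f v) :: real^1) = b" for b
    by (rule has_absolute_integral_change_of_variables_invertible[OF has_derivative_at_withinI[OF der] h])
  have v: "\<bar>det (matrix (g' u))\<bar> *\<^sub>R (vec (f (g u)) :: real^1) = vec (?D u)" for u
    by (simp add: vec_eq_iff)
  have "?D absolutely_integrable_on S \<and> integral S ?D = b \<longleftrightarrow>
      f absolutely_integrable_on (g ` S) \<and> integral (g ` S) f = b" for b
    using *[of "vec b", unfolded v] unfolding absolutely_integrable_on_1_iff integral_on_1_eq by (simp add: vec_eq_iff)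
  then have "?D absolutely_integrable_on S \<longleftrightarrow> f absolutely_integrable_on (g ` S)"
    "?D absolutely_integrable_on S \<Longrightarrow> integral S ?D = integral (g ` S) f" by blast+
  moreover have "(\<integral>\<^sup>+u. ennreal (?D u) * indicator S u \<partial>lborel) =
      (if ?D absolutely_integrable_on S then ennreal (integral S ?D) else \<infinity>)"
    by (rule nn_integral_eq_absolutely_integrable[OF m1]) (simp add: f0)
  moreover have "(\<integral>\<^sup>+v. ennreal (f v) * indicator (g ` S) v \<partial>lborel) =
      (if f absolutely_integrable_on (g ` S) then ennreal (integral (g ` S) f) else \<infinity>)"
    by (rule nn_integral_eq_absolutely_integrable[OF m2 f0])
  ultimately show ?thesis by simp
qed

subsection \<open>Charts\<close>

locale surface =
  fixes X :: "'a topology" and A :: "'a chart set"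
  assumes surface: "oriented_surface X A"
begin

lemma Hausdorff: "Hausdorff_space X" and second_countable: "second_countable X"
  and cover: "topspace X = (\<Union>(D, x)\<in>A. x ` D)"
  using surface unfolding oriented_surface_def by simp_all

lemma chart:
  assumes "(D, x) \<in> A"
  shows "open D" "openin X (x ` D)" "homeomorphic_map (top_of_set D) (subtopology X (x ` D)) x"
  using surface assms unfolding oriented_surface_def by auto

lemma chart_inj: "(D, x) \<in> A \<Longrightarrow> inj_on x D"
  using homeomorphic_imp_injective_map[OF chart(3)] by simp

lemma chart_subset: "(D, x) \<in> A \<Longrightarrow> x ` D \<subseteq> topspace X"
  using openin_subset[OF chart(2)] .

lemma chart_continuous: "(D, x) \<in> A \<Longrightarrow> continuous_map (top_of_set D) X x"
  using homeomorphic_imp_continuous_map[OF chart(3)] continuous_map_in_subtopology by blast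

lemma open_preimage:
  assumes c: "(D, x) \<in> A" and V: "openin X V"
  shows "open {u\<in>D. x u \<in> V}"
proof -
  have "openin (top_of_set D) {u\<in>D. x u \<in> V}"
    using openin_continuous_map_preimage[OF chart_continuous[OF c] V] by simp
  then show ?thesis using openin_open_trans chart(1)[OF c] by blast
qed

lemma open_image:
  assumes c: "(D, x) \<in> A" and U: "open U" "U \<subseteq> D"
  shows "openin X (x ` U)"
proof -
  have "openin (subtopology X (x ` D)) (x ` U)"
    using homeomorphic_imp_open_map[OF chart(3)[OF c]] U unfolding open_map_def
    by (simp add: openin_open_eq chart(1)[OF c])
  then show ?thesis using openin_trans_full chart(2)[OF c] by blast
qed

definition transition :: "'a chart \<Rightarrow> 'a chart \<Rightarrow> real^2 \<Rightarrow> real^2" where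
  "transition c c' = the_inv_into (fst c') (snd c') \<circ> snd c"

lemma transition:
  assumes c: "(D, x) \<in> A" and c': "(D', y) \<in> A"
  defines "\<tau> \<equiv> transition (D, x) (D', y)"
  shows "open {u\<in>D. x u \<in> y ` D'}" "smooth_on {u\<in>D. x u \<in> y ` D'} \<tau>"
    "\<And>u. u \<in> D \<Longrightarrow> x u \<in> y ` D' \<Longrightarrow> det (matrix (frechet_derivative \<tau> (at u))) > 0"
    "\<And>u. u \<in> D \<Longrightarrow> x u \<in> y ` D' \<Longrightarrow> \<tau> u \<in> D'" "\<And>u. u \<in> D \<Longrightarrow> x u \<in> y ` D' \<Longrightarrow> y (\<tau> u) = x u"
proof -
  show "open {u\<in>D. x u \<in> y ` D'}" by (rule open_preimage[OF c chart(2)[OF c']])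
  have s: "\<forall>(D, x)\<in>A. \<forall>(D', y)\<in>A. let W = {u\<in>D. x u \<in> y ` D'}; \<tau> = the_inv_into D' y \<circ> x
        in smooth_on W \<tau> \<and> (\<forall>u\<in>W. det (matrix (frechet_derivative \<tau> (at u))) > 0)"
    using surface unfolding oriented_surface_def by simp
  have "smooth_on {u\<in>D. x u \<in> y ` D'} (the_inv_into D' y \<circ> x) \<and>
      (\<forall>u\<in>{u\<in>D. x u \<in> y ` D'}. det (matrix (frechet_derivative (the_inv_into D' y \<circ> x) (at u))) > 0)"
    using bspec[OF bspec[OF s c, unfolded prod.case] c', unfolded prod.case Let_def] .
  then show "smooth_on {u\<in>D. x u \<in> y ` D'} \<tau>"
    "\<And>u. u \<in> D \<Longrightarrow> x u \<in> y ` D' \<Longrightarrow> det (matrix (frechet_derivative \<tau> (at u))) > 0"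
    unfolding \<tau>_def transition_def by simp_all
  show "\<tau> u \<in> D'" if "x u \<in> y ` D'" for u
    unfolding \<tau>_def transition_def using the_inv_into_into[OF chart_inj[OF c'] that] by simp
  show "y (\<tau> u) = x u" if "x u \<in> y ` D'" for u
    unfolding \<tau>_def transition_def using f_the_inv_into_f[OF chart_inj[OF c'] that] by simp
qed

lemma transition_inverse:
  assumes c: "(D, x) \<in> A" and c': "(D', y) \<in> A" and u: "u \<in> D" "x u \<in> y ` D'"
  shows "transition (D', y) (D, x) (transition (D, x) (D', y) u) = u"
proof -
  note t = transition(4,5)[OF c c' u]
  have v: "y (transition (D, x) (D', y) u) \<in> x ` D" unfolding t(2) using u(1) by (rule imageI)
  note t' = transition(4,5)[OF c' c t(1) v]
  show ?thesis by (rule inj_onD[OF chart_inj[OF c] _ t'(1) u(1)]) (simp only: t' t)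
qed

lemma matrix_det_cross3:
  fixes L :: "real^2 \<Rightarrow> real^3" and T :: "real^2 \<Rightarrow> real^2"
  assumes L: "linear L" and T: "linear T"
  shows "cross3 (L (T (axis 1 1))) (L (T (axis 2 1))) = det (matrix T) *\<^sub>R cross3 (L (axis 1 1)) (L (axis 2 1))"
  unfolding linear_vec2[OF L, of "T _"] cross3_det det_2 matrix_def by simp

lemma frechet_transition:
  fixes G :: "'a \<Rightarrow> 'b::real_normed_vector"
  assumes c: "(D, x) \<in> A" and c': "(D', y) \<in> A" and G: "smooth_on D' (G \<circ> y)" and u: "u \<in> D" "x u \<in> y ` D'"
  shows "((G \<circ> x) has_derivative (\<lambda>v. frechet_derivative (G \<circ> y) (at (transition (D, x) (D', y) u))
      (frechet_derivative (transition (D, x) (D', y)) (at u) v))) (at u)"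
proof -
  note t = transition[OF c c']
  let ?W = "{u\<in>D. x u \<in> y ` D'}" and ?\<tau> = "transition (D, x) (D', y)"
  have uW: "u \<in> ?W" using u by simp
  note 1 = smooth_on_has_derivative[OF t(2) uW]
  note 2 = smooth_on_has_derivative[OF G t(4)[OF u]]
  show ?thesis
    by (rule has_derivative_transform_within_open[OF has_derivative_compose[OF 1 2] t(1) uW]) (simp add: t(5))
qed

text \<open>The vector \<open>\<Phi>\<^sub>u \<times> \<Phi>\<^sub>v\<close> is multiplied by the Jacobian determinant under a change of charts.
  The absolute value is the invariance of the area element; the positive sign is the invariance
  of the normal.\<close>

lemma coord_cross_transition:
  assumes c: "(D, x) \<in> A" and c': "(D', y) \<in> A" and F: "smooth_map A F" and u: "u \<in> D" "x u \<in> y ` D'"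
  shows "coord_cross (F \<circ> x) u = det (matrix (frechet_derivative (transition (D, x) (D', y)) (at u))) *\<^sub>R
      coord_cross (F \<circ> y) (transition (D, x) (D', y) u)"
proof -
  let ?\<tau> = "transition (D, x) (D', y)"
  note t = transition[OF c c']
  have uW: "u \<in> {u\<in>D. x u \<in> y ` D'}" using u by simp
  have G: "smooth_on D' (F \<circ> y)" using F c' unfolding smooth_map_def by auto
  note d = frechet_derivative_at[OF frechet_transition[OF c c' G u], symmetric]
  show ?thesis
    unfolding coord_cross_def d
    by (rule matrix_det_cross3[OF has_derivative_linear[OF smooth_on_has_derivative[OF G t(4)[OF u]]]
          has_derivative_linear[OF smooth_on_has_derivative[OF t(2) uW]]])
qed

subsection \<open>Existence of the area measure\<close>

text \<open>The Borel measurable space of the surface.\<close>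

definition MX :: "'a measure" where "MX = sigma (topspace X) {U. openin X U}"

lemma space_MX: "space MX = topspace X" and sets_MX: "sets MX = sigma_sets (topspace X) {U. openin X U}"
proof -
  have "{U. openin X U} \<subseteq> Pow (topspace X)" using openin_subset by blast
  then show "space MX = topspace X" "sets MX = sigma_sets (topspace X) {U. openin X U}" unfolding MX_def by simp_all
qed

lemma open_MX: "openin X U \<Longrightarrow> U \<in> sets MX"
  unfolding sets_MX by (simp add: sigma_sets.Basic)

lemma chart_measurable:
  assumes c: "(D, x) \<in> A"
  shows "x \<in> measurable (restrict_space lborel D) MX"
  unfolding MX_def
proof (rule measurable_measure_of)
  show "{U. openin X U} \<subseteq> Pow (topspace X)" using openin_subset by blast
  show "x \<in> space (restrict_space lborel D) \<rightarrow> topspace X" using chart_subset[OF c] by (auto simp: space_restrict_space)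
  fix U assume "U \<in> {U. openin X U}"
  then have "open {u\<in>D. x u \<in> U}" using open_preimage[OF c] by simp
  moreover have "x -` U \<inter> space (restrict_space lborel D) = {u\<in>D. x u \<in> U}" by (auto simp: space_restrict_space)
  ultimately show "x -` U \<inter> space (restrict_space lborel D) \<in> sets (restrict_space lborel D)"
    using chart(1)[OF c] by (auto simp: sets_restrict_space_iff)
qed

lemma preimage_borel:
  assumes c: "(D, x) \<in> A" and B: "B \<in> sets MX"
  shows "{u\<in>D. x u \<in> B} \<in> sets borel"
proof -
  have "x -` B \<inter> space (restrict_space lborel D) \<in> sets (restrict_space lborel D)"
    using measurable_sets[OF chart_measurable[OF c] B] .
  moreover have "x -` B \<inter> space (restrict_space lborel D) = {u\<in>D. x u \<in> B}" by (auto simp: space_restrict_space)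
  ultimately show ?thesis using chart(1)[OF c] by (auto simp: sets_restrict_space_iff)
qed

definition J :: "('a \<Rightarrow> real^3) \<Rightarrow> 'a chart \<Rightarrow> real^2 \<Rightarrow> real" where
  "J F c u = norm (coord_cross (F \<circ> snd c) u)"

lemma J_continuous:
  assumes "(D, x) \<in> A" "smooth_map A F"
  shows "continuous_on D (J F (D, x))"
proof -
  have s: "smooth_on D (F \<circ> x)" using assms unfolding smooth_map_def by auto
  have "smooth_on D (\<lambda>u. coord_cross (F \<circ> x) u)" unfolding coord_cross_def
    by (rule smooth_on_cross3[OF chart(1)[OF assms(1)] smooth_on_frechet_derivative[OF s] smooth_on_frechet_derivative[OF s]])
  then show ?thesis unfolding J_def snd_conv by (intro continuous_on_norm smooth_on_imp_continuous_on)
qed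

lemma indicator_measurable:
  fixes f :: "real^2 \<Rightarrow> real"
  assumes "open D" "continuous_on D f" "S \<in> sets borel" "S \<subseteq> D"
  shows "(\<lambda>u. indicator S u * f u) \<in> borel_measurable borel"
proof -
  have 1: "(\<lambda>u. indicator D u *\<^sub>R f u) \<in> borel_measurable borel"
    using assms(1,2) by (intro borel_measurable_continuous_on_indicator) auto
  have "(\<lambda>u. indicator S u * (indicator D u *\<^sub>R f u)) \<in> borel_measurable borel"
    by (intro borel_measurable_times 1 borel_measurable_indicator assms(3))
  moreover have "(\<lambda>u. indicator S u * (indicator D u *\<^sub>R f u)) = (\<lambda>u. indicator S u * f u)"
    using assms(4) by (auto simp: indicator_def fun_eq_iff)
  ultimately show ?thesis by (simp only:)
qed

definition local_area :: "('a \<Rightarrow> real^3) \<Rightarrow> 'a chart \<Rightarrow> 'a set \<Rightarrow> ennreal" where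
  "local_area F c B = (\<integral>\<^sup>+u. ennreal (J F c u) * indicator {u\<in>fst c. snd c u \<in> B} u \<partial>lborel)"

lemma local_area_transition:
  assumes c: "c \<in> A" and c': "c' \<in> A" and F: "smooth_map A F"
    and B: "B \<in> sets MX" "B \<subseteq> snd c ` fst c" "B \<subseteq> snd c' ` fst c'"
  shows "local_area F c B = local_area F c' B"
proof -
  obtain D x D' y where cc: "c = (D, x)" "c' = (D', y)" by (metis surj_pair)
  note c = c[unfolded cc] and c' = c'[unfolded cc] and B = B[unfolded cc fst_conv snd_conv]
  let ?\<tau> = "transition (D, x) (D', y)" and ?S = "{u\<in>D. x u \<in> B}" and ?T = "{v\<in>D'. y v \<in> B}"
  note t = transition[OF c c']
  note t' = transition[OF c' c]
  have SW: "u \<in> D" "x u \<in> y ` D'" if "u \<in> ?S" for u using that B by auto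
  have TW: "v \<in> D'" "y v \<in> x ` D" if "v \<in> ?T" for v using that B by auto
  have inv: "transition (D', y) (D, x) (?\<tau> u) = u" if "u \<in> ?S" for u
    by (rule transition_inverse[OF c c' SW[OF that]])
  have inv': "?\<tau> (transition (D', y) (D, x) v) = v" if "v \<in> ?T" for v
    by (rule transition_inverse[OF c' c TW[OF that]])
  have im: "?\<tau> ` ?S = ?T"
  proof
    show "?\<tau> ` ?S \<subseteq> ?T"
    proof
      fix v assume "v \<in> ?\<tau> ` ?S"
      then obtain u where u: "u \<in> ?S" "v = ?\<tau> u" by blast
      then show "v \<in> ?T" using t(4,5)[OF SW[OF u(1)]] by simp
    qed
    show "?T \<subseteq> ?\<tau> ` ?S"
    proof
      fix v assume v: "v \<in> ?T"
      have "transition (D', y) (D, x) v \<in> ?S" using t'(4,5)[OF TW[OF v]] v by simp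
      from imageI[OF this, of ?\<tau>] show "v \<in> ?\<tau> ` ?S" unfolding inv'[OF v] .
    qed
  qed
  have Jt: "J F (D, x) u = \<bar>det (matrix (frechet_derivative ?\<tau> (at u)))\<bar> * J F (D', y) (?\<tau> u)" if "u \<in> ?S" for u
    unfolding J_def snd_conv coord_cross_transition[OF c c' F SW[OF that]] by simp
  have "local_area F c B = (\<integral>\<^sup>+u. ennreal (\<bar>det (matrix (frechet_derivative ?\<tau> (at u)))\<bar> * J F (D', y) (?\<tau> u)) * indicator ?S u \<partial>lborel)"
    unfolding local_area_def cc fst_conv snd_conv by (rule nn_integral_cong) (use Jt in \<open>simp add: indicator_def\<close>)
  also have "\<dots> = (\<integral>\<^sup>+v. ennreal (J F (D', y) v) * indicator (?\<tau> ` ?S) v \<partial>lborel)"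
  proof (rule nn_integral_change_of_variables[where h = "transition (D', y) (D, x)"])
    show "(?\<tau> has_derivative frechet_derivative ?\<tau> (at u)) (at u)" if "u \<in> ?S" for u
      by (rule smooth_on_has_derivative[OF t(2)]) (use SW[OF that] in simp)
    show "continuous_on (?\<tau> ` ?S) (transition (D', y) (D, x))"
      unfolding im by (rule continuous_on_subset[OF smooth_on_imp_continuous_on[OF t'(2)]]) (use TW in blast)
    have "(\<lambda>u. indicator ?S u * J F (D, x) u) \<in> borel_measurable borel"
      by (rule indicator_measurable[OF chart(1)[OF c] J_continuous[OF c F] preimage_borel[OF c B(1)]]) blast
    moreover have "indicator ?S u * J F (D, x) u = indicator ?S u * (\<bar>det (matrix (frechet_derivative ?\<tau> (at u)))\<bar> * J F (D', y) (?\<tau> u))" for u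
      using Jt by (simp add: indicator_def)
    ultimately show "(\<lambda>u. indicator ?S u * (\<bar>det (matrix (frechet_derivative ?\<tau> (at u)))\<bar> * J F (D', y) (?\<tau> u))) \<in> borel_measurable borel"
      by simp
    show "(\<lambda>v. indicator (?\<tau> ` ?S) v * J F (D', y) v) \<in> borel_measurable borel"
      unfolding im by (rule indicator_measurable[OF chart(1)[OF c'] J_continuous[OF c' F] preimage_borel[OF c' B(1)]]) blast
    show "0 \<le> J F (D', y) v" for v unfolding J_def by simp
  qed (rule inv)
  also have "\<dots> = local_area F c' B" unfolding im local_area_def cc fst_conv snd_conv ..
  finally show ?thesis .
qed

lemma local_area_UN:
  assumes c: "c \<in> A" and F: "smooth_map A F" and B: "\<And>i::nat. B i \<in> sets MX" "disjoint_family B"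
  shows "local_area F c (\<Union>i. B i) = (\<Sum>i. local_area F c (B i))"
proof -
  obtain D x where cc: "c = (D, x)" by (metis surj_pair)
  note c = c[unfolded cc]
  have m: "(\<lambda>u. ennreal (J F (D, x) u) * indicator {u\<in>D. x u \<in> B i} u) \<in> borel_measurable lborel" for i
  proof -
    have "(\<lambda>u. ennreal (indicator {u\<in>D. x u \<in> B i} u * J F (D, x) u)) \<in> borel_measurable borel"
      by (intro measurable_compose[OF _ measurable_ennreal] indicator_measurable[OF chart(1)[OF c] J_continuous[OF c F] preimage_borel[OF c B(1)]]) blast
    moreover have "ennreal (indicator {u\<in>D. x u \<in> B i} u * J F (D, x) u) = ennreal (J F (D, x) u) * indicator {u\<in>D. x u \<in> B i} u" for u
      by (simp add: indicator_def)
    ultimately show ?thesis by simp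
  qed
  have "(\<Sum>i. indicator {u\<in>D. x u \<in> B i} u :: ennreal) = indicator (\<Union>i. {u\<in>D. x u \<in> B i}) u" for u
    by (rule suminf_indicator) (use B(2) in \<open>auto simp: disjoint_family_on_def\<close>)
  moreover have "(\<Union>i. {u\<in>D. x u \<in> B i}) = {u\<in>D. x u \<in> (\<Union>i. B i)}" by blast
  ultimately have s: "indicator {u\<in>D. x u \<in> (\<Union>i. B i)} u = (\<Sum>i. indicator {u\<in>D. x u \<in> B i} u :: ennreal)" for u by simp
  show ?thesis
    unfolding local_area_def cc fst_conv snd_conv s ennreal_suminf_cmult[symmetric] by (rule nn_integral_suminf[OF m])
qed

text \<open>Countably many charts cover the surface. Their images, made disjoint, carry measures given
  by the charts, and the sum of these is the area measure: by invariance under transitions, any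
  other chart computes it as well.\<close>

lemma ex_area_measure:
  assumes ne: "A \<noteq> {}" and F: "smooth_map A F"
  shows "\<exists>M. is_area_measure X A F M"
proof -
  let ?im = "\<lambda>c::'a chart. snd c ` fst c"
  have cov: "\<Union> (?im ` A) = topspace X" unfolding cover by (auto simp: split_beta)
  have op: "openin X U" if U: "U \<in> ?im ` A" for U
  proof -
    obtain c where "c \<in> A" "U = ?im c" using U by blast
    then show ?thesis using chart(2)[of "fst c" "snd c"] by simp
  qed
  have "\<exists>\<V>. countable \<V> \<and> \<V> \<subseteq> ?im ` A \<and> \<Union>\<V> = topspace X"
    by (rule Lindelof_spaceD[OF second_countable_imp_Lindelof_space[OF second_countable] op cov])
  then obtain \<V> where V: "countable \<V>" "\<V> \<subseteq> ?im ` A" "\<Union>\<V> = topspace X" by (elim exE conjE)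
  obtain C where C: "countable C" "C \<subseteq> A" "\<V> = ?im ` C" using V(1,2) countable_subset_image[of \<V> ?im A] by blast
  obtain c0 where c0: "c0 \<in> A" using ne by blast
  define ch where "ch = from_nat_into (insert c0 C)"
  have ran: "range ch = insert c0 C" unfolding ch_def using C(1) by (intro range_from_nat_into) auto
  have chA: "ch n \<in> A" for n
  proof -
    have "ch n \<in> insert c0 C" unfolding ran[symmetric] by (rule rangeI)
    then show ?thesis using C(2) c0 by blast
  qed
  have chcov: "(\<Union>n. ?im (ch n)) = topspace X"
  proof
    show "(\<Union>n. ?im (ch n)) \<subseteq> topspace X" unfolding cov[symmetric] using chA by (intro UN_least Union_upper imageI)
    show "topspace X \<subseteq> (\<Union>n. ?im (ch n))"
    proof
      fix z assume "z \<in> topspace X"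
      then obtain c where "c \<in> C" "z \<in> ?im c" using V(3) C(3) by blast
      moreover from this obtain n where "c = ch n" using ran by blast
      ultimately show "z \<in> (\<Union>n. ?im (ch n))" by blast
    qed
  qed
  define E where "E = disjointed (\<lambda>n. ?im (ch n))"
  have imM: "?im (ch n) \<in> sets MX" for n by (rule open_MX[OF op[OF imageI[OF chA]]])
  have EM: "E n \<in> sets MX" for n
    using sets.range_disjointed_sets[of "\<lambda>n. ?im (ch n)" MX] imM unfolding E_def by blast
  have Esub: "E n \<subseteq> ?im (ch n)" for n unfolding E_def by (rule disjointed_subset)
  have EU: "(\<Union>n. E n) = topspace X" unfolding E_def UN_disjointed_eq chcov ..
  have Edis: "disjoint_family E" unfolding E_def by (rule disjoint_family_disjointed)
  define \<mu> where "\<mu> = (\<lambda>B. \<Sum>n. local_area F (ch n) (B \<inter> E n))"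
  define M where "M = measure_of (topspace X) (sets MX) \<mu>"
  have sig: "sigma_algebra (topspace X) (sets MX)" using sets.sigma_algebra_axioms[of MX] unfolding space_MX .
  have setsM: "sets M = sets MX" unfolding M_def by (simp add: sigma_algebra.sets_measure_of_eq[OF sig])
  have spaceM: "space M = topspace X" unfolding M_def by (simp add: sigma_algebra.space_measure_of_eq[OF sig])
  have eM: "emeasure M B = \<mu> B" if "B \<in> sets MX" for B
  proof (rule emeasure_measure_of_sigma[OF sig _ _ that, of \<mu>, folded M_def])
    show "positive (sets MX) \<mu>" unfolding positive_def \<mu>_def local_area_def by simp
    show "countably_additive (sets MX) \<mu>"
    proof (rule countably_additiveI)
      fix B :: "nat \<Rightarrow> 'a set" assume B: "range B \<subseteq> sets MX" "disjoint_family B"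
      have "local_area F (ch n) ((\<Union>i. B i) \<inter> E n) = (\<Sum>i. local_area F (ch n) (B i \<inter> E n))" for n
      proof -
        have "(\<Union>i. B i) \<inter> E n = (\<Union>i. B i \<inter> E n)" by blast
        moreover have "disjoint_family (\<lambda>i. B i \<inter> E n)" using B(2) unfolding disjoint_family_on_def by blast
        moreover have "B i \<inter> E n \<in> sets MX" for i using B(1) EM by blast
        ultimately show ?thesis using local_area_UN[OF chA F, of "\<lambda>i. B i \<inter> E n"] by simp
      qed
      then have "\<mu> (\<Union>i. B i) = (\<Sum>n. \<Sum>i. local_area F (ch n) (B i \<inter> E n))" unfolding \<mu>_def by simp
      also have "\<dots> = (\<integral>\<^sup>+n. (\<Sum>i. local_area F (ch n) (B i \<inter> E n)) \<partial>count_space UNIV)"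
        by (rule nn_integral_count_space_nat[symmetric])
      also have "\<dots> = (\<Sum>i. \<integral>\<^sup>+n. local_area F (ch n) (B i \<inter> E n) \<partial>count_space UNIV)"
        by (rule nn_integral_suminf) simp
      also have "\<dots> = (\<Sum>i. \<mu> (B i))" unfolding \<mu>_def nn_integral_count_space_nat ..
      finally show "(\<Sum>i. \<mu> (B i)) = \<mu> (\<Union>i. B i)" by simp
    qed
  qed
  have "emeasure M B = local_area F c B" if c: "c \<in> A" and B: "B \<in> sets MX" "B \<subseteq> ?im c" for c B
  proof -
    have BU: "B = (\<Union>n. B \<inter> E n)" using EU sets.sets_into_space[OF B(1)] unfolding space_MX by blast
    have "emeasure M B = (\<Sum>n. local_area F (ch n) (B \<inter> E n))" unfolding eM[OF B(1)] \<mu>_def ..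
    also have "\<dots> = (\<Sum>n. local_area F c (B \<inter> E n))"
      by (intro suminf_cong local_area_transition[OF chA c F] sets.Int B(1) EM) (use Esub B(2) in blast)+
    also have "\<dots> = local_area F c (\<Union>n. B \<inter> E n)"
      by (rule local_area_UN[OF c F, symmetric]) (use B(1) EM Edis in \<open>auto simp: disjoint_family_on_def\<close>)
    finally show ?thesis using BU by simp
  qed
  then have "is_area_measure X A F M"
    unfolding is_area_measure_def using spaceM setsM by (auto simp: sets_MX local_area_def J_def)
  then show ?thesis by blast
qed

end

section \<open>First variation of the energy\<close>

subsection \<open>A smooth bump function\<close>

text \<open>\<open>exp (-1/s) / s\<^sup>n\<close>, extended by zero: the functions that occur in the derivatives of the standard flat function.\<close>

definition exp_cutoff :: "nat \<Rightarrow> real \<Rightarrow> real" where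
  "exp_cutoff n s = (if s > 0 then exp (- (1 / s)) / s ^ n else 0)"

lemma exp_cutoff_tendsto_0: "(exp_cutoff n \<longlongrightarrow> 0) (at_right 0)"
proof -
  have "((\<lambda>y::real. y ^ n / exp y) \<longlongrightarrow> 0) at_top" by (rule tendsto_power_div_exp_0)
  from filterlim_compose[OF this filterlim_inverse_at_top_right]
  have "((\<lambda>s::real. inverse s ^ n / exp (inverse s)) \<longlongrightarrow> 0) (at_right 0)" .
  moreover have "\<forall>\<^sub>F s in at_right (0::real). inverse s ^ n / exp (inverse s) = exp_cutoff n s"
    using eventually_at_right_less[of "0::real"]
    by eventually_elim (simp add: exp_cutoff_def exp_minus field_simps)
  ultimately show ?thesis by (rule Lim_transform_eventually)
qed

text \<open>The family is closed under differentiation up to linear combinations, hence all its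
  members are smooth.\<close>

lemma exp_cutoff_has_derivative:
  "(exp_cutoff n has_real_derivative (exp_cutoff (n + 2) s - of_nat n * exp_cutoff (n + 1) s)) (at s)"
proof -
  consider "s > 0" | "s < 0" | "s = 0" by linarith
  then show ?thesis
  proof cases
    case 1
    have "((\<lambda>s. exp (- (1 / s)) / s ^ n) has_real_derivative (exp_cutoff (n + 2) s - of_nat n * exp_cutoff (n + 1) s)) (at s)"
    proof -
      have "((\<lambda>s. - (1 / s)) has_real_derivative (1 / s\<^sup>2)) (at s)"
        using 1 by (auto intro!: derivative_eq_intros simp: power2_eq_square)
      from DERIV_chain2[OF DERIV_exp this] DERIV_pow[of n s]
      have "((\<lambda>s. exp (- (1 / s)) / s ^ n) has_real_derivative
          (exp (- (1 / s)) * (1 / s\<^sup>2) * s ^ n - exp (- (1 / s)) * (real n * s ^ (n - Suc 0))) / (s ^ n * s ^ n)) (at s)"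
        using 1 by (intro DERIV_divide) auto
      moreover have "(E * (1 / s\<^sup>2) * s ^ n - E * (real n * s ^ (n - Suc 0))) / (s ^ n * s ^ n)
          = E / s ^ (n + 2) - real n * (E / s ^ (n + 1))" for E :: real
        using 1 by (cases n) (simp_all add: field_simps power2_eq_square)
      ultimately show ?thesis using 1 by (simp add: exp_cutoff_def)
    qed
    then show ?thesis
      by (rule has_field_derivative_transform_within_open[where S = "{0<..}"]) (use 1 in \<open>auto simp: exp_cutoff_def\<close>)
  next
    case 2
    have "((\<lambda>s. 0) has_real_derivative (exp_cutoff (n + 2) s - of_nat n * exp_cutoff (n + 1) s)) (at s)"
      using 2 by (simp add: exp_cutoff_def)
    then show ?thesis
      by (rule has_field_derivative_transform_within_open[where S = "{..<0}"]) (use 2 in \<open>auto simp: exp_cutoff_def\<close>)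
  next
    case 3
    have "((\<lambda>h. (exp_cutoff n (0 + h) - exp_cutoff n 0) / h) \<longlongrightarrow> 0) (at 0)"
    proof (rule filterlim_split_at)
      have "\<forall>\<^sub>F h in at_left (0::real). 0 = (exp_cutoff n (0 + h) - exp_cutoff n 0) / h"
        unfolding eventually_at_left_field by (rule exI[of _ "-1"]) (simp add: exp_cutoff_def)
      from Lim_transform_eventually[OF tendsto_const this]
      show "((\<lambda>h. (exp_cutoff n (0 + h) - exp_cutoff n 0) / h) \<longlongrightarrow> 0) (at_left 0)" .
      have "\<forall>\<^sub>F h in at_right (0::real). exp_cutoff (n + 1) h = (exp_cutoff n (0 + h) - exp_cutoff n 0) / h"
        using eventually_at_right_less[of "0::real"] by eventually_elim (simp add: exp_cutoff_def mult.commute)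
      from Lim_transform_eventually[OF exp_cutoff_tendsto_0 this]
      show "((\<lambda>h. (exp_cutoff n (0 + h) - exp_cutoff n 0) / h) \<longlongrightarrow> 0) (at_right 0)" .
    qed
    then show ?thesis using 3 by (simp add: DERIV_def exp_cutoff_def)
  qed
qed

lemma Ck_on_exp_cutoff: "Ck_on k (exp_cutoff n) UNIV"
proof (induction k arbitrary: n)
  case 0
  have "isCont (exp_cutoff n) s" for s by (rule DERIV_isCont[OF exp_cutoff_has_derivative])
  then show ?case by (simp add: continuous_at_imp_continuous_on)
next
  case (Suc k)
  have "Ck_on k (\<lambda>s. exp_cutoff (n + 2) s - of_nat n * exp_cutoff (n + 1) s) UNIV"
    using Ck_on_add[OF open_UNIV Suc[of "n + 2"] Ck_on_bounded_bilinear[OF open_UNIV bounded_bilinear_mult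
          Ck_on_const[OF open_UNIV, of k "- of_nat n"] Suc[of "n + 1"]]] by simp
  then show ?case by (rule Ck_on_real_derivI[OF open_UNIV exp_cutoff_has_derivative])
qed

definition bump :: "real^2 \<Rightarrow> real \<Rightarrow> real^2 \<Rightarrow> real" where
  "bump u0 r u = exp_cutoff 0 (r\<^sup>2 - (u - u0) \<bullet> (u - u0))"

lemma bump_nonneg: "0 \<le> bump u0 r u"
  by (simp add: bump_def exp_cutoff_def)

lemma bump_pos_iff: "r > 0 \<Longrightarrow> 0 < bump u0 r u \<longleftrightarrow> u \<in> ball u0 r"
proof -
  assume r: "r > 0"
  have "0 < bump u0 r u \<longleftrightarrow> (norm (u - u0))\<^sup>2 < r\<^sup>2"
    unfolding bump_def exp_cutoff_def power2_norm_eq_inner by simp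
  also have "\<dots> \<longleftrightarrow> norm (u - u0) < r" 
    using r power2_less_imp_less[of "norm (u - u0)" r] power_strict_mono[of "norm (u - u0)" r 2] by auto
  finally show ?thesis by (simp add: dist_norm norm_minus_commute)
qed

lemma bump_zero: "r > 0 \<Longrightarrow> u \<notin> ball u0 r \<Longrightarrow> bump u0 r u = 0"
  using bump_pos_iff[of r u0 u] bump_nonneg[of u0 r u] by linarith

lemma smooth_on_bump_compose:
  assumes S: "open S" "smooth_on S g"
  shows "smooth_on S (\<lambda>w. bump u0 r (g w))"
proof -
  have g: "smooth_on S (\<lambda>w. g w - u0)" by (rule smooth_on_diff[OF S smooth_on_const[OF S(1)]])
  have "smooth_on S (\<lambda>w. r\<^sup>2 - (g w - u0) \<bullet> (g w - u0))"
    by (rule smooth_on_diff[OF S(1) smooth_on_const[OF S(1)] smooth_on_inner[OF S(1) g g]])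
  then show ?thesis
    unfolding smooth_on_def bump_def
    by (intro allI Ck_on_compose_real[OF S(1) open_UNIV subset_UNIV _ Ck_on_exp_cutoff]) blast
qed

subsection \<open>Integration by parts\<close>

lemma set_integrable_continuous_cbox:
  fixes f :: "'a::euclidean_space \<Rightarrow> real"
  assumes "continuous_on (cbox a b) f"
  shows "set_integrable lborel (cbox a b) f"
  unfolding set_integrable_def by (rule borel_integrable_compact[OF compact_cbox assms])

lemma integral_translate_support:
  fixes g :: "'a::euclidean_space \<Rightarrow> real"
  assumes g: "continuous_on UNIV g" and s: "\<And>u. u \<notin> K \<Longrightarrow> g u = 0" "\<And>u. u \<notin> K \<Longrightarrow> g (c + u) = 0" and K: "K = cbox a b"
  shows "integral K (\<lambda>u. g (c + u)) = integral K g"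
proof -
  have *: "integral K f = integral\<^sup>L lborel f" if "continuous_on UNIV f" "\<And>u. u \<notin> K \<Longrightarrow> f u = 0" for f :: "'a \<Rightarrow> real"
  proof -
    have "set_integrable lborel K f"
      unfolding K by (rule set_integrable_continuous_cbox[OF continuous_on_subset[OF that(1) subset_UNIV]])
    then have "integral K f = (LINT u:K|lborel. f u)" by (simp add: set_borel_integral_eq_integral(2))
    also have "\<dots> = integral\<^sup>L lborel f"
      unfolding set_lebesgue_integral_def by (rule Bochner_Integration.integral_cong) (use that(2) in \<open>auto simp: indicator_def\<close>)
    finally show ?thesis .
  qed
  have gc: "continuous_on UNIV (\<lambda>u. g (c + u))"
    by (rule continuous_on_compose2[OF g]) (auto intro: continuous_intros)
  have m: "g \<in> borel_measurable borel" by (rule borel_measurable_continuous_onI[OF g])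
  have "integral K (\<lambda>u. g (c + u)) = (LINT u|lborel. g (c + u))" by (rule *[OF gc s(2)])
  also have "\<dots> = integral\<^sup>L (distr lborel borel ((+) c)) g" by (rule integral_distr[symmetric]) (use m in auto)
  also have "\<dots> = integral K g" unfolding lborel_distr_plus by (rule *[OF g s(1), symmetric])
  finally show ?thesis .
qed

text \<open>The integral of \<open>u \<mapsto> g (u + s v)\<close> does not depend on \<open>s\<close>, by translation invariance;
  differentiate under the integral sign at \<open>s = 0\<close>.\<close>

lemma integral_derivative_compact_support:
  fixes g :: "'a::euclidean_space \<Rightarrow> real"
  assumes d: "\<And>u. (g has_derivative g' u) (at u)" and c: "continuous_on UNIV (\<lambda>u. g' u v)"
    and s: "\<And>u. u \<notin> cbox a b \<Longrightarrow> g u = 0"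
  shows "integral (cbox a b) (\<lambda>u. g' u v) = 0"
proof -
  let ?S = "(\<lambda>(s::real, u). u - s *\<^sub>R v) ` ({-1..1} \<times> cbox a b)"
  have "compact ?S"
    by (intro compact_continuous_image compact_Times compact_Icc compact_cbox) (auto intro!: continuous_intros simp: split_beta)
  then have "bounded ?S" by (rule compact_imp_bounded)
  then obtain e where e: "?S \<subseteq> cbox (- e) e" using bounded_subset_cbox_symmetric by blast
  let ?K = "cbox (- e) e"
  have sK: "g (u + s *\<^sub>R v) = 0" if "s \<in> {-1..1}" "u \<notin> ?K" for s u
  proof (rule s, rule notI)
    assume "u + s *\<^sub>R v \<in> cbox a b"
    then have "(u + s *\<^sub>R v) - s *\<^sub>R v \<in> ?S" using that(1) by (intro image_eqI[of _ _ "(s, u + s *\<^sub>R v)"]) auto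
    then show False using e that(2) by auto
  qed
  have g: "continuous_on UNIV g"
    using d by (intro continuous_at_imp_continuous_on ballI has_derivative_continuous) blast
  have K0: "g u = 0" if "u \<notin> ?K" for u using sK[of 0 u] that by simp
  have "((\<lambda>s. integral ?K (\<lambda>u. g (u + s *\<^sub>R v))) has_field_derivative integral ?K (\<lambda>u. g' (u + 0 *\<^sub>R v) v)) (at 0 within {-1..1})"
  proof (rule leibniz_rule_field_derivative[where fx = "\<lambda>s u. g' (u + s *\<^sub>R v) v"])
    fix s :: real and u assume "s \<in> {-1..1}"
    have "((\<lambda>s. u + s *\<^sub>R v) has_derivative (\<lambda>s. s *\<^sub>R v)) (at s)" by (auto intro!: derivative_eq_intros)
    from has_derivative_compose[OF this d]
    have "((\<lambda>s. g (u + s *\<^sub>R v)) has_derivative (\<lambda>t. g' (u + s *\<^sub>R v) (t *\<^sub>R v))) (at s)" .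
    moreover have "(\<lambda>t. g' (u + s *\<^sub>R v) (t *\<^sub>R v)) = (*) (g' (u + s *\<^sub>R v) v)"
      using linear_scale[OF has_derivative_linear[OF d]] by (auto simp: mult.commute)
    ultimately show "((\<lambda>s. g (u + s *\<^sub>R v)) has_field_derivative g' (u + s *\<^sub>R v) v) (at s within {-1..1})"
      unfolding has_field_derivative_def using has_derivative_at_withinI by metis
    show "(\<lambda>u. g (u + s *\<^sub>R v)) integrable_on ?K"
      by (rule integrable_continuous[OF continuous_on_compose2[OF g]]) (auto intro!: continuous_intros)
  next
    show "continuous_on ({-1..1} \<times> ?K) (\<lambda>(s, u). g' (u + s *\<^sub>R v) v)"
      unfolding split_beta by (rule continuous_on_compose2[OF c]) (auto intro!: continuous_intros)
  qed auto
  then have 1: "((\<lambda>s. integral ?K (\<lambda>u. g (u + s *\<^sub>R v))) has_field_derivative integral ?K (\<lambda>u. g' u v)) (at 0 within {-1..1})" by simp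
  have "integral ?K (\<lambda>u. g (u + s *\<^sub>R v)) = integral ?K g" if "s \<in> {-1..1}" for s
    using integral_translate_support[OF g K0 _ refl, where c = "s *\<^sub>R v"] sK[OF that] by (simp add: add.commute)
  then have "((\<lambda>s. integral ?K g) has_field_derivative integral ?K (\<lambda>u. g' u v)) (at 0 within {-1..1})"
    using has_field_derivative_transform_within[OF 1, of 1 "\<lambda>s. integral ?K g"] by simp
  then have "((\<lambda>s. integral ?K g) has_real_derivative integral ?K (\<lambda>u. g' u v)) (at 0)"
    by (simp add: at_within_Icc_at)
  from DERIV_unique[OF this DERIV_const] have K: "integral ?K (\<lambda>u. g' u v) = 0" .
  have z: "g' u v = 0" if u: "u \<notin> cbox a b" for u
  proof -
    have "((\<lambda>u. 0) has_derivative g' u) (at u)"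
      by (rule has_derivative_transform_within_open[OF d, of "- cbox a b"]) (use u s in auto)
    from has_derivative_unique[OF this has_derivative_const] show ?thesis by metis
  qed
  have sub: "cbox a b \<subseteq> ?K"
  proof
    fix u assume "u \<in> cbox a b"
    then have "u - 0 *\<^sub>R v \<in> ?S" by (intro image_eqI[of _ _ "(0, u)"]) auto
    then show "u \<in> ?K" using e by auto
  qed
  have "integral (cbox a b) (\<lambda>u. g' u v) = integral ?K (\<lambda>u. if u \<in> cbox a b then g' u v else 0)"
    unfolding integral_restrict_Int Int_absorb2[OF sub] ..
  also have "\<dots> = integral ?K (\<lambda>u. g' u v)" by (rule integral_cong) (use z in auto)
  finally show ?thesis using K by simp
qed

subsection \<open>Derivative of the energy density\<close>

lemma has_derivative_norm_line:
  fixes P p :: "'a::real_inner"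
  assumes "P + t *\<^sub>R p \<noteq> 0"
  shows "((\<lambda>t. norm (P + t *\<^sub>R p)) has_real_derivative ((P + t *\<^sub>R p) \<bullet> p / norm (P + t *\<^sub>R p))) (at t)"
proof -
  let ?q = "\<lambda>t. P \<bullet> P + 2 * t * (P \<bullet> p) + t * t * (p \<bullet> p)"
  have q: "(P + t *\<^sub>R p) \<bullet> (P + t *\<^sub>R p) = ?q t" for t
    by (simp add: inner_add_left inner_add_right inner_commute algebra_simps)
  have n: "norm (P + t *\<^sub>R p) = sqrt (?q t)" for t unfolding norm_eq_sqrt_inner q ..
  have "?q t > 0" unfolding q[symmetric] using assms by simp
  moreover have "(?q has_real_derivative (2 * (P \<bullet> p) + 2 * t * (p \<bullet> p))) (at t)"
    by (auto intro!: derivative_eq_intros)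
  ultimately have "((\<lambda>t. sqrt (?q t)) has_real_derivative (inverse (sqrt (?q t)) / 2 * (2 * (P \<bullet> p) + 2 * t * (p \<bullet> p)))) (at t)"
    by (intro DERIV_chain2[OF DERIV_real_sqrt])
  moreover have "inverse (sqrt (?q t)) / 2 * (2 * (P \<bullet> p) + 2 * t * (p \<bullet> p)) = (P + t *\<^sub>R p) \<bullet> p / norm (P + t *\<^sub>R p)"
  proof -
    have e: "2 * (P \<bullet> p) + 2 * t * (p \<bullet> p) = 2 * ((P + t *\<^sub>R p) \<bullet> p)"
      by (simp only: inner_add_left inner_scaleR_left distrib_left mult.assoc)
    have h: "inverse N / 2 * (2 * z) = z / N" for N z :: real by (simp add: field_simps)
    show ?thesis using h unfolding e n by blast
  qed
  ultimately show ?thesis unfolding n[symmetric] by simp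
qed

lemma has_derivative_density:
  fixes P p :: "'a::real_inner" and Q q :: "'b::real_inner"
  assumes P: "P + t *\<^sub>R p \<noteq> 0" and Q: "Q + t *\<^sub>R q \<noteq> 0"
  shows "((\<lambda>t. norm (P + t *\<^sub>R p) powr \<alpha> * norm (Q + t *\<^sub>R q)) has_real_derivative
    (\<alpha> * norm (P + t *\<^sub>R p) powr (\<alpha> - 2) * ((P + t *\<^sub>R p) \<bullet> p) * norm (Q + t *\<^sub>R q)
     + norm (P + t *\<^sub>R p) powr \<alpha> * ((Q + t *\<^sub>R q) \<bullet> q / norm (Q + t *\<^sub>R q)))) (at t)"
proof -
  have n: "norm (P + t *\<^sub>R p) > 0" using P by simp
  have "((\<lambda>t. norm (P + t *\<^sub>R p) powr \<alpha>) has_real_derivative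
      (\<alpha> * norm (P + t *\<^sub>R p) powr (\<alpha> - 1)) * ((P + t *\<^sub>R p) \<bullet> p / norm (P + t *\<^sub>R p))) (at t)"
    by (rule DERIV_chain2[OF has_real_derivative_powr[OF n] has_derivative_norm_line[OF P]])
  moreover have "(\<alpha> * norm (P + t *\<^sub>R p) powr (\<alpha> - 1)) * ((P + t *\<^sub>R p) \<bullet> p / norm (P + t *\<^sub>R p))
      = \<alpha> * norm (P + t *\<^sub>R p) powr (\<alpha> - 2) * ((P + t *\<^sub>R p) \<bullet> p)"
  proof -
    have "norm (P + t *\<^sub>R p) powr (\<alpha> - 1) = norm (P + t *\<^sub>R p) powr (\<alpha> - 2) * norm (P + t *\<^sub>R p)"
      using n powr_mult_base[of "norm (P + t *\<^sub>R p)" "\<alpha> - 2"] by (simp add: mult.commute)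
    then show ?thesis using n by simp
  qed
  ultimately have 1: "((\<lambda>t. norm (P + t *\<^sub>R p) powr \<alpha>) has_real_derivative
      \<alpha> * norm (P + t *\<^sub>R p) powr (\<alpha> - 2) * ((P + t *\<^sub>R p) \<bullet> p)) (at t)" by simp
  show ?thesis
    by (rule DERIV_cong[OF DERIV_mult[OF 1 has_derivative_norm_line[OF Q]]]) (simp add: algebra_simps)
qed


subsection \<open>The energy in a chart\<close>

context surface begin

lemma smooth_map_chart: "smooth_map A F \<Longrightarrow> (D, x) \<in> A \<Longrightarrow> smooth_on D (\<lambda>u. F (x u))"
  unfolding smooth_map_def by (auto simp: o_def)

lemma open_preimage_immersion:
  assumes F: "smooth_map A F" and S: "open S"
  shows "openin X {p\<in>topspace X. F p \<in> S}"
proof -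
  have "{p\<in>topspace X. F p \<in> S} = (\<Union>(D, x)\<in>A. x ` {u\<in>D. F (x u) \<in> S})"
    unfolding cover by auto
  moreover have "openin X (x ` {u\<in>D. F (x u) \<in> S})" if c: "(D, x) \<in> A" for D x
  proof (rule open_image[OF c])
    from continuous_open_preimage[OF smooth_on_imp_continuous_on[OF smooth_map_chart[OF F c]] chart(1)[OF c] S] show "open {u\<in>D. F (x u) \<in> S}"
      by (simp add: vimage_def Int_def)
  qed blast
  ultimately show ?thesis by (auto intro!: openin_Union)
qed

lemma chart_compact:
  assumes c: "(D, x) \<in> A" and K: "compact K" "K \<subseteq> D"
  shows "compactin X (x ` K)" "closedin X (x ` K)" "x ` K \<in> sets MX"
proof -
  show C: "compactin X (x ` K)"
    by (rule image_compactin[OF _ chart_continuous[OF c]]) (simp add: compactin_subtopology K)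
  show cl: "closedin X (x ` K)" by (rule compactin_imp_closedin[OF Hausdorff C])
  have "openin X (topspace X - x ` K)" using cl by blast
  then have "space MX - (topspace X - x ` K) \<in> sets MX" by (intro sets.compl_sets open_MX)
  moreover have "space MX - (topspace X - x ` K) = x ` K"
    unfolding space_MX using closedin_subset[OF cl] by blast
  ultimately show "x ` K \<in> sets MX" by simp
qed

text \<open>Up to the chart, the restriction of the area measure to the image of a compact box is
  Lebesgue measure with density \<open>|\<Phi>\<^sub>u \<times> \<Phi>\<^sub>v|\<close>.\<close>

lemma energy_chart:
  assumes c: "(D, x) \<in> A" and K: "cbox a b \<subseteq> D" and F: "smooth_map A F" and F0: "\<And>u. u \<in> cbox a b \<Longrightarrow> F (x u) \<noteq> 0"
  shows "energy \<alpha> X A (x ` cbox a b) F = integral (cbox a b) (\<lambda>u. norm (F (x u)) powr \<alpha> * J F (D, x) u)"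
proof -
  let ?C = "x ` cbox a b" and ?f = "\<lambda>p. norm (F p) powr \<alpha>" and ?R = "restrict_space lborel D"
  define M where "M = area_measure X A F"
  have ne: "A \<noteq> {}" using c by blast
  have ar: "is_area_measure X A F M" unfolding M_def area_measure_def using ex_area_measure[OF ne F] by (rule someI_ex)
  have sM: "sets M = sets MX" and spM: "space M = topspace X" using ar unfolding is_area_measure_def sets_MX by simp_all
  have eM: "emeasure M B = local_area F (D, x) B" if "B \<in> sets MX" "B \<subseteq> x ` D" for B
    using ar c that unfolding is_area_measure_def sM local_area_def J_def by auto
  have DR: "D \<inter> space lborel \<in> sets lborel" using chart(1)[OF c] by simp
  have Jm: "J F (D, x) \<in> borel_measurable ?R"
    unfolding borel_measurable_restrict_space_iff[OF DR]
    using indicator_measurable[OF chart(1)[OF c] J_continuous[OF c F], of D] chart(1)[OF c] by simp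
  then have Jm': "(\<lambda>u. ennreal (J F (D, x) u)) \<in> borel_measurable ?R" by simp
  define R where "R = density ?R (\<lambda>u. ennreal (J F (D, x) u))"
  define N where "N = distr R MX x"
  have xR: "x \<in> measurable R MX" using chart_measurable[OF c] unfolding R_def by simp
  have eN: "emeasure N B = local_area F (D, x) B" if B: "B \<in> sets MX" for B
  proof -
    have "x -` B \<inter> space R = {u\<in>D. x u \<in> B}" unfolding R_def by (auto simp: space_restrict_space)
    then have "emeasure N B = emeasure R {u\<in>D. x u \<in> B}" unfolding N_def emeasure_distr[OF xR B] by simp
    also have "\<dots> = (\<integral>\<^sup>+u. ennreal (J F (D, x) u) * indicator {u\<in>D. x u \<in> B} u \<partial>?R)"
      unfolding R_def
      by (rule emeasure_density[OF Jm']) (use preimage_borel[OF c B] chart(1)[OF c] in \<open>simp add: sets_restrict_space_iff Collect_mono\<close>)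
    also have "\<dots> = (\<integral>\<^sup>+u. ennreal (J F (D, x) u) * indicator {u\<in>D. x u \<in> B} u * indicator D u \<partial>lborel)"
      by (rule nn_integral_restrict_space[OF DR])
    also have "\<dots> = local_area F (D, x) B"
      unfolding local_area_def fst_conv snd_conv by (rule nn_integral_cong) (simp add: indicator_def)
    finally show ?thesis .
  qed
  have sN: "sets N = sets MX" "space N = topspace X" unfolding N_def by (simp_all add: space_MX)
  have C: "?C \<in> sets MX" by (rule chart_compact(3)[OF c compact_cbox K])
  have CM: "?C \<inter> space M \<in> sets M" "?C \<inter> space N \<in> sets N" unfolding sM spM sN using C by (auto simp: space_MX[symmetric])
  have CD: "?C \<subseteq> x ` D" using K by blast
  have eq: "restrict_space M ?C = restrict_space N ?C"
  proof (rule measure_eqI)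
    show "sets (restrict_space M ?C) = sets (restrict_space N ?C)" unfolding sets_restrict_space sM sN ..
    fix B assume "B \<in> sets (restrict_space M ?C)"
    then have B: "B \<subseteq> ?C" "B \<in> sets MX" unfolding sets_restrict_space_iff[OF CM(1)] sM by auto
    show "emeasure (restrict_space M ?C) B = emeasure (restrict_space N ?C) B"
      unfolding emeasure_restrict_space[OF CM(1) B(1)] emeasure_restrict_space[OF CM(2) B(1)] eN[OF B(2)]
      by (rule eM[OF B(2)]) (use B(1) CD in blast)
  qed
  have Fm: "F \<in> measurable MX borel"
  proof (rule borel_measurableI)
    fix S :: "(real^3) set" assume "open S"
    have "F -` S \<inter> space MX = {p\<in>topspace X. F p \<in> S}" unfolding space_MX by auto
    then show "F -` S \<inter> space MX \<in> sets MX" using open_MX[OF open_preimage_immersion[OF F \<open>open S\<close>]] by simp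
  qed
  have fm: "(\<lambda>p. indicator ?C p *\<^sub>R ?f p) \<in> borel_measurable MX"
    using Fm C by measurable
  have "energy \<alpha> X A ?C F = integral\<^sup>L (restrict_space M ?C) ?f"
    unfolding energy_def M_def[symmetric] set_lebesgue_integral_def integral_restrict_space[OF CM(1)] ..
  also have "\<dots> = (LINT p|N. indicator ?C p *\<^sub>R ?f p)"
    unfolding eq integral_restrict_space[OF CM(2)] ..
  also have "\<dots> = (LINT u|R. indicator ?C (x u) *\<^sub>R ?f (x u))"
    unfolding N_def by (rule integral_distr[OF xR fm])
  also have "\<dots> = (LINT u|?R. J F (D, x) u *\<^sub>R (indicator ?C (x u) *\<^sub>R ?f (x u)))"
    unfolding R_def
    by (rule integral_density[OF measurable_compose[OF chart_measurable[OF c] fm] Jm]) (simp add: J_def)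
  also have "\<dots> = (LINT u|lborel. indicator D u *\<^sub>R (J F (D, x) u *\<^sub>R (indicator ?C (x u) *\<^sub>R ?f (x u))))"
    by (rule integral_restrict_space[OF DR])
  also have "\<dots> = (LINT u:cbox a b|lborel. ?f (x u) * J F (D, x) u)"
    unfolding set_lebesgue_integral_def
  proof (rule Bochner_Integration.integral_cong[OF refl])
    fix u
    have "u \<in> D \<Longrightarrow> x u \<in> ?C \<longleftrightarrow> u \<in> cbox a b" using inj_on_image_mem_iff[OF chart_inj[OF c] _ K] by blast
    then show "indicator D u *\<^sub>R (J F (D, x) u *\<^sub>R (indicator ?C (x u) *\<^sub>R ?f (x u))) = indicator (cbox a b) u *\<^sub>R (?f (x u) * J F (D, x) u)"
      using K by (auto simp: indicator_def)
  qed
  also have "\<dots> = integral (cbox a b) (\<lambda>u. ?f (x u) * J F (D, x) u)"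
  proof (rule set_borel_integral_eq_integral(2)[OF set_integrable_continuous_cbox])
    have "continuous_on (cbox a b) (\<lambda>u. F (x u))"
      by (rule continuous_on_subset[OF smooth_on_imp_continuous_on[OF smooth_map_chart[OF F c]] K])
    then show "continuous_on (cbox a b) (\<lambda>u. ?f (x u) * J F (D, x) u)"
      by (intro continuous_intros continuous_on_subset[OF J_continuous[OF c F] K]) (use F0 in auto)
  qed
  finally show ?thesis .
qed

end

subsection \<open>Variations supported in a chart\<close>

lemma Ck_on_snd:
  assumes "open S" "open T" "Ck_on k f S"
  shows "Ck_on k (\<lambda>z. f (snd z)) (T \<times> S)"
  using assms(3)
proof (induction k arbitrary: f)
  case 0
  then show ?case by (auto intro!: continuous_on_compose2[of S f] continuous_intros)
next
  case (Suc k)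
  have d: "((\<lambda>z. f (snd z)) has_derivative (\<lambda>v. frechet_derivative f (at (snd z)) (snd v))) (at z)" if "z \<in> T \<times> S" for z
  proof (rule has_derivative_compose[where f = snd and g = f])
    show "(snd has_derivative snd) (at z)" by (rule has_derivative_snd[OF has_derivative_ident])
    show "(f has_derivative frechet_derivative f (at (snd z))) (at (snd z))"
      using Suc.prems that by (intro Ck_on_Suc_has_derivative) auto
  qed
  have "Ck_on k (\<lambda>z. frechet_derivative f (at (snd z)) (snd v)) (T \<times> S)" for v
    using Suc.prems by (intro Suc.IH[of "\<lambda>u. frechet_derivative f (at u) (snd v)"]) simp
  from Ck_on_SucI[OF open_Times[OF assms(2,1)] d this] show ?case .
qed

context surface begin

definition chart_bump :: "'a chart \<Rightarrow> real^2 \<Rightarrow> real \<Rightarrow> 'a \<Rightarrow> real" where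
  "chart_bump c u0 r p = (if p \<in> snd c ` fst c then bump u0 r (the_inv_into (fst c) (snd c) p) else 0)"

lemma chart_bump_chart: "(D, x) \<in> A \<Longrightarrow> u \<in> D \<Longrightarrow> chart_bump (D, x) u0 r (x u) = bump u0 r u"
  unfolding chart_bump_def using the_inv_into_f_f[OF chart_inj] by simp

text \<open>The image \<open>x ` K\<close> is compact, hence closed because the surface is Hausdorff; so the
  extension by zero is smooth in every other chart too.\<close>

lemma smooth_chart_bump:
  assumes c: "(D, x) \<in> A" and c': "(D', y) \<in> A" and r: "r > 0" and K: "compact K" "K \<subseteq> D" "ball u0 r \<subseteq> K"
  shows "smooth_on D' (\<lambda>v. chart_bump (D, x) u0 r (y v))"
proof (rule smooth_on_local)
  fix v assume v: "v \<in> D'"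
  let ?W = "{v\<in>D'. y v \<in> x ` D}" and ?Z = "{v\<in>D'. y v \<in> topspace X - x ` K}"
  note t = transition[OF c' c]
  show "\<exists>T. open T \<and> v \<in> T \<and> smooth_on T (\<lambda>v. chart_bump (D, x) u0 r (y v))"
  proof (cases "y v \<in> x ` D")
    case True
    have "smooth_on ?W (\<lambda>v. bump u0 r (transition (D', y) (D, x) v))" by (rule smooth_on_bump_compose[OF t(1,2)])
    then have "smooth_on ?W (\<lambda>v. chart_bump (D, x) u0 r (y v))"
      by (rule smooth_on_cong_open[OF t(1), rotated]) (simp add: chart_bump_def transition_def)
    then show ?thesis using t(1) v True by blast
  next
    case False
    have o: "open ?Z" by (rule open_preimage[OF c']) (use chart_compact(2)[OF c K(1,2)] in blast)
    have z: "0 = chart_bump (D, x) u0 r (y w)" if "w \<in> ?Z" for w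
    proof (cases "y w \<in> x ` D")
      case True
      then obtain u where u: "u \<in> D" "y w = x u" by blast
      then have "u \<notin> K" using that by auto
      then have "u \<notin> ball u0 r" using K(3) by blast
      then show ?thesis unfolding u(2) chart_bump_chart[OF c u(1)] using bump_zero[OF r] by simp
    qed (simp add: chart_bump_def)
    have "smooth_on ?Z (\<lambda>v. chart_bump (D, x) u0 r (y v))"
      by (rule smooth_on_cong_open[OF o z smooth_on_const[OF o]])
    moreover have "v \<in> ?Z" using v False K(2) chart_subset[OF c'] by blast
    ultimately show ?thesis using o by blast
  qed
qed

definition push :: "('a \<Rightarrow> real^3) \<Rightarrow> ('a \<Rightarrow> real) \<Rightarrow> real^3 \<Rightarrow> real \<Rightarrow> 'a \<Rightarrow> real^3" where
  "push F h v t p = F p + (t * h p) *\<^sub>R v"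

lemma smooth_map_push:
  assumes F: "smooth_map A F" and h: "\<And>D x. (D, x) \<in> A \<Longrightarrow> smooth_on D (\<lambda>u. h (x u))"
  shows "smooth_map A (push F h v t)"
  unfolding smooth_map_def
proof safe
  fix D x assume c: "(D, x) \<in> A"
  note o = chart(1)[OF c]
  show "smooth_on D (push F h v t \<circ> x)"
    unfolding push_def[abs_def] o_def
    by (rule smooth_on_add[OF o smooth_map_chart[OF F c] smooth_on_scaleR[OF o smooth_on_mult[OF o smooth_on_const[OF o] h[OF c]] smooth_on_const[OF o]]])
qed

lemma compact_variation_push:
  assumes F: "smooth_map A F" and h: "\<And>D x. (D, x) \<in> A \<Longrightarrow> smooth_on D (\<lambda>u. h (x u))"
    and C: "compactin X C" "\<And>p. p \<in> topspace X - C \<Longrightarrow> h p = 0"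
  shows "compact_variation X A F C 1 (push F h v)"
  unfolding compact_variation_def
proof (intro conjI ballI)
  fix c assume "c \<in> A"
  moreover obtain D x where cc: "c = (D, x)" by (metis surj_pair)
  ultimately have c: "(D, x) \<in> A" by simp
  let ?T = "{-1<..<1::real}"
  have o: "open (?T \<times> D)" by (intro open_Times chart(1)[OF c]) auto
  have sn: "smooth_on (?T \<times> D) (\<lambda>z. g (snd z))" if "smooth_on D g" for g :: "real^2 \<Rightarrow> 'b::real_normed_vector"
    unfolding smooth_on_def by (intro allI Ck_on_snd chart(1)[OF c] smooth_on_imp_Ck[OF that]) auto
  have fs: "smooth_on (?T \<times> D) (fst :: real \<times> (real^2) \<Rightarrow> real)"
    using smooth_on_bounded_linear[OF o bounded_linear_fst smooth_on_id[OF o]] by simp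
  from smooth_on_add[OF o sn[OF smooth_map_chart[OF F c]] smooth_on_scaleR[OF o smooth_on_mult[OF o fs sn[OF h[OF c]]] smooth_on_const[OF o, of v]]]
  have "smooth_on (?T \<times> D) (\<lambda>(t, u). push F h v t (x u))" unfolding push_def split_beta .
  then show "case c of (D, x) \<Rightarrow> smooth_on (?T \<times> D) (\<lambda>(t, u). push F h v t (x u))" unfolding cc by simp
qed (use C in \<open>auto simp: push_def\<close>)

end

section \<open>The Euler--Lagrange equation\<close>

text \<open>Small variations of an immersion that avoids the origin stay away from the singularities
  of the energy density, uniformly on a compact set.\<close>

lemma line_avoids_zero:
  fixes P p :: "'a::topological_space \<Rightarrow> 'b::real_normed_vector"
  assumes K: "compact K" and c: "continuous_on K P" "continuous_on K p" and P: "\<And>u. u \<in> K \<Longrightarrow> P u \<noteq> 0"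
  shows "\<exists>\<delta>>0. \<forall>t. \<bar>t\<bar> \<le> \<delta> \<longrightarrow> (\<forall>u\<in>K. P u + t *\<^sub>R p u \<noteq> 0)"
proof (cases "K = {}")
  case False
  obtain B where B: "B > 0" "\<And>u. u \<in> K \<Longrightarrow> norm (p u) \<le> B"
    using compact_imp_bounded[OF compact_continuous_image[OF c(2) K]] unfolding bounded_pos by blast
  obtain z where z: "z \<in> K" "\<And>u. u \<in> K \<Longrightarrow> norm (P z) \<le> norm (P u)"
    using continuous_attains_inf[OF K False continuous_on_norm[OF c(1)]] by blast
  define m where "m = norm (P z)"
  have m: "m > 0" unfolding m_def using P[OF z(1)] by simp
  have "P u + t *\<^sub>R p u \<noteq> 0" if t: "\<bar>t\<bar> \<le> m / (2 * B)" and u: "u \<in> K" for t u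
  proof
    assume "P u + t *\<^sub>R p u = 0"
    then have "P u = - (t *\<^sub>R p u)" by (simp add: add_eq_0_iff2)
    then have "norm (P u) = \<bar>t\<bar> * norm (p u)" by simp
    also have "\<dots> \<le> m / (2 * B) * B" by (rule mult_mono[OF t B(2)[OF u]]) (use m B in auto)
    also have "\<dots> = m / 2" using B by simp
    finally show False using z(2)[OF u] m unfolding m_def by simp
  qed
  then show ?thesis using m B(1) by (intro exI[of _ "m / (2 * B)"]) simp
qed (auto intro: exI[of _ 1])

lemma cross3_parallel_normal:
  assumes "a \<bullet> n = 0" "b \<bullet> n = 0" "n \<bullet> n = (1::real)"
  shows "cross3 a b = (n \<bullet> cross3 a b) *\<^sub>R n"
proof -
  have "cross3 n (cross3 a b) = 0" unfolding Lagrange using assms by (simp add: inner_commute)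
  then have "cross3 (cross3 a b) n = 0" using cross_skew[of "cross3 a b" n] by simp
  then have "cross3 n (cross3 (cross3 a b) n) = 0" by simp
  then show ?thesis unfolding Lagrange using assms(3) by simp
qed

text \<open>A patch \<open>F\<close> of an immersed surface that avoids the origin, with \<open>c = F\<^sub>1 \<times> F\<^sub>2\<close>. The integrand of the
  first variation in the direction \<open>h v\<close> is \<open>h A\<^sub>0 + h\<^sub>1 A\<^sub>1 + h\<^sub>2 A\<^sub>2\<close>.\<close>

locale patch =
  fixes D :: "(real^2) set" and F :: "real^2 \<Rightarrow> real^3"
  assumes D: "open D" and F: "smooth_on D F" and F0: "\<And>u. u \<in> D \<Longrightarrow> F u \<noteq> 0"
    and c0: "\<And>u. u \<in> D \<Longrightarrow> coord_cross F u \<noteq> 0"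
begin

abbreviation "c u \<equiv> coord_cross F u"

definition n :: "real^2 \<Rightarrow> real^3" where "n u = sgn (c u)"

lemma smooth_partials: "smooth_on D (\<lambda>u. frechet_derivative F (at u) v)"
  by (rule smooth_on_frechet_derivative[OF F])

lemma smooth_c: "smooth_on D c"
  unfolding coord_cross_def by (rule smooth_on_cross3[OF D smooth_partials smooth_partials])

lemma smooth_n: "smooth_on D n"
  unfolding n_def[abs_def] by (rule smooth_on_sgn[OF D smooth_c c0])

lemma n_unit: "u \<in> D \<Longrightarrow> n u \<bullet> n u = 1"
  unfolding n_def using c0[of u] by (simp add: dot_square_norm norm_sgn)

lemma c_eq: "c u = norm (c u) *\<^sub>R n u"
  unfolding n_def sgn_div_norm by (cases "c u = 0") simp_all

lemma n_tangent: "pd1 F u \<bullet> n u = 0" "pd2 F u \<bullet> n u = 0"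
  unfolding n_def sgn_div_norm coord_cross_def by (simp_all add: dot_cross_self)

lemma dn_tangent:
  assumes u: "u \<in> D" shows "frechet_derivative n (at u) v \<bullet> n u = 0"
  using dir_deriv_orthogonal[OF D smooth_n smooth_n n_unit u, of "\<lambda>_. v"] unfolding dir_deriv_def by (simp add: inner_commute)

definition A0 :: "real \<Rightarrow> real^3 \<Rightarrow> real^2 \<Rightarrow> real" where
  "A0 \<alpha> v u = \<alpha> * norm (F u) powr (\<alpha> - 2) * (F u \<bullet> v) * norm (c u)"
definition A1 :: "real \<Rightarrow> real^3 \<Rightarrow> real^2 \<Rightarrow> real" where
  "A1 \<alpha> v u = norm (F u) powr \<alpha> * (n u \<bullet> cross3 v (pd2 F u))"
definition A2 :: "real \<Rightarrow> real^3 \<Rightarrow> real^2 \<Rightarrow> real" where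
  "A2 \<alpha> v u = norm (F u) powr \<alpha> * (n u \<bullet> cross3 (pd1 F u) v)"

lemma smooth_powr: "smooth_on D (\<lambda>u. norm (F u) powr a)"
  by (rule smooth_on_powr[OF D smooth_on_norm[OF D F F0]]) (use F0 in auto)

lemma smooth_A: "smooth_on D (A0 \<alpha> v)" "smooth_on D (A1 \<alpha> v)" "smooth_on D (A2 \<alpha> v)"
proof -
  note k = smooth_on_const[OF D]
  show "smooth_on D (A0 \<alpha> v)" unfolding A0_def[abs_def]
    by (rule smooth_on_mult[OF D smooth_on_mult[OF D smooth_on_mult[OF D k smooth_powr] smooth_on_inner[OF D F k]] smooth_on_norm[OF D smooth_c c0]])
  show "smooth_on D (A1 \<alpha> v)" unfolding A1_def[abs_def]
    by (rule smooth_on_mult[OF D smooth_powr smooth_on_inner[OF D smooth_n smooth_on_cross3[OF D k smooth_partials]]])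
  show "smooth_on D (A2 \<alpha> v)" unfolding A2_def[abs_def]
    by (rule smooth_on_mult[OF D smooth_powr smooth_on_inner[OF D smooth_n smooth_on_cross3[OF D smooth_partials k]]])
qed

lemma frechet_push:
  assumes h: "smooth_on D h" and u: "u \<in> D"
  shows "frechet_derivative (\<lambda>u. F u + (t * h u) *\<^sub>R v) (at u) w =
    frechet_derivative F (at u) w + (t * frechet_derivative h (at u) w) *\<^sub>R v"
proof -
  have "((\<lambda>u. F u + (t * h u) *\<^sub>R v) has_derivative (\<lambda>w. frechet_derivative F (at u) w + (t * frechet_derivative h (at u) w) *\<^sub>R v)) (at u)"
    by (rule has_derivative_add[OF smooth_on_has_derivative[OF F u] has_derivative_scaleR_left[OF
          has_derivative_mult_right[OF smooth_on_has_derivative[OF h u]]]])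
  then show ?thesis by (rule fun_cong[OF frechet_derivative_at[symmetric]])
qed

text \<open>Linear in \<open>t\<close>, because the quadratic term contains \<open>v \<times> v = 0\<close>.\<close>

lemma coord_cross_push:
  assumes h: "smooth_on D h" and u: "u \<in> D"
  shows "coord_cross (\<lambda>u. F u + (t * h u) *\<^sub>R v) u =
    c u + t *\<^sub>R (pd1 h u *\<^sub>R cross3 v (pd2 F u) + pd2 h u *\<^sub>R cross3 (pd1 F u) v)"
  unfolding coord_cross_def frechet_push[OF h u] cross_add_left cross_add_right cross_mult_left cross_mult_right
  by (simp add: scaleR_add_right)

lemma first_variation:
  assumes h: "smooth_on D h" and K: "cbox a b \<subseteq> D"
  shows "((\<lambda>t. integral (cbox a b) (\<lambda>u. norm (F u + (t * h u) *\<^sub>R v) powr \<alpha> * norm (coord_cross (\<lambda>u. F u + (t * h u) *\<^sub>R v) u)))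
    has_real_derivative integral (cbox a b) (\<lambda>u. h u * A0 \<alpha> v u + (pd1 h u * A1 \<alpha> v u + pd2 h u * A2 \<alpha> v u))) (at 0)"
    and "\<exists>\<delta>>0. \<forall>t. \<bar>t\<bar> \<le> \<delta> \<longrightarrow> (\<forall>u\<in>cbox a b. F u + (t * h u) *\<^sub>R v \<noteq> 0)"
proof -
  let ?K = "cbox a b"
  define p where "p = (\<lambda>u. h u *\<^sub>R v)"
  define d where "d = (\<lambda>u. pd1 h u *\<^sub>R cross3 v (pd2 F u) + pd2 h u *\<^sub>R cross3 (pd1 F u) v)"
  note KD = subsetD[OF K]
  note co = continuous_on_subset[OF smooth_on_imp_continuous_on K]
  have sp: "smooth_on D p" unfolding p_def by (rule smooth_on_scaleR[OF D h smooth_on_const[OF D]])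
  have sd: "smooth_on D d" unfolding d_def
    by (rule smooth_on_add[OF D smooth_on_scaleR[OF D smooth_on_frechet_derivative[OF h] smooth_on_cross3[OF D smooth_on_const[OF D] smooth_partials]]
          smooth_on_scaleR[OF D smooth_on_frechet_derivative[OF h] smooth_on_cross3[OF D smooth_partials smooth_on_const[OF D]]]])
  note cn = co[OF F] co[OF sp] co[OF smooth_c] co[OF sd]
  obtain \<delta>1 where d1: "\<delta>1 > 0" "\<And>t u. \<bar>t\<bar> \<le> \<delta>1 \<Longrightarrow> u \<in> ?K \<Longrightarrow> F u + t *\<^sub>R p u \<noteq> 0"
    using line_avoids_zero[OF compact_cbox cn(1,2) F0[OF KD]] by blast
  obtain \<delta>2 where d2: "\<delta>2 > 0" "\<And>t u. \<bar>t\<bar> \<le> \<delta>2 \<Longrightarrow> u \<in> ?K \<Longrightarrow> c u + t *\<^sub>R d u \<noteq> 0"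
    using line_avoids_zero[OF compact_cbox cn(3,4) c0[OF KD]] by blast
  define \<delta> where "\<delta> = min \<delta>1 \<delta>2"
  have \<delta>: "\<delta> > 0" unfolding \<delta>_def using d1 d2 by simp
  let ?U = "{-\<delta>..\<delta>}"
  have nz: "F u + t *\<^sub>R p u \<noteq> 0" "c u + t *\<^sub>R d u \<noteq> 0" if "t \<in> ?U" "u \<in> ?K" for t u
  proof -
    have "\<bar>t\<bar> \<le> \<delta>1" "\<bar>t\<bar> \<le> \<delta>2" using that(1) unfolding \<delta>_def by auto
    then show "F u + t *\<^sub>R p u \<noteq> 0" "c u + t *\<^sub>R d u \<noteq> 0" using d1(2)[OF _ that(2)] d2(2)[OF _ that(2)] by blast+
  qed
  show "\<exists>\<delta>>0. \<forall>t. \<bar>t\<bar> \<le> \<delta> \<longrightarrow> (\<forall>u\<in>?K. F u + (t * h u) *\<^sub>R v \<noteq> 0)"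
    using d1 unfolding p_def by (intro exI[of _ \<delta>1]) simp
  define e where "e = (\<lambda>t u. norm (F u + t *\<^sub>R p u) powr \<alpha> * norm (c u + t *\<^sub>R d u))"
  define e' where "e' = (\<lambda>t u. \<alpha> * norm (F u + t *\<^sub>R p u) powr (\<alpha> - 2) * ((F u + t *\<^sub>R p u) \<bullet> p u) * norm (c u + t *\<^sub>R d u)
     + norm (F u + t *\<^sub>R p u) powr \<alpha> * ((c u + t *\<^sub>R d u) \<bullet> d u / norm (c u + t *\<^sub>R d u)))"
  have cs: "continuous_on (?U \<times> ?K) (\<lambda>z. g (snd z))" if "continuous_on ?K g" for g :: "real^2 \<Rightarrow> real^3"
    by (rule continuous_on_compose2[OF that]) (auto intro!: continuous_intros)
  have "((\<lambda>t. integral ?K (e t)) has_field_derivative integral ?K (e' 0)) (at 0 within ?U)"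
  proof (rule leibniz_rule_field_derivative)
    fix t u assume t: "t \<in> ?U"
    show "((\<lambda>t. e t u) has_real_derivative e' t u) (at t within ?U)" if u: "u \<in> ?K"
      unfolding e_def e'_def by (rule has_field_derivative_at_within[OF has_derivative_density[OF nz[OF t u]]])
    show "e t integrable_on ?K"
      unfolding e_def
      by (rule integrable_continuous) (use nz[OF t] cn in \<open>auto intro!: continuous_intros\<close>)
  next
    show "continuous_on (?U \<times> ?K) (\<lambda>(t, u). e' t u)"
      unfolding e'_def split_beta
      by (intro continuous_intros cs cn) (use nz in auto)
  qed (use \<delta> in auto)
  then have "((\<lambda>t. integral ?K (e t)) has_real_derivative integral ?K (e' 0)) (at 0)"
    using \<delta> by (simp add: at_within_Icc_at)
  moreover have "integral ?K (e t) = integral ?K (\<lambda>u. norm (F u + (t * h u) *\<^sub>R v) powr \<alpha> * norm (coord_cross (\<lambda>u. F u + (t * h u) *\<^sub>R v) u))" for t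
    by (rule integral_cong) (use KD in \<open>simp add: e_def p_def d_def coord_cross_push[OF h]\<close>)
  moreover have "integral ?K (e' 0) = integral ?K (\<lambda>u. h u * A0 \<alpha> v u + (pd1 h u * A1 \<alpha> v u + pd2 h u * A2 \<alpha> v u))"
  proof (rule integral_cong)
    fix u
    have n: "c u \<bullet> w / norm (c u) = n u \<bullet> w" for w unfolding n_def sgn_div_norm by (simp add: divide_inverse mult.commute)
    show "e' 0 u = h u * A0 \<alpha> v u + (pd1 h u * A1 \<alpha> v u + pd2 h u * A2 \<alpha> v u)"
      unfolding e'_def scaleR_zero_left add_0_right n
      unfolding A0_def A1_def A2_def p_def d_def by (simp add: inner_add_right distrib_left mult.left_commute)
  qed
  ultimately show "((\<lambda>t. integral ?K (\<lambda>u. norm (F u + (t * h u) *\<^sub>R v) powr \<alpha> * norm (coord_cross (\<lambda>u. F u + (t * h u) *\<^sub>R v) u)))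
    has_real_derivative integral ?K (\<lambda>u. h u * A0 \<alpha> v u + (pd1 h u * A1 \<alpha> v u + pd2 h u * A2 \<alpha> v u))) (at 0)" by simp
qed

lemma integral_product_rule:
  assumes h: "smooth_on D h" and w: "smooth_on D w" and K: "cbox a b \<subseteq> D" and h0: "\<And>u. u \<in> D \<Longrightarrow> u \<notin> cbox a b \<Longrightarrow> h u = 0"
  shows "integral (cbox a b) (\<lambda>u. frechet_derivative h (at u) v * w u + h u * frechet_derivative w (at u) v) = (0::real)"
proof -
  define g where "g = (\<lambda>u. if u \<in> D then h u * w u else 0)"
  have hw: "smooth_on D (\<lambda>u. h u * w u)" by (rule smooth_on_mult[OF D h w])
  have gD: "smooth_on D g" by (rule smooth_on_cong_open[OF D _ hw]) (simp add: g_def)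
  have oc: "open (- cbox a b)" using closed_cbox by blast
  have gc: "smooth_on (- cbox a b) g"
    by (rule smooth_on_cong_open[OF oc _ smooth_on_const[OF oc]]) (use h0 in \<open>auto simp: g_def\<close>)
  have g: "smooth_on UNIV g"
  proof (rule smooth_on_local)
    fix u :: "real^2"
    show "\<exists>T. open T \<and> u \<in> T \<and> smooth_on T g"
      using gD gc D oc K by (cases "u \<in> cbox a b") blast+
  qed
  have "integral (cbox a b) (\<lambda>u. frechet_derivative g (at u) v) = 0"
  proof (rule integral_derivative_compact_support)
    show "(g has_derivative frechet_derivative g (at u)) (at u)" for u by (rule smooth_on_has_derivative[OF g UNIV_I])
    show "continuous_on UNIV (\<lambda>u. frechet_derivative g (at u) v)"
      by (rule smooth_on_imp_continuous_on[OF smooth_on_frechet_derivative[OF g]])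
    show "g u = 0" if "u \<notin> cbox a b" for u using h0 that by (simp add: g_def)
  qed
  moreover have "integral (cbox a b) (\<lambda>u. frechet_derivative h (at u) v * w u + h u * frechet_derivative w (at u) v)
      = integral (cbox a b) (\<lambda>u. frechet_derivative g (at u) v)"
  proof (rule integral_cong)
    fix u assume u: "u \<in> cbox a b"
    show "frechet_derivative h (at u) v * w u + h u * frechet_derivative w (at u) v = frechet_derivative g (at u) v"
  proof -
    have uD: "u \<in> D" using u K by blast
    have "dir_deriv (\<lambda>_. v) g u = dir_deriv (\<lambda>_. v) (\<lambda>u. h u * w u) u"
      by (rule dir_deriv_cong_open[OF D gD uD]) (simp add: g_def)
    then show ?thesis unfolding dir_deriv_mult[OF h w uD] unfolding dir_deriv_def by simp
  qed
  qed
  ultimately show ?thesis by simp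
qed

text \<open>The Euler--Lagrange operator of the energy, paired with the direction \<open>v\<close>.\<close>

definition L :: "real \<Rightarrow> real^3 \<Rightarrow> real^2 \<Rightarrow> real" where
  "L \<alpha> v u = A0 \<alpha> v u - (pd1 (A1 \<alpha> v) u + pd2 (A2 \<alpha> v) u)"

lemma smooth_L: "smooth_on D (L \<alpha> v)"
  unfolding L_def[abs_def]
  by (rule smooth_on_diff[OF D smooth_A(1) smooth_on_add[OF D smooth_on_frechet_derivative[OF smooth_A(2)] smooth_on_frechet_derivative[OF smooth_A(3)]]])

lemma first_variation_by_parts:
  assumes h: "smooth_on D h" and K: "cbox a b \<subseteq> D" and h0: "\<And>u. u \<in> D \<Longrightarrow> u \<notin> cbox a b \<Longrightarrow> h u = 0"
  shows "integral (cbox a b) (\<lambda>u. h u * A0 \<alpha> v u + (pd1 h u * A1 \<alpha> v u + pd2 h u * A2 \<alpha> v u)) = integral (cbox a b) (\<lambda>u. h u * L \<alpha> v u)"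
proof -
  let ?g1 = "\<lambda>u. pd1 h u * A1 \<alpha> v u + h u * pd1 (A1 \<alpha> v) u" and ?g2 = "\<lambda>u. pd2 h u * A2 \<alpha> v u + h u * pd2 (A2 \<alpha> v) u"
  note int = integrable_continuous[OF continuous_on_subset[OF smooth_on_imp_continuous_on K]]
  have s1: "smooth_on D ?g1"
    by (rule smooth_on_add[OF D smooth_on_mult[OF D smooth_on_frechet_derivative[OF h] smooth_A(2)] smooth_on_mult[OF D h smooth_on_frechet_derivative[OF smooth_A(2)]]])
  have s2: "smooth_on D ?g2"
    by (rule smooth_on_add[OF D smooth_on_mult[OF D smooth_on_frechet_derivative[OF h] smooth_A(3)] smooth_on_mult[OF D h smooth_on_frechet_derivative[OF smooth_A(3)]]])
  have s3: "smooth_on D (\<lambda>u. h u * L \<alpha> v u)" by (rule smooth_on_mult[OF D h smooth_L])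
  have "integral (cbox a b) (\<lambda>u. h u * A0 \<alpha> v u + (pd1 h u * A1 \<alpha> v u + pd2 h u * A2 \<alpha> v u)) = integral (cbox a b) (\<lambda>u. h u * L \<alpha> v u + (?g1 u + ?g2 u))"
    by (rule integral_cong) (simp add: L_def algebra_simps)
  also have "\<dots> = integral (cbox a b) (\<lambda>u. h u * L \<alpha> v u) + (integral (cbox a b) ?g1 + integral (cbox a b) ?g2)"
    unfolding Henstock_Kurzweil_Integration.integral_add[OF int[OF s3] integrable_add[OF int[OF s1] int[OF s2]]]
      Henstock_Kurzweil_Integration.integral_add[OF int[OF s1] int[OF s2]] ..
  also have "integral (cbox a b) ?g1 = 0" by (rule integral_product_rule[OF h smooth_A(2) K h0])
  also have "integral (cbox a b) ?g2 = 0" by (rule integral_product_rule[OF h smooth_A(3) K h0])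
  finally show ?thesis by simp
qed

text \<open>The fundamental lemma of the calculus of variations: where \<open>L\<close> has a sign, integration
  against a bump function would detect it.\<close>

lemma L_zero_if_stationary:
  assumes u0: "u0 \<in> D"
    and st: "\<And>a b r. cbox a b \<subseteq> D \<Longrightarrow> r > 0 \<Longrightarrow> ball u0 r \<subseteq> cbox a b \<Longrightarrow> integral (cbox a b) (\<lambda>u. bump u0 r u * L \<alpha> v u) = 0"
  shows "L \<alpha> v u0 = 0"
proof -
  have "\<not> \<sigma> * L \<alpha> v u0 > 0" for \<sigma> :: real
  proof
    assume pos: "\<sigma> * L \<alpha> v u0 > 0"
    have sL: "continuous_on D (\<lambda>u. \<sigma> * L \<alpha> v u)"
      by (rule continuous_on_mult[OF continuous_on_const smooth_on_imp_continuous_on[OF smooth_L]])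
    have "open (D \<inter> (\<lambda>u. \<sigma> * L \<alpha> v u) -` {0<..})" by (rule continuous_open_preimage[OF sL D]) auto
    moreover have "u0 \<in> D \<inter> (\<lambda>u. \<sigma> * L \<alpha> v u) -` {0<..}" using u0 pos by simp
    ultimately obtain a b where ab: "cbox a b \<subseteq> D \<inter> (\<lambda>u. \<sigma> * L \<alpha> v u) -` {0<..}" "u0 \<in> box a b"
      using open_contains_cbox by metis
    obtain r where r: "r > 0" "ball u0 r \<subseteq> box a b" using ab(2) open_box openE by blast
    have K: "cbox a b \<subseteq> D" "ball u0 r \<subseteq> cbox a b" using ab(1) r(2) box_subset_cbox by blast+
    have cb: "continuous_on (cbox a b) (bump u0 r)"
      using smooth_on_imp_continuous_on[OF smooth_on_bump_compose[OF open_UNIV smooth_on_id[OF open_UNIV]]] continuous_on_subset by blast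
    have "integral (cbox a b) (\<lambda>u. bump u0 r u * (\<sigma> * L \<alpha> v u)) = \<sigma> * integral (cbox a b) (\<lambda>u. bump u0 r u * L \<alpha> v u)"
      unfolding integral_mult_right[symmetric] by (rule integral_cong) simp
    also have "\<dots> = 0" using st[OF K(1) r(1) K(2)] by simp
    finally have z: "integral (cbox a b) (\<lambda>u. bump u0 r u * (\<sigma> * L \<alpha> v u)) = 0" .
    have "\<forall>u\<in>cbox a b. bump u0 r u * (\<sigma> * L \<alpha> v u) = 0"
    proof (rule integral_cbox_eq_0_iff[THEN iffD1, OF _ _ _ z])
      show "continuous_on (cbox a b) (\<lambda>u. bump u0 r u * (\<sigma> * L \<alpha> v u))"
        by (rule continuous_on_mult[OF cb continuous_on_subset[OF sL K(1)]])
      show "box a b \<noteq> {}" using ab(2) by blast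
      fix u assume "u \<in> cbox a b"
      then have "\<sigma> * L \<alpha> v u > 0" using ab(1) by auto
      then show "0 \<le> bump u0 r u * (\<sigma> * L \<alpha> v u)" using bump_nonneg[of u0 r u] by simp
    qed
    then have "bump u0 r u0 * (\<sigma> * L \<alpha> v u0) = 0" using ab(2) box_subset_cbox by blast
    moreover have "bump u0 r u0 > 0" using bump_pos_iff[OF r(1), of u0 u0] r(1) by simp
    ultimately show False using mult_pos_pos[OF _ pos] by fastforce
  qed
  from this[of 1] this[of "-1"] show ?thesis by simp
qed

text \<open>Testing with the constant vector \<open>v = n(u\<^sub>0)\<close>, all terms in which \<open>|F|\<^sup>\<alpha>\<close> or \<open>F\<^sub>i\<close> is differentiated vanish at \<open>u\<^sub>0\<close>.\<close>

lemma mean_curvature_equation: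
  assumes u: "u \<in> D" and L: "L \<alpha> (n u) u = 0"
  shows "cross3 (pd1 F u) (pd2 n u) + cross3 (pd1 n u) (pd2 F u) = - (\<alpha> * (F u \<bullet> n u) / (F u \<bullet> F u)) *\<^sub>R c u"
proof -
  define v where "v = n u"
  note k = smooth_on_const[OF D, of v]
  note s1 = smooth_on_cross3[OF D k smooth_partials] and s2 = smooth_on_cross3[OF D smooth_partials k]
  have dc: "dir_deriv V (\<lambda>u. v) u = 0" for V unfolding dir_deriv_def by simp
  have 1: "pd1 (A1 \<alpha> v) u = norm (F u) powr \<alpha> * (pd1 n u \<bullet> cross3 v (pd2 F u))"
  proof -
    have "dir_deriv (\<lambda>_. axis 1 1) (\<lambda>u. norm (F u) powr \<alpha> * (n u \<bullet> cross3 v (pd2 F u))) u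
        = norm (F u) powr \<alpha> * (pd1 n u \<bullet> cross3 v (pd2 F u))"
      unfolding dir_deriv_mult[OF smooth_powr smooth_on_inner[OF D smooth_n s1] u] dir_deriv_inner[OF smooth_n s1 u]
        dir_deriv_bounded_bilinear[OF bounded_bilinear_cross3 k smooth_partials u] dc
      unfolding dir_deriv_def v_def by (simp add: dot_cross_self)
    then show ?thesis unfolding dir_deriv_def A1_def[abs_def] .
  qed
  have 2: "pd2 (A2 \<alpha> v) u = norm (F u) powr \<alpha> * (pd2 n u \<bullet> cross3 (pd1 F u) v)"
  proof -
    have "dir_deriv (\<lambda>_. axis 2 1) (\<lambda>u. norm (F u) powr \<alpha> * (n u \<bullet> cross3 (pd1 F u) v)) u
        = norm (F u) powr \<alpha> * (pd2 n u \<bullet> cross3 (pd1 F u) v)"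
      unfolding dir_deriv_mult[OF smooth_powr smooth_on_inner[OF D smooth_n s2] u] dir_deriv_inner[OF smooth_n s2 u]
        dir_deriv_bounded_bilinear[OF bounded_bilinear_cross3 smooth_partials k u] dc
      unfolding dir_deriv_def v_def by (simp add: dot_cross_self)
    then show ?thesis unfolding dir_deriv_def A2_def[abs_def] .
  qed
  define m where "m = n u \<bullet> (cross3 (pd1 F u) (pd2 n u) + cross3 (pd1 n u) (pd2 F u))"
  have tp: "pd1 n u \<bullet> cross3 v (pd2 F u) + pd2 n u \<bullet> cross3 (pd1 F u) v = - m"
    unfolding m_def v_def by (simp add: cross3_simps)
  have F2: "F u \<bullet> F u > 0" using F0[OF u] by simp
  define P where "P = norm (F u) powr (\<alpha> - 2)"
  have P: "P > 0" unfolding P_def using F0[OF u] by simp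
  have "norm (F u) powr \<alpha> = norm (F u) powr ((\<alpha> - 2) + 2)" by simp
  also have "\<dots> = P * norm (F u) powr 2" unfolding P_def by (rule powr_add)
  also have "norm (F u) powr 2 = F u \<bullet> F u" using F0[OF u] by (simp add: dot_square_norm)
  finally have Pa: "norm (F u) powr \<alpha> = P * (F u \<bullet> F u)" .
  have "\<alpha> * P * (F u \<bullet> v) * norm (c u) = norm (F u) powr \<alpha> * (pd1 n u \<bullet> cross3 v (pd2 F u) + pd2 n u \<bullet> cross3 (pd1 F u) v)"
    using L unfolding v_def[symmetric] L_def 1 2 A0_def P_def by (simp add: distrib_left)
  then have "P * (\<alpha> * (F u \<bullet> v) * norm (c u)) = P * (- (F u \<bullet> F u) * m)" unfolding tp Pa by (simp add: algebra_simps)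
  moreover have "P \<noteq> 0" using P by simp
  ultimately have "\<alpha> * (F u \<bullet> v) * norm (c u) = - (F u \<bullet> F u) * m" using mult_left_cancel by blast
  then have m: "m = - (\<alpha> * (F u \<bullet> n u) / (F u \<bullet> F u)) * norm (c u)" using F2 unfolding v_def by (simp add: field_simps)
  have "cross3 (pd1 F u) (pd2 n u) + cross3 (pd1 n u) (pd2 F u) = m *\<^sub>R n u"
    unfolding m_def inner_add_right scaleR_add_left
    by (rule arg_cong2[where f = "(+)", OF cross3_parallel_normal[OF n_tangent(1) dn_tangent[OF u] n_unit[OF u]]
          cross3_parallel_normal[OF dn_tangent[OF u] n_tangent(2) n_unit[OF u]]])
  also have "\<dots> = - (\<alpha> * (F u \<bullet> n u) / (F u \<bullet> F u)) *\<^sub>R c u"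
    unfolding m scaleR_scaleR[symmetric] c_eq[symmetric] ..
  finally show ?thesis .
qed

end

context surface begin

text \<open>Injectivity of the differential says that \<open>F\<^sub>1\<close> and \<open>F\<^sub>2\<close> are linearly independent, that
  is, \<open>F\<^sub>1 \<times> F\<^sub>2 \<noteq> 0\<close>.\<close>

lemma patch_chart:
  assumes c: "(D, x) \<in> A" and imm: "smooth_immersion A \<Phi>" and nz: "0 \<notin> \<Phi> ` topspace X"
  shows "patch D (\<lambda>u. \<Phi> (x u))"
proof
  have sm: "smooth_map A \<Phi>" using imm unfolding smooth_immersion_def by blast
  show "open D" by (rule chart(1)[OF c])
  show s: "smooth_on D (\<lambda>u. \<Phi> (x u))" by (rule smooth_map_chart[OF sm c])
  fix u assume u: "u \<in> D"
  show "\<Phi> (x u) \<noteq> 0" using nz chart_subset[OF c] u by (metis image_eqI subsetD)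
  have inj: "inj (frechet_derivative (\<lambda>u. \<Phi> (x u)) (at u))"
    using imm c u unfolding smooth_immersion_def by (auto simp: o_def)
  note lin = has_derivative_linear[OF smooth_on_has_derivative[OF s u]]
  show "coord_cross (\<lambda>u. \<Phi> (x u)) u \<noteq> 0"
  proof
    let ?L = "frechet_derivative (\<lambda>u. \<Phi> (x u)) (at u)"
    assume "coord_cross (\<lambda>u. \<Phi> (x u)) u = 0"
    then have "collinear {0, ?L (axis 1 1), ?L (axis 2 1)}" unfolding coord_cross_def cross_eq_0 .
    then consider "?L (axis 1 1) = 0" | "?L (axis 2 1) = 0" | k where "?L (axis 2 1) = k *\<^sub>R ?L (axis 1 1)"
      unfolding collinear_lemma by blast
    then show False
    proof cases
      case 1
      then have "?L (axis 1 1) = ?L 0" using linear_0[OF lin] by simp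
      from injD[OF inj this] show ?thesis by (simp add: axis_eq_0_iff)
    next
      case 2
      then have "?L (axis 2 1) = ?L 0" using linear_0[OF lin] by simp
      from injD[OF inj this] show ?thesis by (simp add: axis_eq_0_iff)
    next
      case 3
      then have "?L (axis 2 1) = ?L (k *\<^sub>R axis 1 1)" using linear_scale[OF lin] by simp
      from injD[OF inj this] have "(axis (2::2) (1::real)) $ 2 = (k *\<^sub>R axis (1::2) (1::real)) $ 2" by simp
      then show ?thesis by (simp add: axis_def)
    qed
  qed
qed

text \<open>The bump functions of a chart, multiplied by a constant vector \<open>v\<close>, are admissible
  variations. Constant directions avoid differentiating a normal field.\<close>

theorem euler_lagrange:
  assumes c: "(D, x) \<in> A" and imm: "smooth_immersion A \<Phi>" and nz: "0 \<notin> \<Phi> ` topspace X"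
    and st: "alpha_stationary \<alpha> X A \<Phi>" and u0: "u0 \<in> D"
  shows "patch.L (\<lambda>u. \<Phi> (x u)) \<alpha> v u0 = 0"
proof -
  interpret patch D "\<lambda>u. \<Phi> (x u)" by (rule patch_chart[OF c imm nz])
  have sm: "smooth_map A \<Phi>" using imm unfolding smooth_immersion_def by blast
  show ?thesis
  proof (rule L_zero_if_stationary[OF u0])
    fix a b r assume K: "cbox a b \<subseteq> D" and r: "r > (0::real)" "ball u0 r \<subseteq> cbox a b"
    let ?C = "x ` cbox a b" and ?h = "chart_bump (D, x) u0 r" and ?F = "\<lambda>u. \<Phi> (x u)"
    have hs: "smooth_on D' (\<lambda>u. ?h (y u))" if "(D', y) \<in> A" for D' y
      by (rule smooth_chart_bump[OF c that r(1) compact_cbox K r(2)])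
    have h: "?h (x u) = bump u0 r u" if "u \<in> D" for u by (rule chart_bump_chart[OF c that])
    have b0: "bump u0 r u = 0" if "u \<notin> cbox a b" for u using bump_zero[OF r(1)] r(2) that by blast
    have h0: "?h p = 0" if "p \<in> topspace X - ?C" for p
    proof (cases "p \<in> x ` D")
      case True
      then obtain u where u: "u \<in> D" "p = x u" by blast
      then have "u \<notin> cbox a b" using that by blast
      then show ?thesis unfolding u(2) h[OF u(1)] by (rule b0)
    qed (simp add: chart_bump_def)
    have var: "compact_variation X A \<Phi> ?C 1 (push \<Phi> ?h v)"
      by (rule compact_variation_push[OF sm hs chart_compact(1)[OF c compact_cbox K] h0])
    have bs: "smooth_on D (bump u0 r)" by (rule smooth_on_bump_compose[OF D smooth_on_id[OF D]])
    note fv = first_variation[OF bs K, of v]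
    obtain \<delta> where \<delta>: "\<delta> > 0" "\<And>t u. \<bar>t\<bar> \<le> \<delta> \<Longrightarrow> u \<in> cbox a b \<Longrightarrow> ?F u + (t * bump u0 r u) *\<^sub>R v \<noteq> 0"
      using fv(2) by blast
    have pe: "push \<Phi> ?h v t (x u) = ?F u + (t * bump u0 r u) *\<^sub>R v" if "u \<in> D" for t u
      unfolding push_def h[OF that] ..
    have E: "energy \<alpha> X A ?C (push \<Phi> ?h v t) = integral (cbox a b) (\<lambda>u. norm (?F u + (t * bump u0 r u) *\<^sub>R v) powr \<alpha>
        * norm (coord_cross (\<lambda>u. ?F u + (t * bump u0 r u) *\<^sub>R v) u))" if t: "\<bar>t\<bar> \<le> \<delta>" for t
    proof -
      have "energy \<alpha> X A ?C (push \<Phi> ?h v t) = integral (cbox a b) (\<lambda>u. norm (push \<Phi> ?h v t (x u)) powr \<alpha> * J (push \<Phi> ?h v t) (D, x) u)"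
      proof (rule energy_chart[OF c K smooth_map_push[OF sm hs]])
        show "push \<Phi> ?h v t (x u) \<noteq> 0" if "u \<in> cbox a b" for u
          using \<delta>(2)[OF t that] pe[of u t] K that by auto
      qed
      also have "\<dots> = integral (cbox a b) (\<lambda>u. norm (?F u + (t * bump u0 r u) *\<^sub>R v) powr \<alpha>
        * norm (coord_cross (\<lambda>u. ?F u + (t * bump u0 r u) *\<^sub>R v) u))"
      proof (rule integral_cong)
        fix u assume "u \<in> cbox a b"
        then have u: "u \<in> D" using K by blast
        have s: "smooth_on D (\<lambda>u. push \<Phi> ?h v t (x u))" by (rule smooth_map_chart[OF smooth_map_push[OF sm hs] c])
        have "dir_deriv (\<lambda>_. w) (\<lambda>u. push \<Phi> ?h v t (x u)) u = dir_deriv (\<lambda>_. w) (\<lambda>u. ?F u + (t * bump u0 r u) *\<^sub>R v) u" for w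
          by (rule dir_deriv_cong_open[OF D s u pe])
        then have "coord_cross (\<lambda>u. push \<Phi> ?h v t (x u)) u = coord_cross (\<lambda>u. ?F u + (t * bump u0 r u) *\<^sub>R v) u"
          unfolding coord_cross_def dir_deriv_def by simp
        then show "norm (push \<Phi> ?h v t (x u)) powr \<alpha> * J (push \<Phi> ?h v t) (D, x) u = norm (?F u + (t * bump u0 r u) *\<^sub>R v) powr \<alpha>
          * norm (coord_cross (\<lambda>u. ?F u + (t * bump u0 r u) *\<^sub>R v) u)"
          unfolding J_def snd_conv o_def pe[OF u] by simp
      qed
      finally show ?thesis .
    qed
    have "((\<lambda>t. energy \<alpha> X A ?C (push \<Phi> ?h v t)) has_real_derivative 0) (at 0)"
      using st var unfolding alpha_stationary_def by blast
    then have "((\<lambda>t. integral (cbox a b) (\<lambda>u. norm (?F u + (t * bump u0 r u) *\<^sub>R v) powr \<alpha>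
        * norm (coord_cross (\<lambda>u. ?F u + (t * bump u0 r u) *\<^sub>R v) u))) has_real_derivative 0) (at 0)"
      by (rule has_field_derivative_transform_within_open[where S = "{-\<delta><..<\<delta>}"]) (use \<delta>(1) E in auto)
    from DERIV_unique[OF fv(1) this]
    have "integral (cbox a b) (\<lambda>u. bump u0 r u * A0 \<alpha> v u + (pd1 (bump u0 r) u * A1 \<alpha> v u + pd2 (bump u0 r) u * A2 \<alpha> v u)) = 0" .
    moreover have "integral (cbox a b) (\<lambda>u. bump u0 r u * A0 \<alpha> v u + (pd1 (bump u0 r) u * A1 \<alpha> v u + pd2 (bump u0 r) u * A2 \<alpha> v u))
        = integral (cbox a b) (\<lambda>u. bump u0 r u * L \<alpha> v u)"
      by (rule first_variation_by_parts[OF bs K b0])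
    ultimately show "integral (cbox a b) (\<lambda>u. bump u0 r u * L \<alpha> v u) = 0" by simp
  qed
qed

end

section \<open>Curvature in charts\<close>

subsection \<open>Linear algebra of the Weingarten map\<close>

lemma scaleR_right_eqD: "a *\<^sub>R x = b *\<^sub>R x \<Longrightarrow> x \<noteq> 0 \<Longrightarrow> a = b" for x :: "'b::real_vector"
  by simp

lemma scaleR_left_eqD: "a *\<^sub>R x = a *\<^sub>R y \<Longrightarrow> a \<noteq> 0 \<Longrightarrow> x = y" for x :: "'b::real_vector"
  by simp

text \<open>The rotation by the half angle \<open>t / 2\<close>, where \<open>t\<close> is the polar angle of \<open>((a - d) / 2,
  b)\<close>, removes the off-diagonal entry of the symmetric matrix with entries \<open>a, b, b, d\<close>.\<close>

lemma symmetric_diagonalisation: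
  fixes a b d :: real
  shows "\<exists>c s. c\<^sup>2 + s\<^sup>2 = 1 \<and> (c\<^sup>2 - s\<^sup>2) * b + c * s * (d - a) = 0"
proof -
  obtain r t where rt: "(a - d) / 2 = r * cos t" "b = r * sin t" using polar_Ex by blast
  have e: "(cos (t/2))\<^sup>2 - (sin (t/2))\<^sup>2 = cos t" "sin t = 2 * sin (t/2) * cos (t/2)"
    using cos_double[of "t/2"] sin_double[of "t/2"] by simp_all
  have da: "d - a = - 2 * (r * cos t)" using rt(1) by simp
  have "((cos (t/2))\<^sup>2 - (sin (t/2))\<^sup>2) * b + cos (t/2) * sin (t/2) * (d - a) = 0"
    unfolding rt(2) e(1) da e(2) by simp
  then show ?thesis by (intro exI[of _ "cos (t/2)"] exI[of _ "sin (t/2)"]) simp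
qed

lemma ex_principal_basis:
  fixes L M :: "real^2 \<Rightarrow> real^3"
  assumes L: "linear L" and M: "linear M" and N: "N \<bullet> N = 1"
    and c: "cross3 (L (axis 1 1)) (L (axis 2 1)) = J *\<^sub>R N" "J \<noteq> 0"
    and MN: "\<And>v. M v \<bullet> N = 0" and sym: "L (axis 1 1) \<bullet> M (axis 2 1) = L (axis 2 1) \<bullet> M (axis 1 1)"
  shows "\<exists>v1 v2 \<kappa>1 \<kappa>2. L v1 \<bullet> L v1 = 1 \<and> L v2 \<bullet> L v2 = 1 \<and> L v1 \<bullet> L v2 = 0 \<and>
    M v1 = - \<kappa>1 *\<^sub>R L v1 \<and> M v2 = - \<kappa>2 *\<^sub>R L v2"
proof -
  let ?F1 = "L (axis 1 1)" and ?F2 = "L (axis 2 1)"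
  have Nn: "N = (1 / J) *\<^sub>R cross3 ?F1 ?F2" using c by simp
  have FN: "?F1 \<bullet> N = 0" "?F2 \<bullet> N = 0" unfolding Nn by (simp_all add: dot_cross_self)
  have surj: "\<exists>v. L v = T" if "T \<bullet> N = 0" for T
  proof -
    have "L ((T \<bullet> cross3 ?F2 N / J) *\<^sub>R axis 1 1 + (T \<bullet> cross3 N ?F1 / J) *\<^sub>R axis 2 1) = T"
      unfolding linear_add[OF L] linear_scale[OF L] by (rule tangent_coordinates[OF c N that, symmetric])
    then show ?thesis by blast
  qed
  have F1: "?F1 \<noteq> 0" using c N by auto
  define E1 where "E1 = sgn ?F1"
  define E2 where "E2 = cross3 N E1"
  have E1: "E1 \<bullet> E1 = 1" "E1 \<bullet> N = 0" unfolding E1_def using F1 FN(1) by (simp_all add: dot_square_norm norm_sgn sgn_div_norm)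
  note E = E1(1) N E1(2) E2_def
  note f = frame_inner[OF E]
  have f': "E2 \<bullet> E1 = 0" using f(2) by (simp add: inner_commute)
  obtain w1 where w1: "L w1 = E1" using surj[OF E1(2)] by blast
  obtain w2 where w2: "L w2 = E2" using surj[OF f(3)] by blast
  have sy: "L v \<bullet> M w = L w \<bullet> M v" for v w
    unfolding linear_vec2[OF L, of v] linear_vec2[OF L, of w] linear_vec2[OF M, of v] linear_vec2[OF M, of w]
    using sym by (simp add: inner_add_left inner_add_right algebra_simps)
  define a b d where abd: "a = - (M w1 \<bullet> E1)" "b = - (M w1 \<bullet> E2)" "d = - (M w2 \<bullet> E2)"
  have M1: "M w1 = - (a *\<^sub>R E1 + b *\<^sub>R E2)"
    by (rule trans[OF orthonormal_expansion[OF E, of "M w1"]]) (simp add: abd MN)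
  have "M w2 \<bullet> E1 = - b" unfolding abd w1[symmetric] w2[symmetric] using sy[of w1 w2] by (simp add: inner_commute)
  then have M2: "M w2 = - (b *\<^sub>R E1 + d *\<^sub>R E2)"
    by (intro trans[OF orthonormal_expansion[OF E, of "M w2"]]) (simp add: abd(3) MN)
  obtain x s where xs: "x\<^sup>2 + s\<^sup>2 = 1" "(x\<^sup>2 - s\<^sup>2) * b + x * s * (d - a) = 0" using symmetric_diagonalisation by blast
  define \<kappa>1 where "\<kappa>1 = x\<^sup>2 * a + 2 * x * s * b + s\<^sup>2 * d"
  define \<kappa>2 where "\<kappa>2 = s\<^sup>2 * a - 2 * x * s * b + x\<^sup>2 * d"
  have k: "x * a + s * b = \<kappa>1 * x" "x * b + s * d = \<kappa>1 * s" "x * b - s * a = - \<kappa>2 * s" "x * d - s * b = \<kappa>2 * x"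
    unfolding \<kappa>1_def \<kappa>2_def using xs by algebra+
  let ?v1 = "x *\<^sub>R w1 + s *\<^sub>R w2" and ?v2 = "(- s) *\<^sub>R w1 + x *\<^sub>R w2"
  have L1: "L ?v1 = x *\<^sub>R E1 + s *\<^sub>R E2" and L2: "L ?v2 = (- s) *\<^sub>R E1 + x *\<^sub>R E2"
    unfolding linear_add[OF L] linear_scale[OF L] w1 w2 by simp_all
  have "M ?v1 = - ((x * a + s * b) *\<^sub>R E1 + (x * b + s * d) *\<^sub>R E2)"
    unfolding linear_add[OF M] linear_scale[OF M] M1 M2 by (simp add: scaleR_add_right scaleR_add_left scaleR_diff_right scaleR_diff_left)
  then have m1: "M ?v1 = - \<kappa>1 *\<^sub>R L ?v1" unfolding L1 k by (simp add: scaleR_add_right)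
  have "M ?v2 = - ((x * b - s * a) *\<^sub>R E1 + (x * d - s * b) *\<^sub>R E2)"
    unfolding linear_add[OF M] linear_scale[OF M] M1 M2 by (simp add: scaleR_add_right scaleR_add_left scaleR_diff_right scaleR_diff_left)
  then have m2: "M ?v2 = - \<kappa>2 *\<^sub>R L ?v2" unfolding L2 k by (simp add: scaleR_add_right scaleR_diff_right)
  have "L ?v1 \<bullet> L ?v1 = 1" "L ?v2 \<bullet> L ?v2 = 1" "L ?v1 \<bullet> L ?v2 = 0"
    unfolding L1 L2 using xs(1) E1 f f' by (simp_all add: inner_add_left inner_add_right inner_diff_left inner_diff_right power2_eq_square add.commute)
  then show ?thesis using m1 m2 by blast
qed

text \<open>The three claims hold for the coordinate basis because they hold for the principal basis
  \<open>v\<^sub>1, v\<^sub>2\<close>: the first two are equations between alternating forms, the third between linear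
  maps.\<close>

lemma principal_basis_curvatures:
  fixes L M :: "real^2 \<Rightarrow> real^3"
  assumes L: "linear L" and M: "linear M"
    and v: "L v1 \<bullet> L v1 = 1" "L v2 \<bullet> L v2 = 1" "L v1 \<bullet> L v2 = 0" "M v1 = - \<kappa>1 *\<^sub>R L v1" "M v2 = - \<kappa>2 *\<^sub>R L v2"
  shows "cross3 (M (axis 1 1)) (M (axis 2 1)) = (\<kappa>1 * \<kappa>2) *\<^sub>R cross3 (L (axis 1 1)) (L (axis 2 1))"
    and "cross3 (L (axis 1 1)) (M (axis 2 1)) + cross3 (M (axis 1 1)) (L (axis 2 1)) = - (\<kappa>1 + \<kappa>2) *\<^sub>R cross3 (L (axis 1 1)) (L (axis 2 1))"
    and "\<kappa>1 = \<kappa>2 \<Longrightarrow> M w = - \<kappa>1 *\<^sub>R L w"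
proof -
  define dt where "dt = v1$1 * v2$2 - v1$2 * v2$1"
  have LL: "cross3 (L v1) (L v2) = dt *\<^sub>R cross3 (L (axis 1 1)) (L (axis 2 1))"
    unfolding linear_vec2[OF L, of v1] linear_vec2[OF L, of v2] cross3_det dt_def ..
  have MM: "cross3 (M v1) (M v2) = dt *\<^sub>R cross3 (M (axis 1 1)) (M (axis 2 1))"
    unfolding linear_vec2[OF M, of v1] linear_vec2[OF M, of v2] cross3_det dt_def ..
  have LM: "cross3 (L v1) (M v2) + cross3 (M v1) (L v2) = dt *\<^sub>R (cross3 (L (axis 1 1)) (M (axis 2 1)) + cross3 (M (axis 1 1)) (L (axis 2 1)))"
    unfolding linear_vec2[OF M, of v1] linear_vec2[OF M, of v2] linear_vec2[OF L, of v1] linear_vec2[OF L, of v2] cross3_alternating dt_def ..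
  have "norm (L v1) = 1" "norm (L v2) = 1" using v(1,2) by (simp_all add: norm_eq_1)
  then have "(norm (cross3 (L v1) (L v2)))\<^sup>2 = 1" using norm_cross_dot[of "L v1" "L v2"] v(3) by simp
  then have "cross3 (L v1) (L v2) \<noteq> 0" by auto
  then have dt: "dt \<noteq> 0" unfolding LL by auto
  have "dt *\<^sub>R cross3 (M (axis 1 1)) (M (axis 2 1)) = (\<kappa>1 * \<kappa>2) *\<^sub>R cross3 (L v1) (L v2)"
    unfolding MM[symmetric] v(4,5) cross_mult_left cross_mult_right by simp
  then have "dt *\<^sub>R cross3 (M (axis 1 1)) (M (axis 2 1)) = dt *\<^sub>R ((\<kappa>1 * \<kappa>2) *\<^sub>R cross3 (L (axis 1 1)) (L (axis 2 1)))"
    unfolding LL by (simp add: mult.commute)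
  then show "cross3 (M (axis 1 1)) (M (axis 2 1)) = (\<kappa>1 * \<kappa>2) *\<^sub>R cross3 (L (axis 1 1)) (L (axis 2 1))"
    using dt by (rule scaleR_left_eqD)
  have "dt *\<^sub>R (cross3 (L (axis 1 1)) (M (axis 2 1)) + cross3 (M (axis 1 1)) (L (axis 2 1))) = - (\<kappa>1 + \<kappa>2) *\<^sub>R cross3 (L v1) (L v2)"
    unfolding LM[symmetric] v(4,5) cross_mult_left cross_mult_right by (simp add: scaleR_diff_left)
  then have "dt *\<^sub>R (cross3 (L (axis 1 1)) (M (axis 2 1)) + cross3 (M (axis 1 1)) (L (axis 2 1))) = dt *\<^sub>R (- (\<kappa>1 + \<kappa>2) *\<^sub>R cross3 (L (axis 1 1)) (L (axis 2 1)))"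
    unfolding LL by (simp add: mult.commute)
  then show "cross3 (L (axis 1 1)) (M (axis 2 1)) + cross3 (M (axis 1 1)) (L (axis 2 1)) = - (\<kappa>1 + \<kappa>2) *\<^sub>R cross3 (L (axis 1 1)) (L (axis 2 1))"
    using dt by (rule scaleR_left_eqD)
  assume eq: "\<kappa>1 = \<kappa>2"
  define A where "A = (\<lambda>v. M v + \<kappa>1 *\<^sub>R L v)"
  have lA: "linear A" unfolding A_def by (intro linear_compose_add M linear_compose_scale_right L)
  have A0: "A v1 = 0" "A v2 = 0" unfolding A_def v(4,5) eq by simp_all
  let ?A1 = "A (axis 1 1)" and ?A2 = "A (axis 2 1)"
  have e: "v1$1 *\<^sub>R ?A1 + v1$2 *\<^sub>R ?A2 = 0" "v2$1 *\<^sub>R ?A1 + v2$2 *\<^sub>R ?A2 = 0"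
    using A0 linear_vec2[OF lA] by metis+
  have "dt *\<^sub>R ?A1 = v2$2 *\<^sub>R (v1$1 *\<^sub>R ?A1 + v1$2 *\<^sub>R ?A2) - v1$2 *\<^sub>R (v2$1 *\<^sub>R ?A1 + v2$2 *\<^sub>R ?A2)"
    unfolding dt_def by (simp add: scaleR_add_right scaleR_diff_left mult.commute)
  then have "?A1 = 0" unfolding e using dt by simp
  have "dt *\<^sub>R ?A2 = v1$1 *\<^sub>R (v2$1 *\<^sub>R ?A1 + v2$2 *\<^sub>R ?A2) - v2$1 *\<^sub>R (v1$1 *\<^sub>R ?A1 + v1$2 *\<^sub>R ?A2)"
    unfolding dt_def by (simp add: scaleR_add_right scaleR_diff_left mult.commute)
  then have "?A2 = 0" unfolding e using dt by simp
  then have "A w = 0" using linear_vec2[OF lA, of w] \<open>?A1 = 0\<close> by simp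
  then show "M w = - \<kappa>1 *\<^sub>R L w" unfolding A_def by (simp add: add_eq_0_iff2)
qed

context patch begin

lemma weingarten_symmetric:
  assumes u: "u \<in> D"
  shows "pd1 F u \<bullet> pd2 n u = pd2 F u \<bullet> pd1 n u"
proof -
  have "pd2 (pd1 F) u \<bullet> n u = - (pd1 F u \<bullet> pd2 n u)"
    using dir_deriv_orthogonal[OF D smooth_partials smooth_n n_tangent(1) u, of "\<lambda>_. axis 2 1"] unfolding dir_deriv_def .
  moreover have "pd1 (pd2 F) u \<bullet> n u = - (pd2 F u \<bullet> pd1 n u)"
    using dir_deriv_orthogonal[OF D smooth_partials smooth_n n_tangent(2) u, of "\<lambda>_. axis 1 1"] unfolding dir_deriv_def .
  ultimately show ?thesis unfolding second_derivative_symmetric[OF D F u, of "axis 2 1" "axis 1 1"] by simp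
qed

lemma ex_principal:
  assumes u: "u \<in> D"
  shows "\<exists>v1 v2 \<kappa>1 \<kappa>2. frechet_derivative F (at u) v1 \<bullet> frechet_derivative F (at u) v1 = 1 \<and>
    frechet_derivative F (at u) v2 \<bullet> frechet_derivative F (at u) v2 = 1 \<and>
    frechet_derivative F (at u) v1 \<bullet> frechet_derivative F (at u) v2 = 0 \<and>
    frechet_derivative n (at u) v1 = - \<kappa>1 *\<^sub>R frechet_derivative F (at u) v1 \<and>
    frechet_derivative n (at u) v2 = - \<kappa>2 *\<^sub>R frechet_derivative F (at u) v2"
  by (rule ex_principal_basis[OF has_derivative_linear[OF smooth_on_has_derivative[OF F u]]
        has_derivative_linear[OF smooth_on_has_derivative[OF smooth_n u]] n_unit[OF u] c_eq[of u, unfolded coord_cross_def] _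
        dn_tangent[OF u] weingarten_symmetric[OF u]])
    (use c0[OF u] in \<open>simp add: coord_cross_def\<close>)

lemma inj_differential: "u \<in> D \<Longrightarrow> inj (frechet_derivative F (at u))"
proof -
  assume u: "u \<in> D"
  note lin = has_derivative_linear[OF smooth_on_has_derivative[OF F u]]
  have J: "norm (c u) \<noteq> 0" using c0[OF u] by simp
  show ?thesis
  proof (rule linear_injective_0[OF lin, THEN iffD2], intro allI impI)
    fix v :: "real^2" assume "frechet_derivative F (at u) v = 0"
    then have z: "(v$1) *\<^sub>R pd1 F u + (v$2) *\<^sub>R pd2 F u = 0" using linear_vec2[OF lin, of v] by simp
    show "v = 0"
      using coordinates_unique[OF c_eq[of u, unfolded coord_cross_def] J[unfolded coord_cross_def] n_unit[OF u], of "v$1" "v$2"]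
      unfolding z by (simp add: vec_eq_iff forall_2)
  qed
qed

end

subsection \<open>Gauss map and Gauss curvature\<close>

locale immersed_surface = surface +
  fixes \<Phi> :: "'a \<Rightarrow> real^3"
  assumes imm: "smooth_immersion A \<Phi>" and nz: "0 \<notin> \<Phi> ` topspace X"
begin

lemma sm: "smooth_map A \<Phi>" using imm unfolding smooth_immersion_def by blast

lemma chart_at:
  assumes "p \<in> topspace X"
  obtains D x u where "chart_at A p = (D, x)" "(D, x) \<in> A" "u \<in> D" "p = x u"
proof -
  have "\<exists>c. c \<in> A \<and> p \<in> snd c ` fst c" using assms unfolding cover by fastforce
  then have "chart_at A p \<in> A \<and> p \<in> snd (chart_at A p) ` fst (chart_at A p)" unfolding chart_at_def by (rule someI_ex)
  then show thesis using that[of "fst (chart_at A p)" "snd (chart_at A p)"] by auto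
qed

abbreviation "N \<equiv> gauss_map A \<Phi>"

lemma gauss_map_chart:
  assumes c: "(D, x) \<in> A" and u: "u \<in> D"
  shows "N (x u) = sgn (coord_cross (\<Phi> \<circ> x) u)"
proof -
  have "x u \<in> topspace X" using chart_subset[OF c] u by blast
  then obtain D' y w where y: "chart_at A (x u) = (D', y)" "(D', y) \<in> A" "w \<in> D'" "x u = y w" by (rule chart_at)
  have xu: "x u \<in> y ` D'" using y by blast
  let ?\<tau> = "transition (D, x) (D', y)"
  have t: "?\<tau> u = the_inv_into D' y (x u)" unfolding transition_def by simp
  have "N (x u) = sgn (coord_cross (\<Phi> \<circ> y) (?\<tau> u))"
    unfolding gauss_map_def differential_def y(1) coord_cross_def t by simp
  also have "\<dots> = sgn (coord_cross (\<Phi> \<circ> x) u)"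
    unfolding coord_cross_transition[OF c y(2) sm u xu] using transition(3)[OF c y(2) u xu] by (simp add: sgn_scaleR)
  finally show ?thesis .
qed

lemma patch: "(D, x) \<in> A \<Longrightarrow> patch D (\<lambda>u. \<Phi> (x u))"
  by (rule patch_chart[OF _ imm nz])

lemma gauss_map_n: "(D, x) \<in> A \<Longrightarrow> u \<in> D \<Longrightarrow> patch.n (\<lambda>u. \<Phi> (x u)) u = N (x u)"
  unfolding patch.n_def[OF patch] gauss_map_chart by (simp add: o_def)

lemma smooth_gauss_map:
  assumes c: "(D, x) \<in> A" shows "smooth_on D (\<lambda>u. N (x u))"
  by (rule smooth_on_cong_open[OF chart(1)[OF c] gauss_map_n[OF c] patch.smooth_n[OF patch[OF c]]])

lemma frechet_gauss_map:
  assumes c: "(D, x) \<in> A" and u: "u \<in> D"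
  shows "frechet_derivative (\<lambda>u. N (x u)) (at u) = frechet_derivative (patch.n (\<lambda>u. \<Phi> (x u))) (at u)"
  using dir_deriv_cong_open[OF chart(1)[OF c] smooth_gauss_map[OF c] u gauss_map_n[OF c, symmetric], of "\<lambda>_. w" for w]
  unfolding dir_deriv_def by blast

text \<open>In the chart used for the tangent space at \<open>p\<close>. The product of the principal curvatures is
  determined by \<open>n\<^sub>1 \<times> n\<^sub>2 = K F\<^sub>1 \<times> F\<^sub>2\<close>, so the definite description of the Gauss curvature
  has a unique solution.\<close>

lemma gauss_curvature_chart_at:
  assumes p: "p \<in> topspace X" and y: "chart_at A p = (D, y)" "(D, y) \<in> A" "u \<in> D" "p = y u"
  shows "cross3 (pd1 (\<lambda>u. N (y u)) u) (pd2 (\<lambda>u. N (y u)) u) = gauss_curvature A \<Phi> p *\<^sub>R coord_cross (\<lambda>u. \<Phi> (y u)) u"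
proof -
  interpret patch D "\<lambda>u. \<Phi> (y u)" by (rule patch[OF y(2)])
  let ?L = "frechet_derivative (\<lambda>u. \<Phi> (y u)) (at u)" and ?M = "frechet_derivative n (at u)"
  have inv: "the_inv_into D y p = u" unfolding y(4) by (rule the_inv_into_f_f[OF chart_inj[OF y(2)] y(3)])
  have dL: "differential A \<Phi> p = ?L" unfolding differential_def y(1) Let_def prod.case inv by (simp add: o_def)
  have dM: "differential A N p = ?M" unfolding differential_def y(1) Let_def prod.case inv frechet_gauss_map[OF y(2,3), symmetric] by (simp add: o_def)
  note linL = has_derivative_linear[OF smooth_on_has_derivative[OF F y(3)]]
  note linM = has_derivative_linear[OF smooth_on_has_derivative[OF smooth_n y(3)]]
  note inj = inj_differential[OF y(3)]
  have pc: "principal_curvatures A \<Phi> p \<kappa>1 \<kappa>2 \<longleftrightarrow> (\<exists>v1 v2. ?L v1 \<bullet> ?L v1 = 1 \<and> ?L v2 \<bullet> ?L v2 = 1 \<and> ?L v1 \<bullet> ?L v2 = 0 \<and>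
      ?M v1 = - \<kappa>1 *\<^sub>R ?L v1 \<and> ?M v2 = - \<kappa>2 *\<^sub>R ?L v2)" for \<kappa>1 \<kappa>2
  proof -
    have neg: "- a = k *\<^sub>R b \<longleftrightarrow> a = - k *\<^sub>R b" for a b :: "real^3" and k by (metis minus_minus scaleR_minus_left)
    show ?thesis
      unfolding principal_curvatures_def tangent_plane_def shape_operator_def dL dM bex_simps(7) the_inv_f_f[OF inj] norm_eq_1 neg
      by simp
  qed
  have K: "cross3 (?M (axis 1 1)) (?M (axis 2 1)) = (\<kappa>1 * \<kappa>2) *\<^sub>R c u" if "principal_curvatures A \<Phi> p \<kappa>1 \<kappa>2" for \<kappa>1 \<kappa>2
  proof -
    from that[unfolded pc] obtain v1 v2 where v: "?L v1 \<bullet> ?L v1 = 1" "?L v2 \<bullet> ?L v2 = 1" "?L v1 \<bullet> ?L v2 = 0"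
      "?M v1 = - \<kappa>1 *\<^sub>R ?L v1" "?M v2 = - \<kappa>2 *\<^sub>R ?L v2" by (elim exE conjE)
    show ?thesis unfolding coord_cross_def by (rule principal_basis_curvatures(1)[OF linL linM v])
  qed
  obtain v1 v2 k1 k2 where "?L v1 \<bullet> ?L v1 = 1 \<and> ?L v2 \<bullet> ?L v2 = 1 \<and> ?L v1 \<bullet> ?L v2 = 0 \<and>
      ?M v1 = - k1 *\<^sub>R ?L v1 \<and> ?M v2 = - k2 *\<^sub>R ?L v2" using ex_principal[OF y(3)] by (elim exE)
  then have k: "principal_curvatures A \<Phi> p k1 k2" unfolding pc by (intro exI)
  have gc: "gauss_curvature A \<Phi> p = k1 * k2"
    unfolding gauss_curvature_def
  proof (rule the_equality)
    show "\<exists>\<kappa>\<^sub>1 \<kappa>\<^sub>2. principal_curvatures A \<Phi> p \<kappa>\<^sub>1 \<kappa>\<^sub>2 \<and> k1 * k2 = \<kappa>\<^sub>1 * \<kappa>\<^sub>2" using k by blast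
    fix K' assume "\<exists>\<kappa>\<^sub>1 \<kappa>\<^sub>2. principal_curvatures A \<Phi> p \<kappa>\<^sub>1 \<kappa>\<^sub>2 \<and> K' = \<kappa>\<^sub>1 * \<kappa>\<^sub>2"
    then obtain x1 x2 where x: "principal_curvatures A \<Phi> p x1 x2" "K' = x1 * x2" by blast
    have "(x1 * x2) *\<^sub>R c u = (k1 * k2) *\<^sub>R c u" by (rule trans[OF K[OF x(1), symmetric] K[OF k]])
    then show "K' = k1 * k2" unfolding x(2) using c0[OF y(3)] by (rule scaleR_right_eqD)
  qed
  show ?thesis unfolding gc frechet_gauss_map[OF y(2,3)] by (rule K[OF k])
qed

text \<open>Both sides are multiplied by the same Jacobian determinant under a change of charts.\<close>

lemma gauss_curvature_chart:
  assumes c: "(D, x) \<in> A" and u: "u \<in> D"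
  shows "cross3 (pd1 (\<lambda>u. N (x u)) u) (pd2 (\<lambda>u. N (x u)) u) = gauss_curvature A \<Phi> (x u) *\<^sub>R coord_cross (\<lambda>u. \<Phi> (x u)) u"
proof -
  have p: "x u \<in> topspace X" using chart_subset[OF c] u by blast
  then obtain D' y w where y: "chart_at A (x u) = (D', y)" "(D', y) \<in> A" "w \<in> D'" "x u = y w" by (rule chart_at)
  have xu: "x u \<in> y ` D'" using y by blast
  let ?\<tau> = "transition (D, x) (D', y)"
  have t: "?\<tau> u = w" unfolding transition_def using the_inv_into_f_f[OF chart_inj[OF y(2)] y(3)] y(4) by simp
  have uW: "u \<in> {u\<in>D. x u \<in> y ` D'}" using u xu by simp
  note lin\<tau> = has_derivative_linear[OF smooth_on_has_derivative[OF transition(2)[OF c y(2)] uW]]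
  have sN: "smooth_on D' (N \<circ> y)" using smooth_gauss_map[OF y(2)] by (simp add: o_def)
  note dN = frechet_derivative_at[OF frechet_transition[OF c y(2) sN u xu], symmetric]
  note linN = has_derivative_linear[OF smooth_on_has_derivative[OF sN y(3)]]
  have "cross3 (pd1 (N \<circ> x) u) (pd2 (N \<circ> x) u) = det (matrix (frechet_derivative ?\<tau> (at u))) *\<^sub>R cross3 (pd1 (N \<circ> y) w) (pd2 (N \<circ> y) w)"
    unfolding dN t by (rule matrix_det_cross3[OF linN lin\<tau>])
  also have "cross3 (pd1 (N \<circ> y) w) (pd2 (N \<circ> y) w) = gauss_curvature A \<Phi> (x u) *\<^sub>R coord_cross (\<Phi> \<circ> y) w"
    using gauss_curvature_chart_at[OF p y] by (simp add: o_def)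
  also have "det (matrix (frechet_derivative ?\<tau> (at u))) *\<^sub>R (gauss_curvature A \<Phi> (x u) *\<^sub>R coord_cross (\<Phi> \<circ> y) w)
      = gauss_curvature A \<Phi> (x u) *\<^sub>R coord_cross (\<Phi> \<circ> x) u"
    unfolding coord_cross_transition[OF c y(2) sm u xu] t by (simp add: mult.commute)
  finally show ?thesis by (simp add: o_def)
qed

subsection \<open>Locally constant functions\<close>

text \<open>Such a function is constant on the image of every small disc, so its level sets are open
  and closed.\<close>

lemma constant_if_derivative_zero:
  fixes f :: "'a \<Rightarrow> 'b::real_normed_vector"
  assumes conn: "connected_space X" and f: "\<And>D x u. (D, x) \<in> A \<Longrightarrow> u \<in> D \<Longrightarrow> ((\<lambda>u. f (x u)) has_derivative (\<lambda>v. 0)) (at u)"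
    and p: "p \<in> topspace X" "q \<in> topspace X"
  shows "f p = f q"
proof -
  have op: "openin X {z\<in>topspace X. Q (f z)}" for Q
    unfolding openin_subopen[of X "{z\<in>topspace X. Q (f z)}"]
  proof
    fix z assume z: "z \<in> {z\<in>topspace X. Q (f z)}"
    then obtain D x u where c: "(D, x) \<in> A" "u \<in> D" "z = x u" unfolding cover by auto
    obtain r where r: "r > 0" "ball u r \<subseteq> D" using chart(1)[OF c(1)] c(2) openE by blast
    have "f (x w) = f (x u)" if w: "w \<in> ball u r" for w
    proof (rule has_derivative_zero_unique[of "ball u r" "\<lambda>u. f (x u)"])
      show "convex (ball u r)" "w \<in> ball u r" "u \<in> ball u r" using w r by auto
      show "((\<lambda>u. f (x u)) has_derivative (\<lambda>v. 0)) (at v within ball u r)" if "v \<in> ball u r" for v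
        by (rule has_derivative_at_withinI[OF f[OF c(1)]]) (use that r in blast)
    qed
    then have "x ` ball u r \<subseteq> {z\<in>topspace X. Q (f z)}" using z c(3) r(2) chart_subset[OF c(1)] by auto
    moreover have "openin X (x ` ball u r)" by (rule open_image[OF c(1) open_ball r(2)])
    moreover have "z \<in> x ` ball u r" unfolding c(3) using r(1) by (intro imageI) simp
    ultimately show "\<exists>T. openin X T \<and> z \<in> T \<and> T \<subseteq> {z\<in>topspace X. Q (f z)}" by blast
  qed
  let ?T = "{z\<in>topspace X. f z = f p}"
  have "openin X ?T" by (rule op)
  moreover have "closedin X ?T"
  proof -
    have "topspace X - ?T = {z\<in>topspace X. f z \<noteq> f p}" by blast
    then show ?thesis unfolding closedin_def using op[of "\<lambda>z. z \<noteq> f p"] by auto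
  qed
  ultimately have "?T = {} \<or> ?T = topspace X" using conn unfolding connected_space_clopen_in by blast
  moreover have "p \<in> ?T" using p(1) by simp
  ultimately have "?T = topspace X" by blast
  then have "q \<in> ?T" using p(2) by simp
  then show ?thesis by simp
qed

subsection \<open>The classification\<close>

text \<open>\<open>H\<^sup>2 - 4 k = (\<kappa>\<^sub>1 - \<kappa>\<^sub>2)\<^sup>2\<close> cannot be positive anywhere, since it would be positive on an
  open set.\<close>

lemma umbilic:
  assumes \<alpha>: "\<alpha> \<noteq> 0" and st: "alpha_stationary \<alpha> X A \<Phi>" and K: "\<And>p. p \<in> topspace X \<Longrightarrow> gauss_curvature A \<Phi> p = k"
    and c: "(D, x) \<in> A" and u: "u \<in> D"
  defines "H \<equiv> \<lambda>p. \<alpha> * (\<Phi> p \<bullet> N p) / (\<Phi> p \<bullet> \<Phi> p)"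
  shows "(H (x u))\<^sup>2 = 4 * k"
    "frechet_derivative (\<lambda>u. N (x u)) (at u) v = - (H (x u) / 2) *\<^sub>R frechet_derivative (\<lambda>u. \<Phi> (x u)) (at u) v"
proof -
  interpret patch D "\<lambda>u. \<Phi> (x u)" by (rule patch[OF c])
  let ?F = "\<lambda>u. \<Phi> (x u)"
  have n: "n w = N (x w)" if "w \<in> D" for w by (rule gauss_map_n[OF c that])
  have mean: "cross3 (pd1 ?F w) (pd2 n w) + cross3 (pd1 n w) (pd2 ?F w) = - H (x w) *\<^sub>R coord_cross ?F w" if w: "w \<in> D" for w
    using mean_curvature_equation[OF w euler_lagrange[OF c imm nz st w]] n[OF w] unfolding H_def by simp
  have gauss: "cross3 (pd1 n w) (pd2 n w) = k *\<^sub>R coord_cross ?F w" if w: "w \<in> D" for w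
    using gauss_curvature_chart[OF c w] K[of "x w"] chart_subset[OF c] w unfolding frechet_gauss_map[OF c w] by auto
  obtain v1 v2 k1 k2 where v: "frechet_derivative ?F (at u) v1 \<bullet> frechet_derivative ?F (at u) v1 = 1"
    "frechet_derivative ?F (at u) v2 \<bullet> frechet_derivative ?F (at u) v2 = 1"
    "frechet_derivative ?F (at u) v1 \<bullet> frechet_derivative ?F (at u) v2 = 0"
    "frechet_derivative n (at u) v1 = - k1 *\<^sub>R frechet_derivative ?F (at u) v1"
    "frechet_derivative n (at u) v2 = - k2 *\<^sub>R frechet_derivative ?F (at u) v2"
    using ex_principal[OF u] by blast
  note pb = principal_basis_curvatures[OF has_derivative_linear[OF smooth_on_has_derivative[OF F u]]
      has_derivative_linear[OF smooth_on_has_derivative[OF smooth_n u]] v]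
  have "(k1 * k2) *\<^sub>R coord_cross ?F u = k *\<^sub>R coord_cross ?F u" unfolding coord_cross_def
    by (rule trans[OF pb(1)[symmetric] gauss[OF u, unfolded coord_cross_def]])
  then have kk: "k1 * k2 = k" using c0[OF u] by (rule scaleR_right_eqD)
  have "(- (k1 + k2)) *\<^sub>R coord_cross ?F u = (- H (x u)) *\<^sub>R coord_cross ?F u" unfolding coord_cross_def
    by (rule trans[OF pb(2)[symmetric] mean[OF u, unfolded coord_cross_def]])
  then have "- (k1 + k2) = - H (x u)" using c0[OF u] by (rule scaleR_right_eqD)
  then have hh: "k1 + k2 = H (x u)" by simp
  have sq: "(H (x u))\<^sup>2 - 4 * k = (k1 - k2)\<^sup>2" unfolding hh[symmetric] kk[symmetric] by algebra
  have smH: "smooth_on D (\<lambda>u. H (x u))"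
  proof -
    have "smooth_on D (\<lambda>u. \<alpha> * (?F u \<bullet> N (x u)) / (?F u \<bullet> ?F u))"
      by (rule smooth_on_divide[OF D smooth_on_mult[OF D smooth_on_const[OF D] smooth_on_inner[OF D F smooth_gauss_map[OF c]]] smooth_on_inner[OF D F F]])
        (use F0 in simp)
    then show ?thesis unfolding H_def .
  qed
  have "\<not> (H (x u))\<^sup>2 - 4 * k > 0"
  proof
    assume pos: "(H (x u))\<^sup>2 - 4 * k > 0"
    define W where "W = {w\<in>D. (H (x w))\<^sup>2 - 4 * k > 0}"
    have "continuous_on D (\<lambda>w. (H (x w))\<^sup>2 - 4 * k)" by (intro continuous_intros smooth_on_imp_continuous_on[OF smH])
    from continuous_open_preimage[OF this D open_greaterThan[of 0]]
    have W: "open W" unfolding W_def by (simp add: vimage_def Int_def)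
    have WD: "w \<in> D" if "w \<in> W" for w using that unfolding W_def by simp
    have sub: "W \<subseteq> D" using WD by blast
    show False
    proof (rule no_nonumbilic_patch[OF W _ smooth_on_subset[OF F sub] smooth_on_subset[OF smooth_n sub], where H = "\<lambda>w. H (x w)" and c = k and \<alpha> = \<alpha> and J = "\<lambda>w. norm (coord_cross ?F w)"])
      show "W \<noteq> {}" using u pos unfolding W_def by blast
      show "\<alpha> \<noteq> 0" by (rule \<alpha>)
      fix w assume w: "w \<in> W"
      note wD = WD[OF w]
      show "n w \<bullet> n w = 1" by (rule n_unit[OF wD])
      show "cross3 (pd1 ?F w) (pd2 ?F w) = norm (coord_cross ?F w) *\<^sub>R n w" using c_eq[of w] by (simp add: coord_cross_def)
      show "norm (coord_cross ?F w) \<noteq> 0" using c0[OF wD] by simp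
      show "cross3 (pd1 ?F w) (pd2 n w) + cross3 (pd1 n w) (pd2 ?F w) = - H (x w) *\<^sub>R cross3 (pd1 ?F w) (pd2 ?F w)"
        using mean[OF wD] unfolding coord_cross_def .
      show "cross3 (pd1 n w) (pd2 n w) = k *\<^sub>R cross3 (pd1 ?F w) (pd2 ?F w)" using gauss[OF wD] unfolding coord_cross_def .
      show "?F w \<noteq> 0" by (rule F0[OF wD])
      then show "H (x w) * (?F w \<bullet> ?F w) = \<alpha> * (?F w \<bullet> n w)" unfolding H_def n[OF wD] by simp
      show "(H (x w))\<^sup>2 - 4 * k > 0" using w unfolding W_def by simp
    qed
  qed
  then have "(k1 - k2)\<^sup>2 = 0" unfolding sq using zero_le_power2[of "k1 - k2"] by linarith
  then have k12: "k1 = k2" by simp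
  show "(H (x u))\<^sup>2 = 4 * k" using sq k12 by simp
  have "k1 = H (x u) / 2" using hh k12 by simp
  then show "frechet_derivative (\<lambda>u. N (x u)) (at u) v = - (H (x u) / 2) *\<^sub>R frechet_derivative ?F (at u) v"
    using pb(3)[OF k12, of v] unfolding frechet_gauss_map[OF c u] by simp
qed

text \<open>A totally umbilic surface. If \<open>k = 0\<close>, then \<open>H = 0\<close>, so the normal is constant and \<open>\<langle>N, \<Phi>\<rangle>
  = 0\<close> by the Euler--Lagrange equation. If \<open>k \<noteq> 0\<close>, then \<open>H\<close> is locally constant and the centre
  \<open>\<Phi> + (2 / H) N\<close> has derivative zero.\<close>

theorem plane_or_sphere:
  assumes \<alpha>: "\<alpha> \<noteq> 0" and conn: "connected_space X" and st: "alpha_stationary \<alpha> X A \<Phi>"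
    and K: "\<And>p. p \<in> topspace X \<Longrightarrow> gauss_curvature A \<Phi> p = k" and p0: "p0 \<in> topspace X"
  shows "(\<exists>P. affine P \<and> aff_dim P = 2 \<and> \<Phi> ` topspace X \<subseteq> P) \<or> (\<exists>c r. r > 0 \<and> \<Phi> ` topspace X \<subseteq> sphere c r)"
proof -
  define H where "H = (\<lambda>p. \<alpha> * (\<Phi> p \<bullet> N p) / (\<Phi> p \<bullet> \<Phi> p))"
  have um1: "(H (x u))\<^sup>2 = 4 * k" if "(D, x) \<in> A" "u \<in> D" for D x u
    unfolding H_def by (rule umbilic(1)[OF \<alpha> st _ that]) (rule K)
  have um2: "frechet_derivative (\<lambda>u. N (x u)) (at u) v = - (H (x u) / 2) *\<^sub>R frechet_derivative (\<lambda>u. \<Phi> (x u)) (at u) v"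
    if "(D, x) \<in> A" "u \<in> D" for D x u v
    unfolding H_def by (rule umbilic(2)[OF \<alpha> st _ that]) (rule K)
  have ch: "\<exists>D x u. (D, x) \<in> A \<and> u \<in> D \<and> p = x u" if "p \<in> topspace X" for p using that unfolding cover by auto
  have H2: "(H p)\<^sup>2 = 4 * k" if "p \<in> topspace X" for p using ch[OF that] um1 by blast
  have NN: "N p \<bullet> N p = 1" if p: "p \<in> topspace X" for p
  proof -
    obtain D x u where c: "(D, x) \<in> A" "u \<in> D" "p = x u" using ch[OF p] by blast
    show ?thesis using patch.n_unit[OF patch[OF c(1)] c(2)] gauss_map_n[OF c(1,2)] c(3) by simp
  qed
  have \<Phi>0: "\<Phi> p \<bullet> \<Phi> p \<noteq> 0" if p: "p \<in> topspace X" for p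
  proof
    assume "\<Phi> p \<bullet> \<Phi> p = 0"
    then have "0 \<in> \<Phi> ` topspace X" using p by (intro image_eqI[of _ _ p]) simp_all
    then show False using nz by (rule notE[rotated])
  qed
  have dF: "((\<lambda>u. \<Phi> (x u)) has_derivative frechet_derivative (\<lambda>u. \<Phi> (x u)) (at u)) (at u)" if "(D, x) \<in> A" "u \<in> D" for D x u
    by (rule smooth_on_has_derivative[OF smooth_map_chart[OF sm that(1)] that(2)])
  have dN: "((\<lambda>u. N (x u)) has_derivative frechet_derivative (\<lambda>u. N (x u)) (at u)) (at u)" if "(D, x) \<in> A" "u \<in> D" for D x u
    by (rule smooth_on_has_derivative[OF smooth_gauss_map[OF that(1)] that(2)])
  show ?thesis
  proof (cases "k = 0")
    case True
    have H0: "H p = 0" if "p \<in> topspace X" for p using H2[OF that] True by simp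
    have "N p = N p0" if p: "p \<in> topspace X" for p
    proof (rule constant_if_derivative_zero[OF conn _ p p0])
      fix D x u assume c: "(D, x) \<in> A" "u \<in> D"
      have "H (x u) = 0" using H0 chart_subset[OF c(1)] c(2) by blast
      then have "frechet_derivative (\<lambda>u. N (x u)) (at u) = (\<lambda>v. 0)" by (intro ext) (simp add: um2[OF c])
      then show "((\<lambda>u. N (x u)) has_derivative (\<lambda>v. 0)) (at u)" using dN[OF c] by simp
    qed
    moreover have "\<Phi> p \<bullet> N p = 0" if p: "p \<in> topspace X" for p
      using H0[OF p] \<alpha> \<Phi>0[OF p] unfolding H_def by simp
    ultimately have sub: "\<Phi> ` topspace X \<subseteq> {z. N p0 \<bullet> z = 0}" by (auto simp: inner_commute)
    have "N p0 \<noteq> 0" using NN[OF p0] by auto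
    then have "aff_dim {z. N p0 \<bullet> z = 0} = 2" by (simp add: aff_dim_hyperplane)
    with sub affine_hyperplane[of "N p0" 0] show ?thesis by (intro disjI1 exI[of _ "{z. N p0 \<bullet> z = 0}"] conjI)
  next
    case False
    have k: "k > 0" using H2[OF p0] False zero_le_power2[of "H p0"] by linarith
    have Hn: "H p \<noteq> 0" if "p \<in> topspace X" for p using H2[OF that] k by auto
    define g where "g = (\<lambda>p. 2 / H p)"
    have g2: "g p * g p = 1 / k" if "p \<in> topspace X" for p
    proof -
      have "g p * g p = 4 / (H p)\<^sup>2" unfolding g_def by (simp add: power2_eq_square)
      then show ?thesis unfolding H2[OF that] by simp
    qed
    define z where "z = (\<lambda>p. \<Phi> p + g p *\<^sub>R N p)"
    have zc: "z p = z p0" if p: "p \<in> topspace X" for p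
    proof (rule constant_if_derivative_zero[OF conn _ p p0])
      fix D x u assume c: "(D, x) \<in> A" "u \<in> D"
      note o = chart(1)[OF c(1)]
      have xt: "x w \<in> topspace X" if "w \<in> D" for w using chart_subset[OF c(1)] that by blast
      have sF: "smooth_on D (\<lambda>u. \<Phi> (x u))" and sN: "smooth_on D (\<lambda>u. N (x u))"
        using smooth_map_chart[OF sm c(1)] smooth_gauss_map[OF c(1)] .
      have "smooth_on D (\<lambda>u. H (x u))" unfolding H_def
        by (rule smooth_on_divide[OF o smooth_on_mult[OF o smooth_on_const[OF o] smooth_on_inner[OF o sF sN]] smooth_on_inner[OF o sF sF] \<Phi>0[OF xt]])
      from smooth_on_divide[OF o smooth_on_const[OF o] this Hn[OF xt]]
      have sg: "smooth_on D (\<lambda>u. g (x u))" unfolding g_def .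
      have gn: "g (x u) \<noteq> 0" unfolding g_def using Hn[OF xt[OF c(2)]] by simp
      note dg = smooth_on_has_derivative[OF sg c(2)]
      have g0: "frechet_derivative (\<lambda>u. g (x u)) (at u) v = 0" for v
      proof -
        have "dir_deriv (\<lambda>_. v) (\<lambda>u. g (x u) * g (x u)) u = dir_deriv (\<lambda>_. v) (\<lambda>u. 1 / k) u"
          by (rule dir_deriv_cong_open[OF o smooth_on_mult[OF o sg sg] c(2) g2[OF xt]])
        then show ?thesis unfolding dir_deriv_mult[OF sg sg c(2)] unfolding dir_deriv_def using gn by simp
      qed
      have "((\<lambda>u. z (x u)) has_derivative (\<lambda>v. frechet_derivative (\<lambda>u. \<Phi> (x u)) (at u) v +
          (g (x u) *\<^sub>R frechet_derivative (\<lambda>u. N (x u)) (at u) v + frechet_derivative (\<lambda>u. g (x u)) (at u) v *\<^sub>R N (x u)))) (at u)"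
        unfolding z_def by (rule has_derivative_add[OF dF[OF c] has_derivative_scaleR[OF dg dN[OF c]]])
      moreover have "g (x u) * (H (x u) / 2) = 1" unfolding g_def using Hn[OF xt[OF c(2)]] by simp
      then have "(\<lambda>v. frechet_derivative (\<lambda>u. \<Phi> (x u)) (at u) v +
          (g (x u) *\<^sub>R frechet_derivative (\<lambda>u. N (x u)) (at u) v + frechet_derivative (\<lambda>u. g (x u)) (at u) v *\<^sub>R N (x u))) = (\<lambda>v. 0)"
        unfolding g0 um2[OF c] by simp
      ultimately show "((\<lambda>u. z (x u)) has_derivative (\<lambda>v. 0)) (at u)" by simp
    qed
    have "\<Phi> p \<in> sphere (z p0) (sqrt (1 / k))" if p: "p \<in> topspace X" for p
    proof -
      have "dist (z p0) (\<Phi> p) = norm (g p *\<^sub>R N p)" unfolding zc[OF p, symmetric] unfolding z_def by (simp add: dist_norm)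
      also have "\<dots> = sqrt ((g p * g p) * (N p \<bullet> N p))" unfolding norm_eq_sqrt_inner by simp
      finally show ?thesis unfolding g2[OF p] NN[OF p] by simp
    qed
    then have "\<Phi> ` topspace X \<subseteq> sphere (z p0) (sqrt (1 / k))" by (rule image_subsetI)
    moreover have "sqrt (1 / k) > 0" using k by simp
    ultimately show ?thesis by (intro disjI2 exI conjI)
  qed
qed

end

theorem theorem1p1:
  fixes X :: "'a topology" and A :: "'a chart set"
    and \<Phi> :: "'a \<Rightarrow> real^3" and \<alpha> :: real
  assumes "\<alpha> \<noteq> 0"
    and "oriented_surface X A"
    and "connected_space X"
    and "smooth_immersion A \<Phi>"
    and "0 \<notin> \<Phi> ` topspace X"
    and "alpha_stationary \<alpha> X A \<Phi>"
    and "\<exists>c. \<forall>p\<in>topspace X. gauss_curvature A \<Phi> p = c"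
  shows "(\<exists>P. affine P \<and> aff_dim P = 2 \<and> \<Phi> ` topspace X \<subseteq> P) \<or>
         (\<exists>c r. r > 0 \<and> \<Phi> ` topspace X \<subseteq> sphere c r)"
proof (cases "topspace X = {}")
  case True
  have "(1::real) > 0 \<and> \<Phi> ` topspace X \<subseteq> sphere 0 1" unfolding True by simp
  then show ?thesis by blast
next
  case False
  then obtain p0 where p0: "p0 \<in> topspace X" by blast
  obtain k where k: "\<And>p. p \<in> topspace X \<Longrightarrow> gauss_curvature A \<Phi> p = k" using assms(7) by blast
  interpret immersed_surface X A \<Phi> using assms(2,4,5) by unfold_locales
  show ?thesis by (rule plane_or_sphere[OF assms(1,3,6) k p0])
qed

end
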